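(* Let $G$ be a generator signature of arity $n$ on domain size $4$ of full rank, with $\mathrm{rank}\,G(t)=4$ for some $1\leq t\leq n$, and let $M$ be a $2^{\ell}\times 4$ complex matrix of rank $4$ such that $\underline{G}=M^{\otimes n}G$ is the standard signature of a generator matchgate of arity $n\ell$. Let $\sigma,\tau\in\{0,1\}^{\ell}$ be such that $\mathrm{wt}(\sigma)$ and $\mathrm{wt}(\tau)$ have the same parity, the rows $\underline{G}(t)^{\sigma}$ and $\underline{G}(t)^{\tau}$ are linearly independent, and $\mathrm{wt}(\sigma\oplus\tau)$ is minimal among all pairs $u\neq v$ in $\{0,1\}^{\ell}$ with these two properties. Let $p_{1}<p_{2}$ be positions with $\sigma\oplus\tau=e_{p_{1}}\oplus e_{p_{2}}$, and let $M'$ be the $4\times 4$ submatrix of $M$ consisting of the rows indexed by $\sigma\oplus b_{1}e_{p_{1}}\oplus b_{2}e_{p_{2}}$ for $b_{1}b_{2}=00,01,10,11$ (in this order). Then $M'^{\otimes n}G$ is the standard signature of a generator matchgate of arity $2n$, and its $t$-th matrix form $(M'^{\otimes n}G)(t)$ has rank $4$.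
   Context: A matchgate is a planar graph $H$ with complex edge weights together with designated output nodes on the outer face (labelled in counterclockwise order); a generator matchgate has only output nodes. Its standard signature is the vector in $\mathbb{C}^{2^{m}}$ ($m$ the number of output nodes) whose entry indexed by $i_{1}\cdots i_{m}\in\{0,1\}^{m}$ (lexicographic order) is the sum over perfect matchings of $H-Z$ of the product of edge weights, $Z$ being the set of output nodes $j$ with $i_{j}=1$. Rows of $M$ are indexed by $\{0,1\}^{\ell}$ lexicographically. A generator signature of arity $n$ on domain size $k$ is $G=(G^{j_{1}\cdots j_{n}})\in\mathbb{C}^{k^{n}}$; $G(t)$ is the $k\times k^{n-1}$ matrix with rows indexed by $j_{t}$ and columns by the remaining indices in lexicographic order. $G$ is degenerate if $G=\gamma_{1}\otimes\cdots\otimes\gamma_{n}$ with $\gamma_{i}\in\mathbb{C}^{k}$, and of full rank if not degenerate and $\mathrm{rank}\,G(t)=k$ for some $t$. A vector in $\mathbb{C}^{2^{nb}}$ is indexed by $\alpha_{1}\cdots\alpha_{n}$ with blocks $\alpha_{i}\in\{0,1\}^{b}$, and its $t$-th matrix form is the $2^{b}\times 2^{(n-1)b}$ matrix with rows indexed by $\alpha_{t}$ and columns by the other blocks lexicographically; $\underline{G}(t)^{\alpha}$ denotes the row of $\underline{G}(t)$ indexed by $\alpha$ (here $b=\ell$). $\mathrm{wt}$ is Hamming weight, $\oplus$ bitwise XOR, and $e_{p}\in\{0,1\}^{\ell}$ has a single $1$ at position $p$. *)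

theory Defs
  imports "HOL-Analysis.Analysis" "Jordan_Normal_Form.DL_Rank"
begin

section \<open>Lexicographic indexing\<close>

text \<open>Vectors in \<open>C\<^sup>N\<close> and matrices are those of Jordan\_Normal\_Form, with entries numbered from 0.
  Tuples over \<open>{0..<k}\<close> and bit strings are lists, first component most significant, so that
  the numerical order of the indices is the lexicographic order of the tuples.\<close>

definition lex_index :: "nat \<Rightarrow> nat list \<Rightarrow> nat" where
  "lex_index k js = foldl (\<lambda>a j. k * a + j) 0 js"

definition lex_tuple :: "nat \<Rightarrow> nat \<Rightarrow> nat \<Rightarrow> nat list" where
  "lex_tuple k n c = map (\<lambda>i. c div k ^ (n - Suc i) mod k) [0..<n]"

lemma length_lex_tuple [simp]: "length (lex_tuple k n c) = n"
  by (simp add: lex_tuple_def)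

lemma lex_tuple_Suc: "lex_tuple k (Suc n) c = lex_tuple k n (c div k) @ [c mod k]"
proof -
  have "c div k ^ (n - i) = c div k div k ^ (n - Suc i)" if "i < n" for i
    using that by (simp flip: div_mult2_eq power_Suc add: Suc_diff_Suc)
  then show ?thesis by (auto simp: lex_tuple_def)
qed

lemma lex_index_lex_tuple:
  assumes "0 < k" "c < k ^ n"
  shows "lex_index k (lex_tuple k n c) = c"
  using assms(2)
proof (induction n arbitrary: c)
  case 0
  then show ?case by (simp add: lex_index_def lex_tuple_def)
next
  case (Suc n)
  then have "c div k < k ^ n"
    by (simp add: less_mult_imp_div_less mult.commute)
  with Suc.IH show ?case
    using assms(1) by (simp add: lex_tuple_Suc lex_index_def)
qed

definition bits_index :: "bool list \<Rightarrow> nat" where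
  "bits_index \<alpha> = lex_index 2 (map of_bool \<alpha>)"

definition wt :: "bool list \<Rightarrow> nat" where
  "wt \<alpha> = length (filter (\<lambda>b. b) \<alpha>)"

definition bxor :: "bool list \<Rightarrow> bool list \<Rightarrow> bool list"  (infixl "\<oplus>\<^sub>b" 65) where
  "\<alpha> \<oplus>\<^sub>b \<beta> = map2 (\<lambda>a b. a \<noteq> b) \<alpha> \<beta>"

text \<open>Positions are counted from 1.\<close>

definition unit_bits :: "nat \<Rightarrow> nat \<Rightarrow> bool list" where
  "unit_bits l p = map (\<lambda>i. i = p) [1..<Suc l]"

definition scale_bits :: "bool \<Rightarrow> bool list \<Rightarrow> bool list" where
  "scale_bits b \<alpha> = map (\<lambda>a. b \<and> a) \<alpha>"


section \<open>Tensors\<close>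

definition kron_mat :: "complex Matrix.mat \<Rightarrow> complex Matrix.mat \<Rightarrow> complex Matrix.mat" where
  "kron_mat A B = Matrix.mat (dim_row A * dim_row B) (dim_col A * dim_col B)
     (\<lambda>(i, j). A $$ (i div dim_row B, j div dim_col B) * B $$ (i mod dim_row B, j mod dim_col B))"

primrec tensor_power :: "complex Matrix.mat \<Rightarrow> nat \<Rightarrow> complex Matrix.mat" where
  "tensor_power A 0 = 1\<^sub>m 1"
| "tensor_power A (Suc n) = kron_mat A (tensor_power A n)"

definition kron_vec :: "complex Matrix.vec \<Rightarrow> complex Matrix.vec \<Rightarrow> complex Matrix.vec" where
  "kron_vec u v = Matrix.vec (dim_vec u * dim_vec v)
     (\<lambda>i. vec_index u (i div dim_vec v) * vec_index v (i mod dim_vec v))"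

definition tensor_vecs :: "complex Matrix.vec list \<Rightarrow> complex Matrix.vec" where
  "tensor_vecs \<gamma>s = foldr kron_vec \<gamma>s (Matrix.vec 1 (\<lambda>_. 1))"

text \<open>\<open>G(t)\<close> for \<open>G\<close> in \<open>C\<^sup>k\<^sup>^\<^sup>n\<close> and \<open>1 \<le> t \<le> n\<close>: the row index \<open>r\<close> is inserted as \<open>t\<close>-th component
  into the \<open>n - 1\<close> remaining indices encoded by the column \<open>c\<close>.  The \<open>t\<close>-th matrix form of a vector
  in \<open>C\<^sup>2\<^sup>^\<^sup>(\<^sup>n\<^sup>b\<^sup>)\<close> with blocks of length \<open>b\<close> is the case \<open>k = 2 ^ b\<close>, since the index of a
  concatenation of blocks is the base \<open>2 ^ b\<close> number whose digits are the indices of the blocks.\<close>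

definition matrix_form :: "nat \<Rightarrow> nat \<Rightarrow> complex Matrix.vec \<Rightarrow> nat \<Rightarrow> complex Matrix.mat" where
  "matrix_form k n G t = Matrix.mat k (k ^ (n - 1))
     (\<lambda>(r, c). let js = lex_tuple k (n - 1) c
               in vec_index G (lex_index k (take (t - 1) js @ r # drop (t - 1) js)))"

definition block_matrix_form :: "nat \<Rightarrow> nat \<Rightarrow> complex Matrix.vec \<Rightarrow> nat \<Rightarrow> complex Matrix.mat" where
  "block_matrix_form b n v t = matrix_form (2 ^ b) n v t"

definition block_row ::
  "nat \<Rightarrow> nat \<Rightarrow> complex Matrix.vec \<Rightarrow> nat \<Rightarrow> bool list \<Rightarrow> complex Matrix.vec" where
  "block_row b n v t \<alpha> = Matrix.row (block_matrix_form b n v t) (bits_index \<alpha>)"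

definition generator_signature :: "nat \<Rightarrow> nat \<Rightarrow> complex Matrix.vec \<Rightarrow> bool" where
  "generator_signature k n G \<longleftrightarrow> G \<in> carrier_vec (k ^ n)"

definition degenerate :: "nat \<Rightarrow> nat \<Rightarrow> complex Matrix.vec \<Rightarrow> bool" where
  "degenerate k n G \<longleftrightarrow>
     (\<exists>\<gamma>s. length \<gamma>s = n \<and> set \<gamma>s \<subseteq> carrier_vec k \<and> G = tensor_vecs \<gamma>s)"

definition full_rank :: "nat \<Rightarrow> nat \<Rightarrow> complex Matrix.vec \<Rightarrow> bool" where
  "full_rank k n G \<longleftrightarrow> \<not> degenerate k n G \<and>
     (\<exists>t. 1 \<le> t \<and> t \<le> n \<and> vec_space.rank k (matrix_form k n G t) = k)"

text \<open>Linear independence of the family \<open>u, v\<close>: equal vectors are dependent, although the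
  set \<open>{u, v}\<close> may then be independent.\<close>

definition lin_indpt_pair :: "complex Matrix.vec \<Rightarrow> complex Matrix.vec \<Rightarrow> bool" where
  "lin_indpt_pair u v \<longleftrightarrow> u \<noteq> v \<and>
     \<not> module.lin_dep class_ring (module_vec TYPE(complex) (dim_vec u)) {u, v}"

text \<open>\<open>M'\<close>: the rows of \<open>M\<close> indexed by \<open>\<sigma> \<oplus> b\<^sub>1 e\<^bsub>p\<^sub>1\<^esub> \<oplus> b\<^sub>2 e\<^bsub>p\<^sub>2\<^esub>\<close>.\<close>

definition four_rows ::
  "nat \<Rightarrow> complex Matrix.mat \<Rightarrow> bool list \<Rightarrow> nat \<Rightarrow> nat \<Rightarrow> complex Matrix.mat" where
  "four_rows l M \<sigma> p1 p2 = mat_of_rows (dim_col M)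
     (map (\<lambda>(b1, b2). Matrix.row M (bits_index
              (\<sigma> \<oplus>\<^sub>b scale_bits b1 (unit_bits l p1) \<oplus>\<^sub>b scale_bits b2 (unit_bits l p2))))
          [(False, False), (False, True), (True, False), (True, True)])"


section \<open>Matchgates\<close>

record 'v wgraph =
  gverts :: "'v set"
  gedges :: "'v set set"
  gweight :: "'v set \<Rightarrow> complex"

definition finite_graph :: "'v wgraph \<Rightarrow> bool" where
  "finite_graph H \<longleftrightarrow> finite (gverts H) \<and> (\<forall>e\<in>gedges H. e \<subseteq> gverts H \<and> card e = 2)"

definition remove_verts :: "'v wgraph \<Rightarrow> 'v set \<Rightarrow> 'v wgraph" where
  "remove_verts H Z =
     H\<lparr>gverts := gverts H - Z, gedges := {e \<in> gedges H. e \<inter> Z = {}}\<rparr>"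

definition perfect_matchings :: "'v wgraph \<Rightarrow> 'v set set set" where
  "perfect_matchings H = {F. F \<subseteq> gedges H \<and> (\<forall>v\<in>gverts H. \<exists>!e. e \<in> F \<and> v \<in> e)}"

definition perf_match_sum :: "'v wgraph \<Rightarrow> complex" where
  "perf_match_sum H = (\<Sum>F\<in>perfect_matchings H. \<Prod>e\<in>F. gweight H e)"

definition plane_drawing ::
  "'v wgraph \<Rightarrow> ('v \<Rightarrow> complex) \<Rightarrow> ('v set \<Rightarrow> real \<Rightarrow> complex) \<Rightarrow> bool" where
  "plane_drawing H pos cur \<longleftrightarrow>
     inj_on pos (gverts H) \<and>
     (\<forall>e\<in>gedges H. arc (cur e) \<and> {pathstart (cur e), pathfinish (cur e)} = pos ` e) \<and>
     (\<forall>e\<in>gedges H. \<forall>v\<in>gverts H. pos v \<in> path_image (cur e) \<longrightarrow> v \<in> e) \<and>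
     (\<forall>e\<in>gedges H. \<forall>f\<in>gedges H. e \<noteq> f \<longrightarrow>
        path_image (cur e) \<inter> path_image (cur f) = pos ` (e \<inter> f))"

definition drawing_set ::
  "'v wgraph \<Rightarrow> ('v \<Rightarrow> complex) \<Rightarrow> ('v set \<Rightarrow> real \<Rightarrow> complex) \<Rightarrow> complex set" where
  "drawing_set H pos cur = pos ` gverts H \<union> (\<Union>e\<in>gedges H. path_image (cur e))"

text \<open>The outer face of a drawing with point set \<open>D\<close> is \<open>outside D\<close>, the unbounded component of the
  complement of \<open>D\<close>.  The points \<open>ps\<close> lie on it in counterclockwise order if they can be joined
  through the outer face, by pairwise disjoint arcs, to points of a large circle enclosing \<open>D\<close> that
  are met in this order when the circle is traversed once counterclockwise (from any starting
  point).  The arcs are the dangling external edges of the matchgate; this formulation also covers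
  boundary walks of the outer face that pass several times through a vertex, and disconnected
  graphs.\<close>

definition ccw_on_outer_face :: "complex set \<Rightarrow> complex list \<Rightarrow> bool" where
  "ccw_on_outer_face D ps \<longleftrightarrow>
     set ps \<subseteq> frontier (outside D) \<and>
     (\<exists>(R::real) (\<theta> :: nat \<Rightarrow> real) (g :: nat \<Rightarrow> real \<Rightarrow> complex).
        0 < R \<and> D \<subseteq> ball 0 R \<and>
        (\<forall>j<length ps.
           arc (g j) \<and> pathstart (g j) = ps ! j \<and> pathfinish (g j) = of_real R * cis (\<theta> j) \<and>
           path_image (g j) - {pathstart (g j)} \<subseteq> outside D \<and>
           path_image (g j) - {pathfinish (g j)} \<subseteq> ball 0 R) \<and>
        (\<forall>i<length ps. \<forall>j<length ps. i \<noteq> j \<longrightarrow> path_image (g i) \<inter> path_image (g j) = {}) \<and>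
        (\<forall>i j. i < j \<and> j < length ps \<longrightarrow> \<theta> i < \<theta> j \<and> \<theta> j < \<theta> i + 2 * pi))"

text \<open>A generator matchgate with output nodes \<open>outs\<close>, in order of their labels.\<close>

definition generator_matchgate :: "'v wgraph \<Rightarrow> 'v list \<Rightarrow> bool" where
  "generator_matchgate H outs \<longleftrightarrow>
     finite_graph H \<and> distinct outs \<and> set outs \<subseteq> gverts H \<and>
     (\<exists>pos cur. plane_drawing H pos cur \<and>
        ccw_on_outer_face (drawing_set H pos cur) (map pos outs))"

definition standard_signature :: "'v wgraph \<Rightarrow> 'v list \<Rightarrow> complex Matrix.vec" where
  "standard_signature H outs = (let m = length outs in
     Matrix.vec (2 ^ m) (\<lambda>i. perf_match_sum
       (remove_verts H {outs ! j | j. j < m \<and> lex_tuple 2 m i ! j = 1})))"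

text \<open>Vertices in \<open>nat\<close> are no restriction, the graphs being finite.\<close>

definition is_generator_matchgate_signature :: "nat \<Rightarrow> complex Matrix.vec \<Rightarrow> bool" where
  "is_generator_matchgate_signature m v \<longleftrightarrow>
     (\<exists>(H :: nat wgraph) outs. generator_matchgate H outs \<and> length outs = m \<and>
        v = standard_signature H outs)"

end

(*
  Number the outputs and write Gamma X for the perfect matching sum of H - X, X a set of outputs.
  Superposing a matching of H - (A + p) with one of H - (B + p), where + is symmetric difference,
  gives paths that join the outputs of A + B in pairs.  These paths are disjoint, so the pairing is
  noncrossing by planarity; exchanging the two matchings along the path that starts at p is a
  sign-reversing involution, and this gives the matchgate identity

    sum over p in A + B of (-1)^(number of q < p in A + B) * Gamma (A + p) * Gamma (B + p) = 0.

  Let S and T = S + P1 + P2 be the bits of sigma and tau in block t.  The identity for the sets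
  (S + P1) b and (S + P2) c, antisymmetrised in the two columns b and c, writes twice their minor of
  the rows sigma, tau as a signed sum of minors of the rows sigma + e_p1, sigma + e_p2; hence these
  two rows are independent as well.  As the nonzero entries of Gamma have a fixed parity, the two
  pairs of rows live on complementary sets of columns, so all four rows are independent and M' is
  invertible.  That (M' tensor ... tensor M') G is a matchgate signature is seen by attaching
  pendant edges at the outputs where sigma has a 1, which complements these bits, and by declaring
  only the outputs p1, p2 of each block to be outputs.
*)

theory Submission
  imports Defs
begin

section \<open>Crossing paths in a disc\<close>

text \<open>Planarity is used through one topological fact: disjoint connected pieces of a drawing
  cannot join output a to c and output b to d when a < b < c < d. The dangling arcs that fix the
  cyclic order in \<open>ccw_on_outer_face\<close> prolong such pieces to paths in a disc with
  interlaced ends on its circle, and these must cross. From there on the identity is finite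
  combinatorics of edge sets; no Pfaffian orientation has to be chosen. Invertibility of
  \<open>M'\<close> settles the rank because the \<open>t\<close>-th matrix form of the new
  signature is G(t) multiplied by \<open>M'\<close> on the left and by the transpose of
  \<open>tensor_power M' (n - 1)\<close> on the right. To obtain it, the matrix form of the given
  signature is written as \<open>M * Z\<close> with one fixed \<open>Z\<close>: a linear relation
  between the rows of \<open>M'\<close> is inherited by the four corresponding rows of matching
  sums, where the identity can refute it. The minor that the identity produces lies in columns other
  than those of the given minor, so it matters that every set of outputs outside block
  \<open>t\<close> is a column.\<close>

lemma disc_to_half_plane:
  assumes "0 < t" "t < 2 * pi"
  shows "\<i> * (1 + cis t) / (1 - cis t) = of_real (- cot (t / 2))" "cis t \<noteq> 1"
proof -
  have s: "sin (t / 2) > 0"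
    using assms by (intro sin_gt_zero) auto
  have c: "cis t = cis (t / 2) * cis (t / 2)"
    by (simp add: cis_mult)
  \<comment> \<open>With 1 and \<open>cis t\<close> both written as products containing
    \<open>cis (t / 2)\<close>, this factor cancels in the quotient and a cosine over a sine of the
    half angle remains.\<close>
  have one: "1 = cis (t / 2) * cis (- (t / 2))"
    by (simp add: cis_mult)
  have "1 + cis t = cis (t / 2) * (cis (- (t / 2)) + cis (t / 2))"
    by (subst one, subst c) (simp only: distrib_left)
  also have "cis (- (t / 2)) + cis (t / 2) = of_real (2 * cos (t / 2))"
    by (simp add: complex_eq_iff)
  finally have p: "1 + cis t = cis (t / 2) * of_real (2 * cos (t / 2))" .
  have "1 - cis t = cis (t / 2) * (cis (- (t / 2)) - cis (t / 2))"
    by (subst one, subst c) (simp only: right_diff_distrib)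
  also have "cis (- (t / 2)) - cis (t / 2) = - \<i> * of_real (2 * sin (t / 2))"
    by (simp add: complex_eq_iff)
  finally have m: "1 - cis t = cis (t / 2) * (- \<i> * of_real (2 * sin (t / 2)))" .
  have "1 - cis t \<noteq> 0"
    using s by (simp add: m)
  then show "cis t \<noteq> 1" by auto
  show "\<i> * (1 + cis t) / (1 - cis t) = of_real (- cot (t / 2))"
    using s by (simp add: p m cot_def field_simps)
qed

text \<open>Together with \<open>disc_to_half_plane\<close> this makes the Cayley transform
  increasing in the angle, so four points in order on the circle keep their order on the real
  line.\<close>

lemma cot_less:
  assumes "0 < x" "x < y" "y < pi"
  shows "cot y < cot (x::real)"
proof -
  have s: "sin x > 0" "sin y > 0" "sin (y - x) > 0"
    using assms by (auto intro!: sin_gt_zero)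
  have "cot x - cot y = sin (y - x) / (sin x * sin y)"
    using s by (simp add: cot_def sin_diff field_simps)
  also have "\<dots> > 0" using s by simp
  finally show ?thesis by simp
qed

lemma vector_2_eq_lambda: "vector [x, y] = (\<chi> i::2. if i = 1 then x else (y::'a::zero))"
  by (simp add: Finite_Cartesian_Product.vec_eq_iff forall_2)

lemma continuous_vector_2 [continuous_intros]:
  fixes f g :: "'a::topological_space \<Rightarrow> real"
  assumes "continuous_on S f" "continuous_on S g"
  shows "continuous_on S (\<lambda>x. vector [f x, g x] :: real^2)"
  unfolding vector_2_eq_lambda
proof (intro continuous_on_vec_lambda)
  show "continuous_on S (\<lambda>x. if i = 1 then f x else g x)" for i :: 2
    using assms by (cases "i = 1") auto
qed

text \<open>\<open>fashoda_interlace\<close> speaks of paths in a box of \<open>real^2\<close> whose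
  ends interlace on the lower edge. Both paths are bounded, so the half plane can be cut down to
  such a box; \<open>h\<close> only changes the type of the plane.\<close>

lemma half_plane_paths_cross:
  fixes f g :: "real \<Rightarrow> complex"
  assumes "path f" "path g"
    and "path_image f \<subseteq> {z. 0 \<le> Im z}" "path_image g \<subseteq> {z. 0 \<le> Im z}"
    and "Im (pathstart f) = 0" "Im (pathfinish f) = 0"
    and "Im (pathstart g) = 0" "Im (pathfinish g) = 0"
    and "Re (pathstart f) < Re (pathstart g)" "Re (pathstart g) < Re (pathfinish f)"
    and "Re (pathfinish f) < Re (pathfinish g)"
  shows "path_image f \<inter> path_image g \<noteq> {}"
proof -
  define h :: "complex \<Rightarrow> real^2" where "h = (\<lambda>z. vector [Re z, Im z])"
  have h1: "h z $ 1 = Re z" and h2: "h z $ 2 = Im z" for z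
    by (simp_all add: h_def)
  have ch: "continuous_on S h" for S
    unfolding h_def
    by (auto intro!: continuous_intros)
  have "bounded (path_image f \<union> path_image g)"
    by (simp add: assms bounded_path_image)
  then obtain B where B: "\<And>z. z \<in> path_image f \<union> path_image g \<Longrightarrow> norm z \<le> B"
    by (auto simp: bounded_iff)
  define a b :: "real^2" where "a = vector [-B, 0]" and "b = vector [B, B]"
  have box: "h z \<in> cbox a b" if "z \<in> path_image f \<union> path_image g" for z
  proof -
    have "\<bar>Re z\<bar> \<le> B" "\<bar>Im z\<bar> \<le> B"
      using B[OF that] abs_Re_le_cmod[of z] abs_Im_le_cmod[of z] by linarith+
    moreover have "0 \<le> Im z" using assms(3,4) that by blast
    ultimately show ?thesis by (simp add: mem_box_cart forall_2 a_def b_def h1 h2 abs_le_iff)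
  qed
  obtain z where z: "z \<in> path_image (h \<circ> f)" "z \<in> path_image (h \<circ> g)"
  proof (rule fashoda_interlace[of "h \<circ> f" "h \<circ> g" a b])
    show "path (h \<circ> f)" "path (h \<circ> g)"
      by (auto intro!: path_continuous_image assms ch)
    show "path_image (h \<circ> f) \<subseteq> cbox a b" "path_image (h \<circ> g) \<subseteq> cbox a b"
      using box by (auto simp: path_image_compose)
  qed (use assms in \<open>auto simp: pathstart_compose pathfinish_compose h1 h2 a_def\<close>)
  have "inj h"
    by (rule injI) (metis h1 h2 complex_eqI)
  then show ?thesis
    using z by (auto simp: path_image_compose dest: injD)
qed

text \<open>A Cayley transform that sends to infinity a boundary point between the arguments \<open>d\<close> and
  \<open>a + 2 * pi\<close> reduces the disc to the half plane.\<close>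

lemma disc_paths_cross:
  fixes f g :: "real \<Rightarrow> complex"
  assumes R: "0 < R" and pf: "path f" and pg: "path g"
    and f: "path_image f \<subseteq> ball 0 R \<union> {pathstart f, pathfinish f}"
    and g: "path_image g \<subseteq> ball 0 R \<union> {pathstart g, pathfinish g}"
    and ends: "pathstart f = of_real R * cis a" "pathfinish f = of_real R * cis c"
      "pathstart g = of_real R * cis b" "pathfinish g = of_real R * cis d"
    and order: "a < b" "b < c" "c < d" "d < a + 2 * pi"
  shows "path_image f \<inter> path_image g \<noteq> {}"
proof -
  \<comment> \<open>The angle halfway between \<open>d - 2 * pi\<close> and \<open>a\<close>.
    Measured from it, all four angles lie strictly between 0 and \<open>2 * pi\<close>, so the pole
    of \<open>q\<close> is on neither path.\<close>
  define \<phi> where "\<phi> = (d - 2 * pi + a) / 2"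
  define w where "w = (\<lambda>z. z / (of_real R * cis \<phi>))"
  define q where "q = (\<lambda>z. \<i> * (1 + w z) / (1 - w z))"
  have w_cis: "w (of_real R * cis x) = cis (x - \<phi>)" for x
    using R by (simp add: w_def cis_divide)
  have w_norm: "norm (w z) = norm z / R" for z
    using R by (simp add: w_def norm_divide norm_mult)
  have dom: "0 < x - \<phi> \<and> x - \<phi> < 2 * pi" if "x \<in> {a, b, c, d}" for x
    using order that unfolding \<phi>_def by (auto simp: field_simps)
  have w1: "norm (w z) \<le> 1 \<and> w z \<noteq> 1" if "z \<in> path_image f \<union> path_image g" for z
  proof (cases "norm z < R")
    case True
    then have "norm (w z) < 1" using R by (simp add: w_norm)
    then show ?thesis by auto
  next
    case False
    then have "z \<notin> ball 0 R" by simp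
    then have "z \<in> {pathstart f, pathfinish f, pathstart g, pathfinish g}"
      using that f g by blast
    then obtain x where x: "x \<in> {a, b, c, d}" "z = of_real R * cis x"
      using ends by blast
    then show ?thesis
      using disc_to_half_plane(2)[of "x - \<phi>"] dom[OF x(1)] by (simp add: w_cis)
  qed
  have q_cis: "q (of_real R * cis x) = of_real (- cot ((x - \<phi>) / 2))" if "x \<in> {a, b, c, d}" for x
    using disc_to_half_plane(1)[of "x - \<phi>"] dom[OF that] by (simp add: q_def w_cis)
  have q_less: "Re (q (of_real R * cis x)) < Re (q (of_real R * cis y))"
    if "x \<in> {a, b, c, d}" "y \<in> {a, b, c, d}" "x < y" for x y
    using cot_less[of "(x - \<phi>) / 2" "(y - \<phi>) / 2"] dom[OF that(1)] dom[OF that(2)] that(3)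
    unfolding q_cis[OF that(1)] q_cis[OF that(2)] by simp
  have q_Im: "0 \<le> Im (q z)" if "z \<in> path_image f \<union> path_image g" for z
  proof -
    have "Im (q z) = Re ((1 + w z) / (1 - w z))"
      by (simp add: q_def flip: times_divide_eq_right)
    also have "\<dots> = Re ((1 + w z) * cnj (1 - w z)) / (norm (1 - w z))\<^sup>2"
      by (subst complex_div_cnj) (simp flip: of_real_power)
    also have "Re ((1 + w z) * cnj (1 - w z)) = 1 - (norm (w z))\<^sup>2"
      by (simp add: cmod_def power2_eq_square algebra_simps)
    finally show ?thesis
      using w1[OF that] by (simp add: power_le_one)
  qed
  have cq: "continuous_on (path_image f \<union> path_image g) q"
    unfolding q_def
    using w1 R by (intro continuous_intros) (auto simp: w_def intro!: continuous_intros)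
  have "path_image (q \<circ> f) \<inter> path_image (q \<circ> g) \<noteq> {}"
  proof (rule half_plane_paths_cross)
    show "path (q \<circ> f)" "path (q \<circ> g)"
      by (auto intro!: path_continuous_image pf pg continuous_on_subset[OF cq])
  qed (use q_Im q_less order in \<open>auto simp: path_image_compose pathstart_compose pathfinish_compose
         ends q_cis\<close>)
  then obtain x y where xy: "x \<in> path_image f" "y \<in> path_image g" "q x = q y"
    by (auto simp: path_image_compose)
  then have "(1 + w x) * (1 - w y) = (1 + w y) * (1 - w x)"
    using w1[of x] w1[of y] by (auto simp: q_def field_simps)
  then have "w x = w y" by (simp add: algebra_simps)
  then have "x = y" using R by (simp add: w_def)
  then show ?thesis using xy by blast
qed

section \<open>Components of plane drawings\<close>

definition edge_rel :: "'v set set \<Rightarrow> ('v \<times> 'v) set" where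
  "edge_rel F = {(x, y). {x, y} \<in> F}"

lemma sym_edge_rel: "sym (edge_rel F)"
  by (auto simp: edge_rel_def sym_def insert_commute)

lemma edge_rel_rtrancl_sym: "(x, y) \<in> (edge_rel F)\<^sup>* \<Longrightarrow> (y, x) \<in> (edge_rel F)\<^sup>*"
  using sym_edge_rel sym_rtrancl symD by metis

lemma plane_drawingD:
  assumes "plane_drawing H pos cur"
  shows "inj_on pos (gverts H)"
    and "\<And>e. e \<in> gedges H \<Longrightarrow> arc (cur e)"
    and "\<And>e. e \<in> gedges H \<Longrightarrow> {pathstart (cur e), pathfinish (cur e)} = pos ` e"
    and "\<And>e v. e \<in> gedges H \<Longrightarrow> v \<in> gverts H \<Longrightarrow> pos v \<in> path_image (cur e) \<Longrightarrow> v \<in> e"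
    and "\<And>e f. e \<in> gedges H \<Longrightarrow> f \<in> gedges H \<Longrightarrow> e \<noteq> f \<Longrightarrow>
           path_image (cur e) \<inter> path_image (cur f) = pos ` (e \<inter> f)"
proof -
  note pd = assms[unfolded plane_drawing_def]
  show "inj_on pos (gverts H)" using pd by (elim conjE)
  show "arc (cur e)" if "e \<in> gedges H" for e
    using pd that by (elim conjE) simp
  show "{pathstart (cur e), pathfinish (cur e)} = pos ` e" if "e \<in> gedges H" for e
    using pd that by (elim conjE) simp
  show "v \<in> e" if "e \<in> gedges H" "v \<in> gverts H" "pos v \<in> path_image (cur e)" for e v
    using pd that by (elim conjE) simp
  show "path_image (cur e) \<inter> path_image (cur f) = pos ` (e \<inter> f)"
    if "e \<in> gedges H" "f \<in> gedges H" "e \<noteq> f" for e f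
    using pd that by (elim conjE) simp
qed

text \<open>The point of \<open>u\<close> is inserted separately because a vertex without edges in
  \<open>F\<close> still occupies a point of the drawing.\<close>

definition drawn_component ::
  "('v \<Rightarrow> complex) \<Rightarrow> ('v set \<Rightarrow> real \<Rightarrow> complex) \<Rightarrow> 'v set set \<Rightarrow> 'v \<Rightarrow> complex set" where
  "drawn_component pos cur F u =
     insert (pos u) (\<Union>e\<in>{e\<in>F. e \<subseteq> (edge_rel F)\<^sup>* `` {u}}. path_image (cur e))"

text \<open>The arcs of the edges of a walk are concatenated. A drawing does not orient its arcs,
  hence the case with \<open>reversepath\<close>. The result need not be simple; the crossing
  theorem asks for paths only.\<close>

lemma path_in_drawn_component:
  assumes "plane_drawing H pos cur" "F \<subseteq> gedges H" "(u, v) \<in> (edge_rel F)\<^sup>*"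
  obtains p where "path p" "pathstart p = pos u" "pathfinish p = pos v"
    "path_image p \<subseteq> drawn_component pos cur F u"
proof -
  have "\<exists>p. path p \<and> pathstart p = pos u \<and> pathfinish p = pos v \<and>
          path_image p \<subseteq> drawn_component pos cur F u"
    using assms(3)
  proof (induction rule: rtrancl_induct)
    case base
    show ?case
      by (rule exI[of _ "\<lambda>_. pos u"])
         (auto simp: drawn_component_def path_def pathstart_def pathfinish_def path_image_def)
  next
    case (step y z)
    then obtain p where p: "path p" "pathstart p = pos u" "pathfinish p = pos y"
      "path_image p \<subseteq> drawn_component pos cur F u" by blast
    define e where "e = {y, z}"
    have e: "e \<in> F" using step by (simp add: edge_rel_def e_def)
    have "z \<in> (edge_rel F)\<^sup>* `` {u}"
      using step by (auto intro: rtrancl_into_rtrancl)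
    then have "e \<subseteq> (edge_rel F)\<^sup>* `` {u}"
      using step by (auto simp: e_def)
    with e have im: "path_image (cur e) \<subseteq> drawn_component pos cur F u"
      by (auto simp: drawn_component_def)
    have arc: "arc (cur e)" and "{pathstart (cur e), pathfinish (cur e)} = {pos y, pos z}"
      using plane_drawingD(2,3)[OF assms(1), of e] assms(2) e by (auto simp: e_def)
    then consider "pathstart (cur e) = pos y" "pathfinish (cur e) = pos z"
      | "pathstart (cur e) = pos z" "pathfinish (cur e) = pos y"
      by (auto simp: doubleton_eq_iff)
    then obtain q where q: "path q" "pathstart q = pos y" "pathfinish q = pos z"
      "path_image q = path_image (cur e)"
    proof cases
      case 1
      then show ?thesis using that[of "cur e"] arc by (auto simp: arc_imp_path)
    next
      case 2
      then show ?thesis using that[of "reversepath (cur e)"] arc by (auto simp: arc_imp_path)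
    qed
    show ?case
      by (rule exI[of _ "p +++ q"]) (use p q im in \<open>auto simp: path_image_join\<close>)
  qed
  then show ?thesis using that by blast
qed

lemma drawn_component_subset:
  assumes "F \<subseteq> gedges H" "u \<in> gverts H"
  shows "drawn_component pos cur F u \<subseteq> drawing_set H pos cur"
  using assms by (auto simp: drawn_component_def drawing_set_def)

text \<open>Two different edges meet only in common vertices, and edges of different components have
  none. Such edges are indeed different, being disjoint and nonempty.\<close>

lemma drawn_components_disjoint:
  assumes "finite_graph H" "plane_drawing H pos cur" "F \<subseteq> gedges H"
    and "u \<in> gverts H" "v \<in> gverts H" "(u, v) \<notin> (edge_rel F)\<^sup>*"
  shows "drawn_component pos cur F u \<inter> drawn_component pos cur F v = {}"
proof -
  let ?K = "\<lambda>u. (edge_rel F)\<^sup>* `` {u}"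
  have disj: "?K u \<inter> ?K v = {}"
    using assms(6) by (auto dest: edge_rel_rtrancl_sym intro: rtrancl_trans)
  have uv: "u \<noteq> v" using assms(6) by auto
  have pos_uv: "pos u \<noteq> pos v"
    using plane_drawingD(1)[OF assms(2)] assms(4,5) uv by (auto simp: inj_on_def)
  have pos_cur: "pos w \<notin> path_image (cur e)"
    if "e \<in> F" "e \<subseteq> ?K w'" "w \<in> gverts H" "(w', w) \<notin> (edge_rel F)\<^sup>*" for e w w'
  proof
    assume "pos w \<in> path_image (cur e)"
    then have "w \<in> e"
      using plane_drawingD(4)[OF assms(2), of e w] assms(3) that(1,3) by (simp add: subset_iff)
    then show False using that(2,4) by blast
  qed
  have cur_cur: "path_image (cur e) \<inter> path_image (cur f) = {}"
    if "e \<in> F" "e \<subseteq> ?K u" "f \<in> F" "f \<subseteq> ?K v" for e f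
  proof -
    have ef: "e \<inter> f = {}" using that disj by blast
    have "card e = 2" using assms(1,3) that by (auto simp: finite_graph_def)
    then have "e \<noteq> {}" by auto
    then have "e \<noteq> f" using ef by auto
    then have "path_image (cur e) \<inter> path_image (cur f) = pos ` (e \<inter> f)"
      using plane_drawingD(5)[OF assms(2), of e f] assms(3) that by blast
    then show ?thesis using ef by simp
  qed
  have vu: "(v, u) \<notin> (edge_rel F)\<^sup>*"
    using assms(6) edge_rel_rtrancl_sym[of v u F] by blast
  let ?E = "\<lambda>u. \<Union>e\<in>{e\<in>F. e \<subseteq> ?K u}. path_image (cur e)"
  have "pos u \<notin> ?E v" "pos v \<notin> ?E u"
    using pos_cur assms(4-6) vu by blast+
  moreover have "?E u \<inter> ?E v = {}"
    using cur_cur by fast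
  ultimately show ?thesis
    using pos_uv unfolding drawn_component_def by blast
qed

text \<open>The condition of \<^const>\<open>ccw_on_outer_face\<close>, with its witnesses as parameters.\<close>

definition outer_arcs ::
  "complex set \<Rightarrow> complex list \<Rightarrow> real \<Rightarrow> (nat \<Rightarrow> real) \<Rightarrow> (nat \<Rightarrow> real \<Rightarrow> complex) \<Rightarrow> bool" where
  "outer_arcs D ps R \<theta> g \<longleftrightarrow>
     0 < R \<and> D \<subseteq> ball 0 R \<and>
     (\<forall>j<length ps.
        arc (g j) \<and> pathstart (g j) = ps ! j \<and> pathfinish (g j) = of_real R * cis (\<theta> j) \<and>
        path_image (g j) - {pathstart (g j)} \<subseteq> outside D \<and>
        path_image (g j) - {pathfinish (g j)} \<subseteq> ball 0 R) \<and>
     (\<forall>i<length ps. \<forall>j<length ps. i \<noteq> j \<longrightarrow> path_image (g i) \<inter> path_image (g j) = {}) \<and>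
     (\<forall>i j. i < j \<and> j < length ps \<longrightarrow> \<theta> i < \<theta> j \<and> \<theta> j < \<theta> i + 2 * pi)"

lemma ccw_on_outer_face_iff:
  "ccw_on_outer_face D ps \<longleftrightarrow>
     set ps \<subseteq> frontier (outside D) \<and> (\<exists>R \<theta> g. outer_arcs D ps R \<theta> g)"
  by (simp add: ccw_on_outer_face_def outer_arcs_def)

lemma outer_arcsD:
  assumes "outer_arcs D ps R \<theta> g"
  shows "0 < R" "D \<subseteq> ball 0 R"
    and "\<And>j. j < length ps \<Longrightarrow> arc (g j)"
    and "\<And>j. j < length ps \<Longrightarrow> pathstart (g j) = ps ! j"
    and "\<And>j. j < length ps \<Longrightarrow> pathfinish (g j) = of_real R * cis (\<theta> j)"
    and "\<And>j. j < length ps \<Longrightarrow> path_image (g j) - {ps ! j} \<subseteq> outside D"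
    and "\<And>j. j < length ps \<Longrightarrow> path_image (g j) - {of_real R * cis (\<theta> j)} \<subseteq> ball 0 R"
    and "\<And>i j. i < length ps \<Longrightarrow> j < length ps \<Longrightarrow> i \<noteq> j \<Longrightarrow> path_image (g i) \<inter> path_image (g j) = {}"
    and "\<And>i j. i < j \<Longrightarrow> j < length ps \<Longrightarrow> \<theta> i < \<theta> j \<and> \<theta> j < \<theta> i + 2 * pi"
proof -
  have all: "\<forall>j<length ps.
        arc (g j) \<and> pathstart (g j) = ps ! j \<and> pathfinish (g j) = of_real R * cis (\<theta> j) \<and>
        path_image (g j) - {pathstart (g j)} \<subseteq> outside D \<and>
        path_image (g j) - {pathfinish (g j)} \<subseteq> ball 0 R"
    using assms unfolding outer_arcs_def by (elim conjE)
  show "arc (g j)" if "j < length ps" for j using all that by simp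
  show start: "pathstart (g j) = ps ! j" if "j < length ps" for j using all that by simp
  show fin: "pathfinish (g j) = of_real R * cis (\<theta> j)" if "j < length ps" for j
    using all that by simp
  show "path_image (g j) - {ps ! j} \<subseteq> outside D" if "j < length ps" for j
    using all[rule_format, OF that] start[OF that] by metis
  show "path_image (g j) - {of_real R * cis (\<theta> j)} \<subseteq> ball 0 R" if "j < length ps" for j
    using all[rule_format, OF that] fin[OF that] by metis
qed (use assms in \<open>unfold outer_arcs_def, elim conjE, simp\<close>)+

text \<open>Were the two components different, then, prolonged by the dangling arcs at
  \<open>a\<close>, \<open>c\<close> and at \<open>b\<close>, \<open>d\<close>, they would be
  disjoint sets inside the disc, each containing a path between two points of the circle, with these
  four points interlaced.\<close>

lemma output_components_noncrossing:
  assumes fg: "finite_graph H" and pd: "plane_drawing H pos cur"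
    and ccw: "ccw_on_outer_face (drawing_set H pos cur) (map pos outs)"
    and outs: "set outs \<subseteq> gverts H" and F: "F \<subseteq> gedges H"
    and order: "a < b" "b < c" "c < d" "d < length outs"
    and ac: "(outs ! a, outs ! c) \<in> (edge_rel F)\<^sup>*"
    and bd: "(outs ! b, outs ! d) \<in> (edge_rel F)\<^sup>*"
  shows "(outs ! a, outs ! b) \<in> (edge_rel F)\<^sup>*"
proof (rule ccontr)
  assume nab: "(outs ! a, outs ! b) \<notin> (edge_rel F)\<^sup>*"
  let ?D = "drawing_set H pos cur"
  obtain R \<theta> g where "outer_arcs ?D (map pos outs) R \<theta> g"
    using ccw by (auto simp: ccw_on_outer_face_iff)
  then have oa: "outer_arcs ?D (map pos outs) R \<theta> g" .
  note R = outer_arcsD(1)[OF oa] and D = outer_arcsD(2)[OF oa]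
  have g: "arc (g j) \<and> pathstart (g j) = pos (outs ! j) \<and>
          pathfinish (g j) = of_real R * cis (\<theta> j) \<and>
          path_image (g j) - {pos (outs ! j)} \<subseteq> outside ?D \<and>
          path_image (g j) - {of_real R * cis (\<theta> j)} \<subseteq> ball 0 R" if "j < length outs" for j
    using outer_arcsD(3-7)[OF oa, of j] that by simp
  have gdisj: "path_image (g i) \<inter> path_image (g j) = {}"
    if "i < length outs" "j < length outs" "i \<noteq> j" for i j
    using outer_arcsD(8)[OF oa, of i j] that by simp
  have \<theta>: "\<theta> i < \<theta> j \<and> \<theta> j < \<theta> i + 2 * pi" if "i < j" "j < length outs" for i j
    using outer_arcsD(9)[OF oa, of i j] that by simp
  let ?C = "\<lambda>i. drawn_component pos cur F (outs ! i)"
  have V: "outs ! i \<in> gverts H" if "i < length outs" for i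
    using that outs by auto
  have CD: "?C i \<subseteq> ?D" if "i < length outs" for i
    using drawn_component_subset[OF F V[OF that]] .
  have gD: "path_image (g j) \<inter> ?D \<subseteq> {pos (outs ! j)}" if "j < length outs" for j
    using g[OF that] outside_no_overlap[of ?D] by blast
  have joined: "\<exists>f. path f \<and> pathstart f = of_real R * cis (\<theta> i) \<and>
      pathfinish f = of_real R * cis (\<theta> j) \<and>
      path_image f \<subseteq> path_image (g i) \<union> ?C i \<union> path_image (g j) \<and>
      path_image f \<subseteq> ball 0 R \<union> {pathstart f, pathfinish f}"
    if ij: "i < length outs" "j < length outs" "(outs ! i, outs ! j) \<in> (edge_rel F)\<^sup>*" for i j
  proof -
    obtain p where p: "path p" "pathstart p = pos (outs ! i)" "pathfinish p = pos (outs ! j)"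
      "path_image p \<subseteq> ?C i"
      using path_in_drawn_component[OF pd F ij(3)] .
    \<comment> \<open>Inwards along the arc of output \<open>i\<close>, through the component, and
      out along the arc of output \<open>j\<close>; only the two ends lie on the circle.\<close>
    let ?f = "reversepath (g i) +++ p +++ g j"
    have im: "path_image ?f = path_image (g i) \<union> path_image p \<union> path_image (g j)"
      using g[OF ij(1)] g[OF ij(2)] p by (simp add: path_image_join Un_assoc)
    have "path_image p \<subseteq> ball 0 R"
      using p(4) CD[OF ij(1)] D by blast
    then have "path_image ?f \<subseteq> ball 0 R \<union> {pathstart ?f, pathfinish ?f}"
      using g[OF ij(1)] g[OF ij(2)] unfolding im by auto
    then show ?thesis
      using g[OF ij(1)] g[OF ij(2)] p im
      by (intro exI[of _ ?f]) (auto simp: arc_imp_path)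
  qed
  have lt: "a < length outs" "b < length outs" "c < length outs" "d < length outs"
    using order by auto
  obtain f where f: "path f" "pathstart f = of_real R * cis (\<theta> a)" 
      "pathfinish f = of_real R * cis (\<theta> c)"
      "path_image f \<subseteq> path_image (g a) \<union> ?C a \<union> path_image (g c)"
      "path_image f \<subseteq> ball 0 R \<union> {pathstart f, pathfinish f}"
    using joined[OF lt(1,3) ac] by blast
  obtain h where h: "path h" "pathstart h = of_real R * cis (\<theta> b)" 
      "pathfinish h = of_real R * cis (\<theta> d)"
      "path_image h \<subseteq> path_image (g b) \<union> ?C b \<union> path_image (g d)"
      "path_image h \<subseteq> ball 0 R \<union> {pathstart h, pathfinish h}"
    using joined[OF lt(2,4) bd] by blast
  have cross: "path_image f \<inter> path_image h \<noteq> {}"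
    by (rule disc_paths_cross[OF R f(1) h(1) f(5) h(5) f(2,3) h(2,3)]) (use \<theta> order in auto)
  \<comment> \<open>A dangling arc touches the drawing at its own output only, and this point
    belongs to the other component.\<close>
  have gC: "path_image (g i) \<inter> ?C k = {}"
    if "i < length outs" "k < length outs" "(outs ! i, outs ! k) \<notin> (edge_rel F)\<^sup>*" for i k
  proof -
    have "path_image (g i) \<inter> ?C k \<subseteq> {pos (outs ! i)}"
      using gD[OF that(1)] CD[OF that(2)] by blast
    moreover have "pos (outs ! i) \<notin> ?C k"
      using drawn_components_disjoint[OF fg pd F V V that(3)] that
      by (auto simp: drawn_component_def)
    ultimately show ?thesis by blast
  qed
  have "(outs ! c, outs ! b) \<notin> (edge_rel F)\<^sup>*" "(outs ! b, outs ! a) \<notin> (edge_rel F)\<^sup>*"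
    "(outs ! d, outs ! a) \<notin> (edge_rel F)\<^sup>*"
    using nab ac bd by (metis edge_rel_rtrancl_sym rtrancl_trans)+
  note gC = gC[OF lt(1,2) nab] gC[OF lt(3,2) this(1)] gC[OF lt(2,1) this(2)] gC[OF lt(4,1) this(3)]
  have "?C a \<inter> ?C b = {}"
    using drawn_components_disjoint[OF fg pd F V[OF lt(1)] V[OF lt(2)] nab] .
  moreover have "path_image (g a) \<inter> path_image (g b) = {}" "path_image (g a) \<inter> path_image (g d) = {}"
    "path_image (g c) \<inter> path_image (g b) = {}" "path_image (g c) \<inter> path_image (g d) = {}"
    using gdisj[of a b] gdisj[of a d] gdisj[of c b] gdisj[of c d] order by auto
  moreover obtain z where "z \<in> path_image f" "z \<in> path_image h"
    using cross by blast
  moreover from this have "z \<in> path_image (g a) \<union> ?C a \<union> path_image (g c)"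
    "z \<in> path_image (g b) \<union> ?C b \<union> path_image (g d)"
    using f(4) h(4) by (blast dest: subsetD)+
  ultimately show False
    using gC by (metis Un_iff disjoint_iff)
qed

section \<open>Superposition of perfect matchings\<close>

lemma even_card_involution:
  assumes "finite S" "\<And>x. x \<in> S \<Longrightarrow> f x \<in> S" "\<And>x. x \<in> S \<Longrightarrow> f (f x) = x" "\<And>x. x \<in> S \<Longrightarrow> f x \<noteq> x"
  shows "even (card S)"
  using assms
proof (induction "card S" arbitrary: S rule: less_induct)
  case less
  show ?case
  proof (cases "S = {}")
    case False
    then obtain x where x: "x \<in> S" by blast
    let ?S = "S - {x, f x}"
    have c: "card S = card ?S + 2"
      using less.prems x card_Diff_subset[of "{x, f x}" S] card_mono[of S "{x, f x}"] by force
    have "even (card ?S)"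
    proof (rule less.hyps)
      fix y assume y: "y \<in> ?S"
      then show "f (f y) = y" "f y \<noteq> y" using less.prems by auto
      have "f y \<noteq> x" "f y \<noteq> f x"
        using y x less.prems(3)[of x] less.prems(3)[of y] by auto
      then show "f y \<in> ?S" using y less.prems(2)[of y] by simp
    qed (use c less.prems in auto)
    with c show ?thesis by simp
  qed auto
qed

text \<open>A point strictly between \<open>p\<close> and \<open>f p\<close> has its partner there
  too, as otherwise two pairs would cross. So the number of points in between is even, and the ranks
  of \<open>p\<close> and \<open>f p\<close> in \<open>P\<close> have opposite parity. This turns
  planarity into the sign change of the involution.\<close>

lemma noncrossing_pairing_sign:
  fixes P :: "nat set"
  assumes P: "finite P" and f: "\<And>x. x \<in> P \<Longrightarrow> f x \<in> P" "\<And>x. x \<in> P \<Longrightarrow> f (f x) = x" "\<And>x. x \<in> P \<Longrightarrow> f x \<noteq> x"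
    and nc: "\<And>a b. a \<in> P \<Longrightarrow> b \<in> P \<Longrightarrow> a < b \<Longrightarrow> b < f a \<Longrightarrow> f a < f b \<Longrightarrow> False"
    and p: "p \<in> P"
  shows "(-1) ^ card {r\<in>P. r < f p} = - ((-1) ^ card {r\<in>P. r < p} :: complex)"
proof -
  have odd: "odd (card {r\<in>P. r < p} + card {r\<in>P. r < f p})" if p: "p \<in> P" and lt: "p < f p" for p
  proof -
    let ?B = "{r\<in>P. p < r \<and> r < f p}"
    have "even (card ?B)"
    proof (rule even_card_involution)
      fix r assume r: "r \<in> ?B"
      then show "f (f r) = r" "f r \<noteq> r" using f(2,3)[of r] by auto
      have "f r \<noteq> p" "f r \<noteq> f p"
        using r f(2)[of r] f(2)[OF p] by auto
      moreover have "\<not> f r < p"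
        using nc[of "f r" p] f(1,2)[of r] r p by auto
      moreover have "\<not> f p < f r"
        using nc[of p r] r p by auto
      ultimately show "f r \<in> ?B" using r f(1)[of r] by auto
    qed (use P in auto)
    moreover have "{r\<in>P. r < f p} = {r\<in>P. r < p} \<union> insert p ?B"
      using lt p by auto
    then have "card {r\<in>P. r < f p} = card {r\<in>P. r < p} + Suc (card ?B)"
      using P by (simp add: card_Un_disjoint disjoint_iff)
    ultimately show ?thesis by simp
  qed
  have "odd (card {r\<in>P. r < p} + card {r\<in>P. r < f p})"
    using odd[OF p] odd[of "f p"] f[OF p]
    by (cases "p < f p") (auto simp: add.commute not_less le_less)
  then show ?thesis
    by (cases "even (card {r\<in>P. r < p})") auto
qed

text \<open>A breadth-first tree: each vertex of the component other than \<open>u\<close> is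
  charged to the edge joining it to a vertex \<open>pa v\<close> nearer to \<open>u\<close>. Two
  vertices charged to the same edge would each be nearer to \<open>u\<close> than the other.\<close>

lemma card_component_le:
  assumes "finite F"
  shows "finite ((edge_rel F)\<^sup>* `` {u})"
    and "card ((edge_rel F)\<^sup>* `` {u}) \<le> card {e\<in>F. e \<subseteq> (edge_rel F)\<^sup>* `` {u}} + 1"
proof -
  let ?R = "edge_rel F" and ?K = "(edge_rel F)\<^sup>* `` {u}"
  define d where "d v = (LEAST n. (u, v) \<in> ?R ^^ n)" for v
  have d: "(u, v) \<in> ?R ^^ d v" if "v \<in> ?K" for v
  proof -
    have "(u, v) \<in> ?R\<^sup>*" using that by simp
    then obtain n where "(u, v) \<in> ?R ^^ n" using rtrancl_imp_relpow by metis
    then show ?thesis unfolding d_def by (rule LeastI)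
  qed
  have "\<exists>w. w \<in> ?K \<and> d w < d v \<and> {w, v} \<in> F" if v: "v \<in> ?K" "v \<noteq> u" for v
  proof -
    obtain n where n: "d v = Suc n"
      using d[OF v(1)] v(2) by (cases "d v") auto
    then obtain w where w: "(u, w) \<in> ?R ^^ n" "(w, v) \<in> ?R"
      using d[OF v(1)] by auto
    then have "d w \<le> n" unfolding d_def by (intro Least_le)
    then show ?thesis
      using w n by (auto simp: edge_rel_def intro: relpow_imp_rtrancl)
  qed
  then obtain pa where pa: "\<And>v. v \<in> ?K \<Longrightarrow> v \<noteq> u \<Longrightarrow> pa v \<in> ?K \<and> d (pa v) < d v \<and> {pa v, v} \<in> F"
    by metis
  have inj: "inj_on (\<lambda>v. {pa v, v}) (?K - {u})"
  proof (rule inj_onI)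
    fix x y assume xy: "x \<in> ?K - {u}" "y \<in> ?K - {u}" "{pa x, x} = {pa y, y}"
    show "x = y"
    proof (rule ccontr)
      assume "x \<noteq> y"
      then have "pa x = y" "pa y = x" using xy(3) by (auto simp: doubleton_eq_iff)
      then show False using pa[of x] pa[of y] xy(1,2) by auto
    qed
  qed
  have sub: "(\<lambda>v. {pa v, v}) ` (?K - {u}) \<subseteq> {e\<in>F. e \<subseteq> ?K}"
    using pa by auto
  have fin: "finite {e\<in>F. e \<subseteq> ?K}" using assms by simp
  have "finite (?K - {u})"
    using inj sub fin by (meson finite_imageD finite_subset)
  then show K: "finite ?K" by simp
  have "card (?K - {u}) \<le> card {e\<in>F. e \<subseteq> ?K}"
    using card_inj_on_le[OF inj sub fin] .
  then show "card ?K \<le> card {e\<in>F. e \<subseteq> ?K} + 1"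
    using K by (simp add: card_Diff_singleton_if)
qed

section \<open>Counting and exchanging in matchings\<close>

lemma perfect_matchings_remove_verts:
  "F \<in> perfect_matchings (remove_verts H X) \<longleftrightarrow>
     F \<subseteq> gedges H \<and> (\<forall>e\<in>F. e \<inter> X = {}) \<and> (\<forall>v\<in>gverts H - X. \<exists>!e. e \<in> F \<and> v \<in> e)"
  by (auto simp: perfect_matchings_def remove_verts_def)

lemma perfect_matchingsD:
  assumes "F \<in> perfect_matchings (remove_verts H X)"
  shows "F \<subseteq> gedges H" "\<And>e. e \<in> F \<Longrightarrow> e \<inter> X = {}"
    and "\<And>v. v \<in> gverts H \<Longrightarrow> v \<notin> X \<Longrightarrow> \<exists>e\<in>F. v \<in> e"
    and "\<And>v e f. v \<in> gverts H \<Longrightarrow> v \<notin> X \<Longrightarrow> e \<in> F \<Longrightarrow> f \<in> F \<Longrightarrow> v \<in> e \<Longrightarrow> v \<in> f \<Longrightarrow> e = f"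
proof -
  note * = assms[unfolded perfect_matchings_remove_verts]
  show "F \<subseteq> gedges H" "\<And>e. e \<in> F \<Longrightarrow> e \<inter> X = {}" using * by simp_all
  fix v assume "v \<in> gverts H" "v \<notin> X"
  then have ex: "\<exists>!e. e \<in> F \<and> v \<in> e" using * by simp
  show "\<exists>e\<in>F. v \<in> e" using ex by (elim ex1E) blast
  show "e = f" if "e \<in> F" "f \<in> F" "v \<in> e" "v \<in> f" for e f
    using ex that by (elim ex1E) metis
qed

lemma finite_perfect_matchings:
  assumes "finite_graph H"
  shows "finite (perfect_matchings (remove_verts H X))"
proof -
  have "finite (gedges H)"
    using assms by (auto simp: finite_graph_def intro: finite_subset[of _ "Pow (gverts H)"])
  moreover have "perfect_matchings (remove_verts H X) \<subseteq> Pow (gedges H)"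
    by (auto simp: perfect_matchings_remove_verts)
  ultimately show ?thesis by (simp add: finite_subset)
qed

text \<open>The matching edges inside \<open>K\<close> are disjoint pairs that cover exactly the
  vertices of \<open>K\<close> that are kept. This is applied to components of a superposition and,
  for the parity condition, to the whole vertex set.\<close>

lemma card_closed_minus_removed:
  assumes fg: "finite_graph H" and F: "F \<in> perfect_matchings (remove_verts H X)"
    and K: "K \<subseteq> gverts H" "\<And>e. e \<in> F \<Longrightarrow> e \<inter> K \<noteq> {} \<Longrightarrow> e \<subseteq> K"
  shows "card (K - X) = 2 * card {e\<in>F. e \<subseteq> K}"
proof -
  note F = perfect_matchingsD[OF F]
  let ?C = "{e\<in>F. e \<subseteq> K}"
  have fin: "finite (gverts H)" using fg by (simp add: finite_graph_def)
  have "finite K" using K(1) fin finite_subset by blast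
  have e: "e \<subseteq> gverts H" "card e = 2" "e \<inter> X = {}" if "e \<in> F" for e
    using F(1,2) fg that by (auto simp: finite_graph_def)
  have "K - X = \<Union>?C"
  proof
    show "K - X \<subseteq> \<Union>?C"
    proof
      fix v assume v: "v \<in> K - X"
      then obtain e where "e \<in> F" "v \<in> e" using F(3)[of v] K(1) by blast
      then show "v \<in> \<Union>?C" using K(2)[of e] v by blast
    qed
    show "\<Union>?C \<subseteq> K - X" using e(3) by blast
  qed
  moreover have "card (\<Union>?C) = (\<Sum>e\<in>?C. card e)"
  proof (rule card_Union_disjoint)
    show "pairwise disjnt ?C"
    proof (clarsimp simp: pairwise_def disjnt_def)
      fix e f assume ef: "e \<in> F" "e \<subseteq> K" "f \<in> F" "f \<subseteq> K" "e \<noteq> f"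
      show "e \<inter> f = {}"
      proof (rule ccontr)
        assume "e \<inter> f \<noteq> {}"
        then obtain v where "v \<in> e" "v \<in> f" by blast
        moreover then have "v \<in> gverts H" "v \<notin> X" using e[OF ef(1)] by blast+
        ultimately show False using F(4)[of v e f] ef by blast
      qed
    qed
    show "finite e" if "e \<in> ?C" for e
      using that e(2)[of e] by (auto intro: card_ge_0_finite)
  qed
  ultimately show ?thesis using e(2) by simp
qed

text \<open>Two matchings are exchanged on the vertex set \<open>K\<close>, a union of components of their
  superposition.\<close>

definition swap_on :: "'v set \<Rightarrow> 'v set set \<Rightarrow> 'v set set \<Rightarrow> 'v set set" where
  "swap_on K F G = {e\<in>F. e \<inter> K = {}} \<union> {e\<in>G. e \<subseteq> K}"

text \<open>As \<open>K\<close> is closed, the edges at a vertex after the exchange are those of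
  \<open>G\<close> if it lies in \<open>K\<close> and those of \<open>F\<close> otherwise; the set
  of removed vertices is exchanged in the same way.\<close>

lemma swap_on_perfect_matching:
  assumes F: "F \<in> perfect_matchings (remove_verts H X)"
    and G: "G \<in> perfect_matchings (remove_verts H Y)"
    and K: "\<And>e. e \<in> F \<union> G \<Longrightarrow> e \<inter> K \<noteq> {} \<Longrightarrow> e \<subseteq> K"
  shows "swap_on K F G \<in> perfect_matchings (remove_verts H (X - K \<union> Y \<inter> K))"
proof -
  note F = perfect_matchingsD[OF F] and G = perfect_matchingsD[OF G]
  show ?thesis
    unfolding perfect_matchings_remove_verts
  proof (intro conjI ballI)
    show "swap_on K F G \<subseteq> gedges H" using F(1) G(1) by (auto simp: swap_on_def)
    show "e \<inter> (X - K \<union> Y \<inter> K) = {}" if "e \<in> swap_on K F G" for e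
      using F(2)[of e] G(2)[of e] that unfolding swap_on_def by blast
    fix v assume v: "v \<in> gverts H - (X - K \<union> Y \<inter> K)"
    show "\<exists>!e. e \<in> swap_on K F G \<and> v \<in> e"
    proof (cases "v \<in> K")
      case True
      then have ex: "\<exists>!e. e \<in> G \<and> v \<in> e" using v G(3)[of v] G(4)[of v] by auto
      have "e \<in> swap_on K F G \<and> v \<in> e \<longleftrightarrow> e \<in> G \<and> v \<in> e" for e
        using True K[of e] unfolding swap_on_def by blast
      then show ?thesis using ex by simp
    next
      case False
      then have ex: "\<exists>!e. e \<in> F \<and> v \<in> e" using v F(3)[of v] F(4)[of v] by auto
      have "e \<in> swap_on K F G \<and> v \<in> e \<longleftrightarrow> e \<in> F \<and> v \<in> e" for e
        using False K[of e] unfolding swap_on_def by blast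
      then show ?thesis using ex by simp
    qed
  qed
qed

text \<open>A nonempty edge of \<open>F\<close> or \<open>G\<close> lies either inside
  \<open>K\<close> or outside of it. An empty edge would satisfy both conditions of
  \<open>swap_on\<close> and be copied from one matching to the other.\<close>

lemma swap_on_swap_on:
  assumes "\<And>e. e \<in> F \<union> G \<Longrightarrow> e \<inter> K \<noteq> {} \<Longrightarrow> e \<subseteq> K" "\<And>e. e \<in> F \<union> G \<Longrightarrow> e \<noteq> {}"
  shows "swap_on K (swap_on K F G) (swap_on K G F) = F"
    and "swap_on K F G \<union> swap_on K G F = F \<union> G"
proof -
  have "e \<in> swap_on K (swap_on K F G) (swap_on K G F) \<longleftrightarrow> e \<in> F"
    "e \<in> swap_on K F G \<union> swap_on K G F \<longleftrightarrow> e \<in> F \<union> G" for e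
    using assms(1,2)[of e] unfolding swap_on_def by auto
  then show "swap_on K (swap_on K F G) (swap_on K G F) = F"
    "swap_on K F G \<union> swap_on K G F = F \<union> G" by blast+
qed

lemma prod_swap_on:
  fixes w :: "'v set \<Rightarrow> complex"
  assumes fin: "finite F" "finite G"
    and K: "\<And>e. e \<in> F \<union> G \<Longrightarrow> e \<inter> K \<noteq> {} \<Longrightarrow> e \<subseteq> K" and ne: "\<And>e. e \<in> F \<union> G \<Longrightarrow> e \<noteq> {}"
  shows "prod w (swap_on K F G) * prod w (swap_on K G F) = prod w F * prod w G"
proof -
  have sw: "prod w (swap_on K F' G') = prod w {e\<in>F'. e \<inter> K = {}} * prod w {e\<in>G'. e \<subseteq> K}"
    if "finite F'" "finite G'" "\<And>e. e \<in> F' \<union> G' \<Longrightarrow> e \<noteq> {}" for F' G'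
    unfolding swap_on_def
  proof (intro prod.union_disjoint)
    show "{e\<in>F'. e \<inter> K = {}} \<inter> {e\<in>G'. e \<subseteq> K} = {}" using that(3) by blast
  qed (use that in auto)
  have sp: "prod w F' = prod w {e\<in>F'. e \<inter> K = {}} * prod w {e\<in>F'. e \<subseteq> K}"
    if "finite F'" "\<And>e. e \<in> F' \<Longrightarrow> e \<inter> K \<noteq> {} \<Longrightarrow> e \<subseteq> K" "\<And>e. e \<in> F' \<Longrightarrow> e \<noteq> {}" for F'
  proof -
    have "F' = {e\<in>F'. e \<inter> K = {}} \<union> {e\<in>F'. e \<subseteq> K}" using that(2) by blast
    then have "prod w F' = prod w ({e\<in>F'. e \<inter> K = {}} \<union> {e\<in>F'. e \<subseteq> K})" by simp
    also have "\<dots> = prod w {e\<in>F'. e \<inter> K = {}} * prod w {e\<in>F'. e \<subseteq> K}"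
    proof (intro prod.union_disjoint)
      show "{e\<in>F'. e \<inter> K = {}} \<inter> {e\<in>F'. e \<subseteq> K} = {}" using that(3) by blast
    qed (use that(1) in auto)
    finally show ?thesis .
  qed
  show ?thesis
    using sw[OF fin ne] sw[OF fin(2,1) ne] sp[OF fin(1) K ne] sp[OF fin(2) K ne]
    by (simp add: Un_iff ac_simps)
qed

lemma component_closed:
  assumes "finite_graph H" "U \<subseteq> gedges H" "e \<in> U" "e \<inter> (edge_rel U)\<^sup>* `` {p} \<noteq> {}"
  shows "e \<subseteq> (edge_rel U)\<^sup>* `` {p}"
proof
  fix y assume y: "y \<in> e"
  obtain x where x: "x \<in> e" "(p, x) \<in> (edge_rel U)\<^sup>*" using assms(4) by blast
  show "y \<in> (edge_rel U)\<^sup>* `` {p}"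
  proof (cases "x = y")
    case False
    have "card e = 2" using assms(1-3) by (auto simp: finite_graph_def)
    then have "e = {x, y}" using x(1) y False by (auto simp: card_2_iff doubleton_eq_iff)
    then have "(x, y) \<in> edge_rel U" using assms(3) by (simp add: edge_rel_def)
    then show ?thesis using x(2) by (auto intro: rtrancl_into_rtrancl)
  qed (use x in auto)
qed

lemma component_subset_gverts:
  assumes "finite_graph H" "U \<subseteq> gedges H" "p \<in> gverts H"
  shows "(edge_rel U)\<^sup>* `` {p} \<subseteq> gverts H"
proof clarsimp
  fix y assume "(p, y) \<in> (edge_rel U)\<^sup>*"
  then show "y \<in> gverts H"
  proof (induction rule: rtrancl_induct)
    case (step y z)
    then have "{y, z} \<in> gedges H" using assms(2) by (auto simp: edge_rel_def)
    then show ?case using assms(1) by (auto simp: finite_graph_def)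
  qed (use assms in auto)
qed

text \<open>Counting covered vertices shows that the number of endpoints in a component is even; as a
  connected graph on \<open>k\<close> vertices has at least \<open>k - 1\<close> edges, it is at most 2.\<close>

lemma card_component_endpoints:
  assumes fg: "finite_graph H"
    and F: "F \<in> perfect_matchings (remove_verts H X)"
    and G: "G \<in> perfect_matchings (remove_verts H Y)"
    and V: "p \<in> gverts H" and p: "p \<in> (X - Y) \<union> (Y - X)"
  shows "card ((edge_rel (F \<union> G))\<^sup>* `` {p} \<inter> ((X - Y) \<union> (Y - X))) = 2"
proof -
  let ?K = "(edge_rel (F \<union> G))\<^sup>* `` {p}"
  have sub: "F \<union> G \<subseteq> gedges H"
    using perfect_matchingsD(1)[OF F] perfect_matchingsD(1)[OF G] by simp
  have "finite (gedges H)"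
    using fg by (auto simp: finite_graph_def intro: finite_subset[of _ "Pow (gverts H)"])
  then have fin: "finite F" "finite G" using sub by (auto intro: finite_subset)
  note closed = component_closed[OF fg sub, of _ p]
  note KV = component_subset_gverts[OF fg sub V]
  have finK: "finite ?K" using card_component_le(1)[of "F \<union> G" p] fin by simp
  have c1: "card (?K - X) = 2 * card {e\<in>F. e \<subseteq> ?K}"
    by (rule card_closed_minus_removed[OF fg F KV]) (use closed in auto)
  have c2: "card (?K - Y) = 2 * card {e\<in>G. e \<subseteq> ?K}"
    by (rule card_closed_minus_removed[OF fg G KV]) (use closed in auto)
  have "{e\<in>F \<union> G. e \<subseteq> ?K} = {e\<in>F. e \<subseteq> ?K} \<union> {e\<in>G. e \<subseteq> ?K}" by auto
  then have c3: "card ?K \<le> card {e\<in>F. e \<subseteq> ?K} + card {e\<in>G. e \<subseteq> ?K} + 1"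
    using card_component_le(2)[of "F \<union> G" p] fin card_Un_le[of "{e\<in>F. e \<subseteq> ?K}" "{e\<in>G. e \<subseteq> ?K}"]
    by simp
  have split: "card ?K = card (?K - Z) + card (?K \<inter> Z)" for Z
    using card_Diff_subset_Int[of ?K Z] finK card_mono[of ?K "?K \<inter> Z"] by simp
  have X: "card (?K \<inter> X) = card (?K \<inter> (X - Y)) + card (?K \<inter> X \<inter> Y)"
    by (subst card_Un_disjoint[symmetric]) (use finK in \<open>auto intro: arg_cong[where f = card]\<close>)
  have Y: "card (?K \<inter> Y) = card (?K \<inter> (Y - X)) + card (?K \<inter> X \<inter> Y)"
    by (subst card_Un_disjoint[symmetric]) (use finK in \<open>auto intro: arg_cong[where f = card]\<close>)
  have P: "card (?K \<inter> ((X - Y) \<union> (Y - X))) = card (?K \<inter> (X - Y)) + card (?K \<inter> (Y - X))"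
    by (subst card_Un_disjoint[symmetric]) (use finK in \<open>auto intro: arg_cong[where f = card]\<close>)
  have "p \<in> ?K \<inter> ((X - Y) \<union> (Y - X))" using p by auto
  then have pos: "card (?K \<inter> ((X - Y) \<union> (Y - X))) > 0"
    using finK by (metis card_gt_0_iff empty_iff finite_Int)
  \<comment> \<open>With k vertices and d endpoints in the component, the two vertex counts add up
    to 2k = 2a + 2b + d + 2c, and connectedness gives k \<le> a + b + 1. Thus d is even, positive
    and at most 2.\<close>
  define a b c where "a = card {e\<in>F. e \<subseteq> ?K}" and "b = card {e\<in>G. e \<subseteq> ?K}"
    and "c = card (?K \<inter> X \<inter> Y)"
  have "2 * card ?K = 2 * a + 2 * b + card (?K \<inter> ((X - Y) \<union> (Y - X))) + 2 * c"
    using c1 c2 split[of X] split[of Y] X Y P unfolding a_def b_def c_def by linarith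
  moreover have "card ?K \<le> a + b + 1"
    using c3 unfolding a_def b_def .
  moreover have "d = 2" if "2 * k = 2 * a + 2 * b + d + 2 * c" "k \<le> a + b + 1" "0 < d" for k d
    using that by presburger
  ultimately show ?thesis
    using pos by metis
qed

section \<open>The matchgate identity\<close>

text \<open>The drawing is forgotten here: the matchgate identity sees planarity only through this
  condition on edge sets, which is applied to superpositions of two matchings.\<close>

locale noncrossing_outputs =
  fixes H :: "'v wgraph" and outs :: "'v list"
  assumes fg: "finite_graph H" and distinct: "distinct outs" and outs_verts: "set outs \<subseteq> gverts H"
    and noncrossing: "\<And>F a b c d. F \<subseteq> gedges H \<Longrightarrow> a < b \<Longrightarrow> b < c \<Longrightarrow> c < d \<Longrightarrow> d < length outs \<Longrightarrow>
      (outs ! a, outs ! c) \<in> (edge_rel F)\<^sup>* \<Longrightarrow> (outs ! b, outs ! d) \<in> (edge_rel F)\<^sup>* \<Longrightarrow>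
      (outs ! a, outs ! b) \<in> (edge_rel F)\<^sup>*"

lemma generator_matchgate_noncrossing_outputs:
  assumes "generator_matchgate H outs"
  shows "noncrossing_outputs H outs"
proof -
  obtain pos cur where "plane_drawing H pos cur"
    "ccw_on_outer_face (drawing_set H pos cur) (map pos outs)"
    "finite_graph H" "distinct outs" "set outs \<subseteq> gverts H"
    using assms unfolding generator_matchgate_def by (elim conjE exE)
  then show ?thesis
    by unfold_locales (auto intro: output_components_noncrossing)
qed

text \<open>Removed outputs are given by their labels, not by the vertices. The signs of the
  identity depend on the order of the labels, and labels survive when the graph or its output
  vertices are changed.\<close>

definition removal_sum :: "'v wgraph \<Rightarrow> 'v list \<Rightarrow> nat set \<Rightarrow> complex" where
  "removal_sum H outs X = perf_match_sum (remove_verts H ((!) outs ` X))"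

lemma removal_sum_eq:
  "removal_sum H outs X =
     (\<Sum>F\<in>perfect_matchings (remove_verts H ((!) outs ` X)). prod (gweight H) F)"
  by (simp add: removal_sum_def perf_match_sum_def) (simp add: remove_verts_def)

text \<open>It depends on the two matchings only through their union \<open>U\<close>. Exchanging
  along a component does not change the union, and this is why the exchange can be undone.\<close>

definition partner :: "'v list \<Rightarrow> nat set \<Rightarrow> 'v set set \<Rightarrow> nat \<Rightarrow> nat" where
  "partner outs P U p = (THE q. q \<in> P \<and> q \<noteq> p \<and> (outs ! p, outs ! q) \<in> (edge_rel U)\<^sup>*)"

context noncrossing_outputs
begin

abbreviation PM where "PM X \<equiv> perfect_matchings (remove_verts H ((!) outs ` X))"

lemma inj_nth: "inj_on ((!) outs) {..<length outs}"
  using distinct by (auto simp: inj_on_def nth_eq_iff_index_eq)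

lemma image_sym_diff:
  assumes "X \<subseteq> {..<length outs}" "Y \<subseteq> {..<length outs}"
  shows "((!) outs ` X - (!) outs ` Y) \<union> ((!) outs ` Y - (!) outs ` X) = (!) outs ` ((X - Y) \<union> (Y - X))"
proof -
  have "X - Y \<subseteq> {..<length outs}" "Y - X \<subseteq> {..<length outs}" using assms by auto
  then show ?thesis
    using assms inj_on_image_set_diff[OF inj_nth, of X Y] inj_on_image_set_diff[OF inj_nth, of Y X]
    by (simp add: image_Un)
qed

context
  fixes X Y P :: "nat set" and F G
  assumes X: "X \<subseteq> {..<length outs}" and Y: "Y \<subseteq> {..<length outs}"
    and P: "P = (X - Y) \<union> (Y - X)" and F: "F \<in> PM X" and G: "G \<in> PM Y"
begin

lemma ex1_partner:
  assumes p: "p \<in> P"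
  shows "\<exists>!q. q \<in> P \<and> q \<noteq> p \<and> (outs ! p, outs ! q) \<in> (edge_rel (F \<union> G))\<^sup>*"
proof -
  let ?K = "(edge_rel (F \<union> G))\<^sup>* `` {outs ! p}"
  have PL: "P \<subseteq> {..<length outs}" using P X Y by auto
  have "outs ! p \<in> (!) outs ` P" using p by simp
  then have c: "card (?K \<inter> (!) outs ` P) = 2"
    using card_component_endpoints[OF fg F G, of "outs ! p"] image_sym_diff[OF X Y] outs_verts p PL
    by (auto simp: P subset_iff)
  have "?K \<inter> (!) outs ` P = (!) outs ` {q\<in>P. (outs ! p, outs ! q) \<in> (edge_rel (F \<union> G))\<^sup>*}"
    (is "_ = _ ` ?Q") by auto
  moreover have "inj_on ((!) outs) ?Q"
    using PL by (intro inj_on_subset[OF inj_nth]) auto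
  ultimately have "card ?Q = 2" using c by (simp only: card_image)
  then obtain a b where ab: "?Q = {a, b}" "a \<noteq> b" by (auto simp: card_2_iff)
  have "p \<in> ?Q" using p by simp
  with ab obtain q where q: "?Q = {p, q}" "q \<noteq> p" by auto
  have "q \<in> ?Q" using q by simp
  show ?thesis
  proof (rule ex1I[of _ q])
    show "q \<in> P \<and> q \<noteq> p \<and> (outs ! p, outs ! q) \<in> (edge_rel (F \<union> G))\<^sup>*"
      using \<open>q \<in> ?Q\<close> q(2) by simp
    fix r assume "r \<in> P \<and> r \<noteq> p \<and> (outs ! p, outs ! r) \<in> (edge_rel (F \<union> G))\<^sup>*"
    then have "r \<in> {p, q}" "r \<noteq> p" unfolding q(1)[symmetric] by simp_all
    then show "r = q" by simp
  qed
qed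

lemma partner:
  assumes p: "p \<in> P"
  shows "partner outs P (F \<union> G) p \<in> P" "partner outs P (F \<union> G) p \<noteq> p"
    "(outs ! p, outs ! partner outs P (F \<union> G) p) \<in> (edge_rel (F \<union> G))\<^sup>*"
  using theI'[OF ex1_partner[OF p]] unfolding partner_def by blast+

lemma partner_unique:
  assumes "p \<in> P" "q \<in> P" "q \<noteq> p" "(outs ! p, outs ! q) \<in> (edge_rel (F \<union> G))\<^sup>*"
  shows "q = partner outs P (F \<union> G) p"
  using the1_equality[OF ex1_partner[OF assms(1)], of q] assms unfolding partner_def by simp

lemma partner_partner:
  assumes p: "p \<in> P"
  shows "partner outs P (F \<union> G) (partner outs P (F \<union> G) p) = p"
  using partner_unique[OF partner(1)[OF p] p partner(2)[OF p, symmetric]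
      edge_rel_rtrancl_sym[OF partner(3)[OF p]]] by (rule sym)

text \<open>Two crossing pairs would lie in one component by \<open>noncrossing\<close>, but a
  component has only two endpoints.\<close>

lemma partner_sign:
  assumes p: "p \<in> P"
  shows "(-1) ^ card {r\<in>P. r < partner outs P (F \<union> G) p} = - ((-1) ^ card {r\<in>P. r < p} :: complex)"
proof (rule noncrossing_pairing_sign[OF _ partner(1) partner_partner partner(2) _ p])
  have PL: "P \<subseteq> {..<length outs}" using P X Y by auto
  then show "finite P" by (rule finite_subset) simp
  have sub: "F \<union> G \<subseteq> gedges H"
    using perfect_matchingsD(1)[OF F] perfect_matchingsD(1)[OF G] by simp
  fix a b assume ab: "a \<in> P" "b \<in> P" "a < b" "b < partner outs P (F \<union> G) a"
    "partner outs P (F \<union> G) a < partner outs P (F \<union> G) b"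
  have "(outs ! a, outs ! b) \<in> (edge_rel (F \<union> G))\<^sup>*"
    by (rule noncrossing[OF sub ab(3,4,5)]) (use partner[OF ab(1)] partner[OF ab(2)] PL in auto)
  then have "b = partner outs P (F \<union> G) a"
    using partner_unique ab by simp
  then show False using ab(4) by simp
qed

end

text \<open>Outputs outside \<open>P\<close> have the same status in \<open>X\<close> and
  \<open>Y\<close>, so the exchange affects only \<open>p\<close> and \<open>q\<close>. At
  \<open>p\<close> it undoes the toggling, since \<open>p\<close> belongs to exactly one of
  \<open>A\<close> and \<open>B\<close>; at \<open>q\<close> it replaces the status in
  \<open>A\<close> by the opposite one in \<open>B\<close>.\<close>

lemma swap_image:
  assumes p: "p \<in> P" "q \<in> P" "p \<noteq> q" and P: "P = (A - B) \<union> (B - A)"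
    and K: "\<And>r. r \<in> P \<Longrightarrow> outs ! r \<in> K \<longleftrightarrow> r = p \<or> r = q"
    and X: "X = (A - {p}) \<union> ({p} - A)" and Y: "Y = (B - {p}) \<union> ({p} - B)"
  shows "((!) outs ` X - K) \<union> ((!) outs ` Y \<inter> K) = (!) outs ` ((A - {q}) \<union> ({q} - A))"
proof -
  have "r \<in> {r\<in>X. outs ! r \<notin> K} \<union> {r\<in>Y. outs ! r \<in> K} \<longleftrightarrow> r \<in> (A - {q}) \<union> ({q} - A)" for r
    using p K[of r] unfolding P X Y by (cases "r \<in> A"; cases "r \<in> B") auto
  then have "{r\<in>X. outs ! r \<notin> K} \<union> {r\<in>Y. outs ! r \<in> K} = (A - {q}) \<union> ({q} - A)" by blast
  moreover have "((!) outs ` X - K) \<union> ((!) outs ` Y \<inter> K) =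
      (!) outs ` ({r\<in>X. outs ! r \<notin> K} \<union> {r\<in>Y. outs ! r \<in> K})" by blast
  ultimately show ?thesis by simp
qed

lemma matchgate_identity:
  assumes A: "A \<subseteq> {..<length outs}" and B: "B \<subseteq> {..<length outs}"
    and P: "P = (A - B) \<union> (B - A)"
  shows "(\<Sum>p\<in>P. (-1) ^ card {q\<in>P. q < p} *
           (removal_sum H outs ((A - {p}) \<union> ({p} - A)) * removal_sum H outs ((B - {p}) \<union> ({p} - B)))) = 0"
proof -
  define fl where "fl A p = (A - {p}) \<union> ({p} - A)" for A :: "nat set" and p
  define S where "S = Sigma P (\<lambda>p. PM (fl A p) \<times> PM (fl B p))"
  define f where "f = (\<lambda>(p, F, G). (-1) ^ card {q\<in>P. q < p} * (prod (gweight H) F * prod (gweight H) G))"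
  define K where "K = (\<lambda>(p, F, G). (edge_rel (F \<union> G))\<^sup>* `` {outs ! p})"
  define \<Phi> where "\<Phi> = (\<lambda>(p, F, G). (partner outs P (F \<union> G) p,
      swap_on (K (p, F, G)) F G, swap_on (K (p, F, G)) G F))"
  have finP: "finite P"
    by (rule finite_subset[of _ "{..<length outs}"]) (use A B in \<open>auto simp: P\<close>)
  have finPM: "finite (PM X)" for X by (rule finite_perfect_matchings[OF fg])
  have "sum f S = (\<Sum>p\<in>P. \<Sum>z\<in>PM (fl A p) \<times> PM (fl B p). f (p, z))"
    unfolding S_def using sum.Sigma[OF finP, of "\<lambda>p. PM (fl A p) \<times> PM (fl B p)" "\<lambda>p z. f (p, z)"] finPM
    by simp
  also have "\<dots> = (\<Sum>p\<in>P. (-1) ^ card {q\<in>P. q < p} *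
      (removal_sum H outs (fl A p) * removal_sum H outs (fl B p)))"
  proof (rule sum.cong[OF refl])
    fix p
    have "(\<Sum>z\<in>PM (fl A p) \<times> PM (fl B p). f (p, z)) =
        (\<Sum>F\<in>PM (fl A p). \<Sum>G\<in>PM (fl B p). f (p, F, G))"
      by (simp add: sum.cartesian_product)
    also have "\<dots> = (-1) ^ card {q\<in>P. q < p} *
        (\<Sum>F\<in>PM (fl A p). \<Sum>G\<in>PM (fl B p). prod (gweight H) F * prod (gweight H) G)"
      by (simp add: f_def sum_distrib_left)
    finally show "(\<Sum>z\<in>PM (fl A p) \<times> PM (fl B p). f (p, z)) = (-1) ^ card {q\<in>P. q < p} *
      (removal_sum H outs (fl A p) * removal_sum H outs (fl B p))"
      by (simp add: removal_sum_eq sum_product)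
  qed
  finally have sum_f: "sum f S = (\<Sum>p\<in>P. (-1) ^ card {q\<in>P. q < p} *
      (removal_sum H outs (fl A p) * removal_sum H outs (fl B p)))" .
  \<comment> \<open>The map \<open>\<Phi>\<close> replaces \<open>p\<close> by the other end of its
    path and exchanges the matchings along that path. It keeps the product of all weights and
    changes the sign.\<close>
  have "sum f S = (\<Sum>z\<in>S. - f z)"
  proof (rule sum.reindex_bij_witness[of S \<Phi> \<Phi>])
    have main: "\<Phi> z \<in> S \<and> \<Phi> (\<Phi> z) = z \<and> f (\<Phi> z) = - f z" if z: "z \<in> S" for z
    proof -
      obtain p F G where z_eq: "z = (p, F, G)" by (cases z) auto
      have p: "p \<in> P" and F: "F \<in> PM (fl A p)" and G: "G \<in> PM (fl B p)"
        using z by (auto simp: S_def z_eq)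
      have sub: "fl A p \<subseteq> {..<length outs}" "fl B p \<subseteq> {..<length outs}"
        using A B p unfolding fl_def P by auto
      \<comment> \<open>Toggling the same \<open>p\<close> in both sets keeps their symmetric
        difference, so all terms refer to one set \<open>P\<close> of endpoints.\<close>
      have Pfl: "P = (fl A p - fl B p) \<union> (fl B p - fl A p)"
        unfolding fl_def P by blast
      note pt = partner[OF sub Pfl F G p] and pp = partner_partner[OF sub Pfl F G p]
      let ?q = "partner outs P (F \<union> G) p" and ?K = "(edge_rel (F \<union> G))\<^sup>* `` {outs ! p}"
      let ?F = "swap_on ?K F G" and ?G = "swap_on ?K G F"
      have PL: "P \<subseteq> {..<length outs}" using A B unfolding P by auto
      have Kr: "outs ! r \<in> ?K \<longleftrightarrow> r = p \<or> r = ?q" if "r \<in> P" for r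
      proof
        assume "outs ! r \<in> ?K"
        then show "r = p \<or> r = ?q" using partner_unique[OF sub Pfl F G p that] by auto
      qed (use pt in auto)
      have U: "F \<union> G \<subseteq> gedges H"
        using perfect_matchingsD(1)[OF F] perfect_matchingsD(1)[OF G] by simp
      have closed: "e \<subseteq> ?K" if "e \<in> F \<union> G" "e \<inter> ?K \<noteq> {}" for e
        using component_closed[OF fg U that] .
      have closed': "e \<subseteq> ?K" if "e \<in> G \<union> F" "e \<inter> ?K \<noteq> {}" for e
        using closed that by blast
      have ne: "e \<noteq> {}" if "e \<in> F \<union> G" for e
      proof -
        have "card e = 2" using U fg that by (auto simp: finite_graph_def)
        then show ?thesis by auto
      qed
      have ne': "e \<noteq> {}" if "e \<in> G \<union> F" for e
        using ne that by blast
      have "finite (gedges H)"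
        using fg by (auto simp: finite_graph_def intro: finite_subset[of _ "Pow (gverts H)"])
      then have fin: "finite F" "finite G" using U by (auto intro: finite_subset)
      have F': "?F \<in> PM (fl A ?q)"
        using swap_on_perfect_matching[OF F G closed]
          swap_image[OF p pt(1) pt(2)[symmetric] P Kr, of "fl A p" "fl B p"]
        by (simp add: fl_def)
      have P': "P = (B - A) \<union> (A - B)" using P by blast
      have G': "?G \<in> PM (fl B ?q)"
        using swap_on_perfect_matching[OF G F closed']
          swap_image[OF p pt(1) pt(2)[symmetric] P' Kr, of "fl B p" "fl A p"]
        by (simp add: fl_def)
      \<comment> \<open>The superposition is the same before and after. With \<open>K'\<close>,
        which says that the component looks the same from its other endpoint, a second application
        of \<open>\<Phi>\<close> exchanges the same edges back.\<close>
      have union: "?F \<union> ?G = F \<union> G"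
        using swap_on_swap_on(2)[OF closed ne] .
      have K': "(edge_rel (F \<union> G))\<^sup>* `` {outs ! ?q} = ?K"
        using pt(3) edge_rel_rtrancl_sym[OF pt(3)] by (auto intro: rtrancl_trans)
      have \<Phi>z: "\<Phi> z = (?q, ?F, ?G)" by (simp add: \<Phi>_def z_eq K_def)
      have "\<Phi> (\<Phi> z) = z"
        unfolding \<Phi>z unfolding \<Phi>_def K_def prod.case union K' pp
        using swap_on_swap_on(1)[OF closed ne] swap_on_swap_on(1)[OF closed' ne'] by (simp add: z_eq)
      moreover have "f (\<Phi> z) = - f z"
        unfolding \<Phi>z unfolding z_eq f_def prod.case partner_sign[OF sub Pfl F G p]
        using prod_swap_on[OF fin closed ne, of "gweight H"] by simp
      moreover have "\<Phi> z \<in> S"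
        unfolding \<Phi>z S_def using pt(1) F' G' by simp
      ultimately show ?thesis by blast
    qed
    show "\<Phi> (\<Phi> z) = z" if "z \<in> S" for z using main[OF that] by blast
    show "\<Phi> (\<Phi> z) = z" if "z \<in> S" for z using main[OF that] by blast
    show "\<Phi> z \<in> S" if "z \<in> S" for z using main[OF that] by blast
    show "\<Phi> z \<in> S" if "z \<in> S" for z using main[OF that] by blast
    show "- f (\<Phi> z) = f z" if "z \<in> S" for z using main[OF that] by simp
  qed
  then have "sum f S + sum f S = 0"
    unfolding sum_negf by (metis add.right_inverse)
  then have "sum f S = 0" by simp
  then show ?thesis unfolding sum_f fl_def .
qed

text \<open>A matching covers the remaining vertices in pairs, so a nonzero sum ties the number of
  removed outputs to the parity of the vertex set.\<close>

lemma removal_sum_parity: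
  assumes "removal_sum H outs X \<noteq> 0" "X \<subseteq> {..<length outs}"
  shows "even (card X) \<longleftrightarrow> even (card (gverts H))"
proof -
  obtain F where F: "F \<in> PM X"
    using assms(1) unfolding removal_sum_eq by (metis all_not_in_conv sum.empty)
  have fin: "finite (gverts H)" using fg by (simp add: finite_graph_def)
  have "e \<subseteq> gverts H" if "e \<in> F" for e
    using perfect_matchingsD(1)[OF F] fg that by (auto simp: finite_graph_def)
  then have "even (card (gverts H - (!) outs ` X))"
    using card_closed_minus_removed[OF fg F subset_refl] by simp
  moreover have sub: "(!) outs ` X \<subseteq> gverts H"
    using assms(2) outs_verts by (auto simp: subset_iff)
  moreover have "card ((!) outs ` X) = card X"
    using inj_on_subset[OF inj_nth assms(2)] by (rule card_image)
  moreover have "card ((!) outs ` X) \<le> card (gverts H)"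
    using card_mono[OF fin sub] .
  ultimately show ?thesis
    using card_Diff_subset[of "(!) outs ` X" "gverts H"] finite_subset[OF sub fin] by auto
qed

end

section \<open>Pendant edges and the choice of outputs\<close>

text \<open>The remainder of the arc from \<open>z\<close> onwards, together with the exterior of
  the disc, is connected and unbounded and avoids \<open>D\<close>; so \<open>z\<close> lies in an
  unbounded component of the complement.\<close>

lemma arc_into_outside:
  fixes g :: "real \<Rightarrow> complex"
  assumes g: "arc g" and D: "D \<subseteq> ball 0 R" and disj: "(path_image g - {pathstart g}) \<inter> D = {}"
    and fin: "norm (pathfinish g) = R"
  shows "path_image g - {pathstart g} \<subseteq> outside D"
proof
  fix z assume z: "z \<in> path_image g - {pathstart g}"
  then obtain s where s: "z = g s" "s \<in> {0..1}" by (auto simp: path_image_def)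
  have s0: "s \<noteq> 0" using z s(1) by (auto simp: pathstart_def)
  define T where "T = g ` {s..1} \<union> - ball 0 R"
  have sub: "g ` {s..1} \<subseteq> path_image g - {pathstart g}"
  proof
    fix w assume "w \<in> g ` {s..1}"
    then obtain u where u: "w = g u" "u \<in> {s..1}" by blast
    then have "g u \<noteq> g 0" using g s s0 unfolding arc_def inj_on_def by force
    then show "w \<in> path_image g - {pathstart g}"
      using u s by (auto simp: path_image_def pathstart_def)
  qed
  have "continuous_on {0..1} g" using g by (simp add: arc_def path_def)
  then have "connected (g ` {s..1})"
    using s(2) by (intro connected_continuous_image) (auto intro: continuous_on_subset)
  moreover have "connected (- ball 0 R :: complex set)"
    by (rule connected_complement_bounded_convex) auto
  moreover have "g 1 \<in> g ` {s..1} \<inter> - ball 0 R"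
    using s(2) fin by (auto simp: pathfinish_def)
  ultimately have "connected T" unfolding T_def by (intro connected_Un) auto
  moreover have "T \<subseteq> - D" using sub disj D unfolding T_def by blast
  moreover have zT: "z \<in> T" using s unfolding T_def by auto
  ultimately have "T \<subseteq> connected_component_set (- D) z"
    by (intro connected_component_maximal)
  moreover have "\<not> bounded (- ball 0 R :: complex set)"
    by (rule cobounded_imp_unbounded) simp
  then have "\<not> bounded T" unfolding T_def by simp
  ultimately have "\<not> bounded (connected_component_set (- D) z)"
    using bounded_subset by blast
  then show "z \<in> outside D"
    using zT \<open>T \<subseteq> - D\<close> unfolding outside_def by blast
qed

lemma arc_start_in_frontier:
  assumes "arc g" "path_image g - {pathstart g} \<subseteq> outside D" "pathstart g \<in> D"
  shows "pathstart g \<in> frontier (outside D)"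
proof -
  have "\<nexists>z. path_image g = {z}"
    using arc_distinct_ends[OF assms(1)] pathstart_in_path_image[of g] pathfinish_in_path_image[of g]
    by (metis singletonD)
  then have "pathstart g islimpt path_image g"
    using connected_imp_perfect[of "path_image g" "pathstart g"] assms(1)
      pathstart_in_path_image[of g] by (simp add: connected_arc_image)
  then have "pathstart g \<in> closure (path_image g - {pathstart g})"
    by (simp add: islimpt_in_closure)
  then have "pathstart g \<in> closure (outside D)"
    using closure_mono[OF assms(2)] by blast
  moreover have "pathstart g \<notin> outside D"
    using assms(3) outside_no_overlap[of D] by blast
  ultimately show ?thesis
    using interior_subset[of "outside D"] unfolding frontier_def by blast
qed

text \<open>The start of an arc is a limit of its other points, which lie in the outer face. This
  supplies the frontier condition whenever a drawing or its list of outputs is changed.\<close>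

lemma outer_arcs_imp_ccw:
  assumes "outer_arcs D ps R \<theta> g" "set ps \<subseteq> D"
  shows "ccw_on_outer_face D ps"
proof -
  have "ps ! j \<in> frontier (outside D)" if "j < length ps" for j
  proof -
    have "ps ! j \<in> D" using nth_mem[OF that] assms(2) by blast
    then show ?thesis
      using arc_start_in_frontier[of "g j" D] outer_arcsD(3,4,6)[OF assms(1) that] by simp
  qed
  then show ?thesis
    using assms(1) by (auto simp: ccw_on_outer_face_iff in_set_conv_nth)
qed

text \<open>Making the far end \<open>y\<close> of a pendant edge the output in place of \<open>x\<close> complements the bit of this
  output: if \<open>y\<close> is kept, it must be matched with \<open>x\<close>.\<close>

definition add_pendant :: "'v wgraph \<Rightarrow> 'v \<Rightarrow> 'v \<Rightarrow> 'v wgraph" where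
  "add_pendant H x y = \<lparr>gverts = insert y (gverts H), gedges = insert {x, y} (gedges H),
     gweight = (gweight H)({x, y} := 1)\<rparr>"

lemma add_pendant_simps [simp]:
  "gverts (add_pendant H x y) = insert y (gverts H)"
  "gedges (add_pendant H x y) = insert {x, y} (gedges H)"
  "gweight (add_pendant H x y) = (gweight H)({x, y} := 1)"
  by (simp_all add: add_pendant_def)

text \<open>The arc \<open>c\<close> meets the old drawing in its start only, so its far end is a
  free point at which \<open>y\<close> can be placed.\<close>

lemma plane_drawing_add_pendant:
  assumes fg: "finite_graph H" and pd: "plane_drawing H pos cur" and x: "x \<in> gverts H"
    and y: "y \<notin> gverts H" and c: "arc c" "pathstart c = pos x"
    and cD: "path_image c \<inter> drawing_set H pos cur \<subseteq> {pos x}"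
  shows "plane_drawing (add_pendant H x y) (pos(y := pathfinish c)) (cur({x, y} := c))"
    and "drawing_set (add_pendant H x y) (pos(y := pathfinish c)) (cur({x, y} := c)) =
         drawing_set H pos cur \<union> path_image c"
proof -
  let ?pos = "pos(y := pathfinish c)" and ?cur = "cur({x, y} := c)" and ?D = "drawing_set H pos cur"
  note pd = plane_drawingD[OF pd]
  have old: "y \<notin> e" "e \<noteq> {x, y}" "?cur e = cur e" "?pos ` e = pos ` e" "e \<subseteq> gverts H"
    if "e \<in> gedges H" for e
  proof -
    show sub: "e \<subseteq> gverts H" using fg that by (auto simp: finite_graph_def)
    then show "y \<notin> e" using y by auto
    then show "e \<noteq> {x, y}" "?pos ` e = pos ` e" by auto
    then show "?cur e = cur e" by simp
  qed
  have pV: "pos v \<in> ?D" if "v \<in> gverts H" for v using that by (simp add: drawing_set_def)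
  have pE: "path_image (cur e) \<subseteq> ?D" if "e \<in> gedges H" for e
    using that by (auto simp: drawing_set_def)
  have fin: "pathfinish c \<notin> ?D"
    using cD arc_distinct_ends[OF c(1)] c(2) pathfinish_in_path_image[of c] by auto
  have cv: "v = x" if "v \<in> gverts H" "pos v \<in> path_image c" for v
    using cD pV[OF that(1)] that pd(1) x by (auto simp: inj_on_def)
  have px: "pos x \<in> path_image c" using c(2) pathstart_in_path_image[of c] by simp
  have xe: "pos x \<in> path_image (cur e) \<longleftrightarrow> x \<in> e" if "e \<in> gedges H" for e
  proof
    show "x \<in> e" if "pos x \<in> path_image (cur e)" using pd(4)[OF \<open>e \<in> gedges H\<close> x that] .
    assume "x \<in> e"
    then have "pos x \<in> {pathstart (cur e), pathfinish (cur e)}"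
      using pd(3)[OF that] by simp
    then show "pos x \<in> path_image (cur e)" by auto
  qed
  have new: "path_image (cur e) \<inter> path_image c = ?pos ` (e \<inter> {x, y})" if e: "e \<in> gedges H" for e
  proof -
    have "path_image (cur e) \<inter> path_image c = (if x \<in> e then {pos x} else {})"
      using xe[OF e] pE[OF e] cD px by auto
    moreover have "e \<inter> {x, y} = (if x \<in> e then {x} else {})"
      using old(1)[OF e] by auto
    ultimately show ?thesis using x y by auto
  qed
  show "plane_drawing (add_pendant H x y) ?pos ?cur"
    unfolding plane_drawing_def
  proof (intro conjI ballI impI)
    show "inj_on ?pos (gverts (add_pendant H x y))"
    proof -
      have "inj_on ?pos (gverts H)"
        by (rule inj_on_cong[THEN iffD2, OF _ pd(1)]) (use y in auto)
      moreover have "?pos ` (gverts H - {y}) = pos ` gverts H" using y by auto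
      moreover have "pos ` gverts H \<subseteq> ?D" unfolding drawing_set_def by (rule Un_upper1)
      then have "pathfinish c \<notin> pos ` gverts H" using fin by (auto dest: subsetD)
      ultimately show ?thesis by simp
    qed
  next
    fix e assume e: "e \<in> gedges (add_pendant H x y)"
    show "arc (?cur e)" using e c(1) pd(2) old(3) by (cases "e = {x, y}") auto
    show "{pathstart (?cur e), pathfinish (?cur e)} = ?pos ` e"
    proof (cases "e = {x, y}")
      case True
      then show ?thesis using c(2) x y by auto
    next
      case False
      then have e: "e \<in> gedges H" using e by simp
      show ?thesis unfolding old(3,4)[OF e] by (rule pd(3)[OF e])
    qed
    show "v \<in> e" if v: "v \<in> gverts (add_pendant H x y)" and im: "?pos v \<in> path_image (?cur e)" for v
    proof (cases "e = {x, y}")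
      case True
      then show ?thesis using v im cv by (cases "v = y") auto
    next
      case False
      then have e: "e \<in> gedges H" using e by simp
      have "v \<noteq> y" using im fin pE[OF e] unfolding old(3)[OF e] by auto
      then show ?thesis using pd(4)[OF e, of v] v im old(3)[OF e] by auto
    qed
    show "path_image (?cur e) \<inter> path_image (?cur f) = ?pos ` (e \<inter> f)"
      if f: "f \<in> gedges (add_pendant H x y)" and "e \<noteq> f" for f
    proof (cases "e = {x, y} \<or> f = {x, y}")
      case True
      then consider "e = {x, y}" "f \<in> gedges H" | "f = {x, y}" "e \<in> gedges H"
        using e f \<open>e \<noteq> f\<close> by auto
      then show ?thesis
      proof cases
        case 1
        then show ?thesis using new[OF 1(2)] old(3)[OF 1(2)] by (simp add: Int_commute)
      next
        case 2
        then show ?thesis using new[OF 2(2)] old(3)[OF 2(2)] by simp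
      qed
    next
      case False
      then have ef: "e \<in> gedges H" "f \<in> gedges H" using e f by auto
      have "?pos ` (e \<inter> f) = pos ` (e \<inter> f)"
        using old(1)[OF ef(1)] by auto
      then show ?thesis
        unfolding old(3)[OF ef(1)] old(3)[OF ef(2)] using pd(5)[OF ef \<open>e \<noteq> f\<close>] by simp
    qed
  qed
  have "?pos ` insert y (gverts H) = insert (pathfinish c) (pos ` gverts H)"
    using y by auto
  moreover have "(\<Union>e\<in>insert {x, y} (gedges H). path_image (?cur e)) =
      path_image c \<union> (\<Union>e\<in>gedges H. path_image (cur e))"
    using old(3) by auto
  ultimately show "drawing_set (add_pendant H x y) ?pos ?cur = ?D \<union> path_image c"
    using pathfinish_in_path_image[of c] by (auto simp: drawing_set_def)
qed

lemma generator_matchgate_add_pendant: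
  assumes gm: "generator_matchgate H outs" and j: "j < length outs" and y: "y \<notin> gverts H"
  shows "generator_matchgate (add_pendant H (outs ! j) y) (outs[j := y])"
proof -
  obtain pos cur where fg: "finite_graph H" and dist: "distinct outs"
    and sub: "set outs \<subseteq> gverts H" and pd: "plane_drawing H pos cur"
    and ccw: "ccw_on_outer_face (drawing_set H pos cur) (map pos outs)"
    using gm unfolding generator_matchgate_def by (elim conjE exE)
  let ?D = "drawing_set H pos cur" and ?x = "outs ! j"
  obtain R \<theta> g where oa: "outer_arcs ?D (map pos outs) R \<theta> g"
    using ccw by (auto simp: ccw_on_outer_face_iff)
  note oa = outer_arcsD[OF oa, unfolded length_map]
  have x: "?x \<in> gverts H" using sub j by auto
  \<comment> \<open>The dangling arc of output \<open>j\<close> is cut in the middle: its first half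
    draws the new edge, its second half is the dangling arc of \<open>y\<close>. The point on the
    circle stays, and with it the cyclic order.\<close>
  define c where "c = subpath 0 (1/2) (g j)"
  define d where "d = subpath (1/2) 1 (g j)"
  have arcg: "arc (g j)" using oa(3)[OF j] .
  have arcs: "arc c" "arc d" using arcg by (auto simp: c_def d_def arc_subpath_arc)
  have ends: "pathstart c = pos ?x" "pathfinish c = g j (1/2)" "pathstart d = g j (1/2)"
    "pathfinish d = of_real R * cis (\<theta> j)"
    using oa(4)[OF j] oa(5)[OF j] j by (auto simp: c_def d_def pathstart_def pathfinish_def subpath_def)
  have c_im: "path_image c = g j ` {0..1/2}" and d_im: "path_image d = g j ` {1/2..1}"
    by (simp_all add: c_def d_def path_image_subpath)
  have g_im: "path_image (g j) = g j ` {0..1}" by (simp add: path_image_def)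
  have inj: "inj_on (g j) {0..1}" using arcg by (simp add: arc_def)
  have cg: "path_image c \<subseteq> path_image (g j)" and dg: "path_image d \<subseteq> path_image (g j)"
    unfolding c_im d_im g_im by auto
  have gD: "path_image (g i) \<inter> ?D \<subseteq> {pos (outs ! i)}" if "i < length outs" for i
  proof -
    have "path_image (g i) - {pos (outs ! i)} \<subseteq> outside ?D" using oa(6)[OF that] that by simp
    then show ?thesis using outside_no_overlap[of ?D] by blast
  qed
  have "pos ?x = g j 0" using ends(1) by (simp add: c_def pathstart_def subpath_def)
  moreover have "g j 0 \<notin> path_image d"
    unfolding d_im by (subst inj_on_image_mem_iff[OF inj]) auto
  ultimately have dD: "path_image d \<inter> ?D = {}"
    using gD[OF j] dg by auto
  have cd: "path_image c \<inter> path_image d \<subseteq> {g j (1/2)}"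
    unfolding c_im d_im by (subst inj_on_image_Int[OF inj, symmetric]) auto
  have g1: "of_real R * cis (\<theta> j) = g j 1" using oa(5)[OF j] by (simp add: pathfinish_def)
  have c_fin: "of_real R * cis (\<theta> j) \<notin> path_image c"
    unfolding g1 c_im by (subst inj_on_image_mem_iff[OF inj]) auto
  have c_ball: "path_image c \<subseteq> ball 0 R"
    using oa(7)[OF j] cg c_fin by blast
  let ?H = "add_pendant H ?x y" and ?outs = "outs[j := y]"
  let ?pos = "pos(y := pathfinish c)" and ?cur = "cur({?x, y} := c)"
  have cD: "path_image c \<inter> ?D \<subseteq> {pos ?x}" using gD[OF j] cg by auto
  note pd' = plane_drawing_add_pendant[OF fg pd x y arcs(1) ends(1) cD]
  let ?D' = "?D \<union> path_image c"
  let ?g = "g(j := d)"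
  have D': "?D' \<subseteq> ball 0 R" using oa(2) c_ball by auto
  have pos_outs: "map ?pos ?outs ! i = (if i = j then pathfinish c else pos (outs ! i))"
    if "i < length outs" for i
  proof -
    have "outs ! i \<noteq> y" using nth_mem[OF that] y sub by blast
    then show ?thesis using that by (simp add: nth_list_update)
  qed
  have disj_gd: "path_image (g i) \<inter> path_image (g j) = {}" if "i < length outs" "i \<noteq> j" for i
    using oa(8)[OF that(1) j that(2)] .
  have g': "arc (?g i) \<and> pathstart (?g i) = map ?pos ?outs ! i \<and>
      pathfinish (?g i) = of_real R * cis (\<theta> i) \<and>
      path_image (?g i) - {pathstart (?g i)} \<subseteq> outside ?D' \<and>
      path_image (?g i) - {pathfinish (?g i)} \<subseteq> ball 0 R" if i: "i < length outs" for i
  proof (intro conjI)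
    show a: "arc (?g i)" using oa(3)[OF i] arcs by simp
    show s: "pathstart (?g i) = map ?pos ?outs ! i"
      unfolding pos_outs[OF i] using oa(4)[OF i] ends i by simp
    show f: "pathfinish (?g i) = of_real R * cis (\<theta> i)" using oa(5)[OF i] ends by simp
    show "path_image (?g i) - {pathfinish (?g i)} \<subseteq> ball 0 R"
      unfolding f using oa(7)[OF i] oa(7)[OF j] dg by auto
    \<comment> \<open>The enlarged drawing has a smaller outer face, so the old inclusions in
      \<open>outside\<close> cannot be reused; \<open>arc_into_outside\<close> recovers them from
      disjointness.\<close>
    have "(path_image (?g i) - {pathstart (?g i)}) \<inter> ?D' = {}"
    proof (cases "i = j")
      case True
      then show ?thesis using dD cd ends by auto
    next
      case False
      then have "pathstart (?g i) = pos (outs ! i)" using s pos_outs[OF i] by simp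
      then show ?thesis using False gD[OF i] disj_gd[OF i False] cg by auto
    qed
    then show "path_image (?g i) - {pathstart (?g i)} \<subseteq> outside ?D'"
      by (rule arc_into_outside[OF a D']) (use f oa(1) in \<open>simp add: norm_mult\<close>)
  qed
  have "outer_arcs ?D' (map ?pos ?outs) R \<theta> ?g"
    unfolding outer_arcs_def
  proof (intro conjI allI impI)
    fix i assume "i < length (map ?pos ?outs)"
    then have i: "i < length outs" by simp
    show "arc (?g i)" "pathstart (?g i) = map ?pos ?outs ! i"
      "pathfinish (?g i) = of_real R * cis (\<theta> i)"
      "path_image (?g i) - {pathstart (?g i)} \<subseteq> outside ?D'"
      "path_image (?g i) - {pathfinish (?g i)} \<subseteq> ball 0 R"
      using g'[OF i] by blast+
    fix k assume "k < length (map ?pos ?outs)" and ik: "i \<noteq> k"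
    then have k: "k < length outs" by simp
    show "path_image (?g i) \<inter> path_image (?g k) = {}"
      using oa(8)[OF i k ik] disj_gd[OF i] disj_gd[OF k] dg ik by (auto simp: disjoint_iff)
  next
    fix i k assume "i < k \<and> k < length (map ?pos ?outs)"
    then show "\<theta> i < \<theta> k" "\<theta> k < \<theta> i + 2 * pi" using oa(9)[of i k] by auto
  qed (use oa(1) D' in auto)
  moreover have "set (map ?pos ?outs) \<subseteq> ?D'"
  proof -
    have "map ?pos ?outs ! i \<in> ?D'" if "i < length outs" for i
    proof -
      have "outs ! i \<in> gverts H" using nth_mem[OF that] sub by blast
      then show ?thesis
        unfolding pos_outs[OF that] using pathfinish_in_path_image[of c]
        by (auto simp: drawing_set_def)
    qed
    then show ?thesis
      unfolding subset_iff by (metis in_set_conv_nth length_map length_list_update)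
  qed
  ultimately have "ccw_on_outer_face ?D' (map ?pos ?outs)" by (rule outer_arcs_imp_ccw)
  moreover have "finite_graph ?H"
    using fg x y by (auto simp: finite_graph_def card_2_iff)
  moreover have "distinct ?outs"
    using dist y sub j by (auto intro: distinct_list_update)
  moreover have "set ?outs \<subseteq> gverts ?H"
    using sub set_update_subset_insert[of outs j y] by auto
  ultimately show ?thesis
    unfolding generator_matchgate_def using pd'(1)
    by (intro conjI exI[of _ ?pos] exI[of _ ?cur]) (simp_all only: pd'(2))
qed

section \<open>Matching sums after adding a pendant edge\<close>

lemma perfect_matchings_add_pendant_removed:
  assumes fg: "finite_graph H" and y: "y \<notin> gverts H" "y \<notin> Z"
  shows "perfect_matchings (remove_verts (add_pendant H x y) (insert y Z)) =
         perfect_matchings (remove_verts H Z)"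
proof -
  have ey: "y \<notin> e" if "e \<in> gedges H" for e
    using fg y that by (auto simp: finite_graph_def)
  have "F \<subseteq> insert {x, y} (gedges H) \<and> (\<forall>e\<in>F. e \<inter> insert y Z = {}) \<longleftrightarrow>
      F \<subseteq> gedges H \<and> (\<forall>e\<in>F. e \<inter> Z = {})" for F
    using ey by blast
  moreover have "insert y (gverts H) - insert y Z = gverts H - Z" using y by auto
  ultimately have "F \<in> perfect_matchings (remove_verts (add_pendant H x y) (insert y Z)) \<longleftrightarrow>
      F \<in> perfect_matchings (remove_verts H Z)" for F
    by (simp only: perfect_matchings_remove_verts add_pendant_simps conj_assoc[symmetric])
  then show ?thesis by blast
qed

lemma bij_betw_perfect_matchings_add_pendant:
  assumes fg: "finite_graph H" and x: "x \<in> gverts H" "x \<notin> Z" and y: "y \<notin> gverts H" "y \<notin> Z"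
  shows "bij_betw (insert {x, y}) (perfect_matchings (remove_verts H (insert x Z)))
           (perfect_matchings (remove_verts (add_pendant H x y) Z))"
proof -
  have ey: "y \<notin> e" if "e \<in> gedges H" for e
    using fg y that by (auto simp: finite_graph_def)
  have xy: "{x, y} \<notin> gedges H" using ey by blast
  show ?thesis
  proof (rule bij_betw_byWitness[where f' = "\<lambda>F. F - {{x, y}}"])
    show "\<forall>F\<in>perfect_matchings (remove_verts H (insert x Z)). insert {x, y} F - {{x, y}} = F"
    proof
      fix F assume "F \<in> perfect_matchings (remove_verts H (insert x Z))"
      then have "{x, y} \<notin> F" using perfect_matchingsD(1) xy by blast
      then show "insert {x, y} F - {{x, y}} = F" by simp
    qed
  next
    have mem: "{x, y} \<in> F" if F: "F \<in> perfect_matchings (remove_verts (add_pendant H x y) Z)" for F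
    proof -
      obtain e where e: "e \<in> F" "y \<in> e"
        using perfect_matchingsD(3)[OF F, of y] y by auto
      then show ?thesis using perfect_matchingsD(1)[OF F] ey[of e] by auto
    qed
    then show "\<forall>F\<in>perfect_matchings (remove_verts (add_pendant H x y) Z). insert {x, y} (F - {{x, y}}) = F"
      by blast
    show "(\<lambda>F. F - {{x, y}}) ` perfect_matchings (remove_verts (add_pendant H x y) Z) \<subseteq>
        perfect_matchings (remove_verts H (insert x Z))"
    proof clarify
      fix F assume F: "F \<in> perfect_matchings (remove_verts (add_pendant H x y) Z)"
      note D = perfect_matchingsD[OF F, unfolded add_pendant_simps]
      have nx: "x \<notin> e" if "e \<in> F - {{x, y}}" for e
        using D(4)[of x e "{x, y}"] x mem[OF F] that by auto
      show "F - {{x, y}} \<in> perfect_matchings (remove_verts H (insert x Z))"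
        unfolding perfect_matchings_remove_verts
      proof (intro conjI ballI)
        show "F - {{x, y}} \<subseteq> gedges H" using D(1) by blast
        show "e \<inter> insert x Z = {}" if "e \<in> F - {{x, y}}" for e
          using D(2)[of e] nx[OF that] that by blast
        fix v assume v: "v \<in> gverts H - insert x Z"
        then have vxy: "v \<notin> {x, y}" using y by auto
        obtain e where e: "e \<in> F" "v \<in> e" using D(3)[of v] v by auto
        show "\<exists>!e. e \<in> F - {{x, y}} \<and> v \<in> e"
        proof (rule ex1I[of _ e])
          show "e \<in> F - {{x, y}} \<and> v \<in> e" using e vxy by auto
          show "f = e" if "f \<in> F - {{x, y}} \<and> v \<in> f" for f
            using D(4)[of v f e] v e that by simp
        qed
      qed
    qed
    show "insert {x, y} ` perfect_matchings (remove_verts H (insert x Z)) \<subseteq>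
        perfect_matchings (remove_verts (add_pendant H x y) Z)"
    proof clarify
      fix F assume F: "F \<in> perfect_matchings (remove_verts H (insert x Z))"
      note D = perfect_matchingsD[OF F]
      show "insert {x, y} F \<in> perfect_matchings (remove_verts (add_pendant H x y) Z)"
        unfolding perfect_matchings_remove_verts add_pendant_simps
      proof (intro conjI ballI)
        show "insert {x, y} F \<subseteq> insert {x, y} (gedges H)" using D(1) by blast
        show "e \<inter> Z = {}" if "e \<in> insert {x, y} F" for e
          using D(2)[of e] x y that by auto
        fix v assume v: "v \<in> insert y (gverts H) - Z"
        show "\<exists>!e. e \<in> insert {x, y} F \<and> v \<in> e"
        proof (cases "v \<in> {x, y}")
          case True
          have "v \<notin> e" if "e \<in> F" for e
            using D(1) D(2)[OF that] ey[of e] True that by auto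
          then show ?thesis using True by (intro ex1I[of _ "{x, y}"]) auto
        next
          case False
          then obtain e where e: "e \<in> F" "v \<in> e" using D(3)[of v] v by auto
          show ?thesis
          proof (rule ex1I[of _ e])
            show "e \<in> insert {x, y} F \<and> v \<in> e" using e by simp
            show "f = e" if "f \<in> insert {x, y} F \<and> v \<in> f" for f
              using D(4)[of v f e] v e that False by auto
          qed
        qed
      qed
    qed
  qed
qed

text \<open>Removing \<open>y\<close> deletes the pendant edge and keeps the old output; keeping
  \<open>y\<close> forces the pendant edge into the matching and so consumes the old output. Its
  weight 1 leaves the products unchanged.\<close>

lemma removal_sum_add_pendant:
  assumes fg: "finite_graph H" and outs: "distinct outs" "set outs \<subseteq> gverts H"
    and y: "y \<notin> gverts H" and j: "j < length outs" and X: "X \<subseteq> {..<length outs}"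
  shows "removal_sum (add_pendant H (outs ! j) y) (outs[j := y]) X =
         removal_sum H outs ((X - {j}) \<union> ({j} - X))"
proof -
  let ?H = "add_pendant H (outs ! j) y"
  have eq: "outs[j := y] ! i = outs ! i" if "i \<noteq> j" for i using that by simp
  have V: "(!) outs ` X' \<subseteq> gverts H" if "X' \<subseteq> {..<length outs}" for X'
    using that outs(2) by (auto simp: subset_iff)
  have xV: "outs ! j \<in> gverts H" using outs(2) j by auto
  have ey: "y \<notin> e" if "e \<in> gedges H" for e
    using fg y that by (auto simp: finite_graph_def)
  have w: "prod (gweight ?H) F = prod (gweight H) F" if "F \<subseteq> gedges H" for F
    using ey that by (intro prod.cong) auto
  show ?thesis
  proof (cases "j \<in> X")
    case True
    let ?X = "X - {j}"
    have yZ: "y \<notin> (!) outs ` ?X" using V[of ?X] X y by blast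
    have "X = insert j ?X" using True by auto
    then have "(!) (outs[j := y]) ` X = insert (outs[j := y] ! j) ((!) (outs[j := y]) ` ?X)"
      by (metis image_insert)
    also have "\<dots> = insert y ((!) outs ` ?X)"
      using eq j by auto
    finally have im: "(!) (outs[j := y]) ` X = insert y ((!) outs ` ?X)" .
    have "removal_sum ?H (outs[j := y]) X = (\<Sum>F\<in>perfect_matchings (remove_verts H ((!) outs ` ?X)).
        prod (gweight ?H) F)"
      unfolding removal_sum_eq im perfect_matchings_add_pendant_removed[OF fg y yZ] ..
    also have "\<dots> = removal_sum H outs ?X"
      unfolding removal_sum_eq by (intro sum.cong refl w perfect_matchingsD(1))
    finally show ?thesis using True by (simp add: Diff_insert_absorb)
  next
    case False
    let ?Z = "(!) outs ` X"
    have im: "(!) (outs[j := y]) ` X = ?Z"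
      using False eq by (intro image_cong refl) metis
    have yZ: "y \<notin> ?Z" using V[OF X] y by blast
    have xZ: "outs ! j \<notin> ?Z"
      using outs(1) X j False by (auto simp: nth_eq_iff_index_eq subset_iff)
    have xy: "{outs ! j, y} \<notin> F" if "F \<in> perfect_matchings (remove_verts H (insert (outs ! j) ?Z))" for F
      using perfect_matchingsD(1)[OF that] ey by blast
    have finE: "finite (gedges H)"
      using fg by (auto simp: finite_graph_def intro: finite_subset[of _ "Pow (gverts H)"])
    have "removal_sum ?H (outs[j := y]) X =
        (\<Sum>F\<in>perfect_matchings (remove_verts H (insert (outs ! j) ?Z)).
          prod (gweight ?H) (insert {outs ! j, y} F))"
      unfolding removal_sum_eq im
      by (rule sum.reindex_bij_betw[symmetric]) 
         (rule bij_betw_perfect_matchings_add_pendant[OF fg xV xZ y yZ])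
    also have "\<dots> = (\<Sum>F\<in>perfect_matchings (remove_verts H (insert (outs ! j) ?Z)).
          prod (gweight H) F)"
    proof (rule sum.cong[OF refl])
      fix F assume F: "F \<in> perfect_matchings (remove_verts H (insert (outs ! j) ?Z))"
      have sub: "F \<subseteq> gedges H" using perfect_matchingsD(1)[OF F] .
      then have "finite F" using finE finite_subset by blast
      then show "prod (gweight ?H) (insert {outs ! j, y} F) = prod (gweight H) F"
        using xy[OF F] w[OF sub] by simp
    qed
    also have "\<dots> = removal_sum H outs (insert j X)"
      by (simp add: removal_sum_eq)
    finally show ?thesis using False by simp
  qed
qed

text \<open>A signature as a function of the set of removed labels, on which complementing and
  dropping outputs are plain set operations. Only subsets of \<open>{..<m}\<close> are constrained,
  so that \<open>\<Gamma>\<close> may be given by any convenient formula.\<close>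

definition matchgate_function :: "nat \<Rightarrow> (nat set \<Rightarrow> complex) \<Rightarrow> bool" where
  "matchgate_function m \<Gamma> \<longleftrightarrow>
     (\<exists>(H :: nat wgraph) outs. generator_matchgate H outs \<and> length outs = m \<and>
        (\<forall>X\<subseteq>{..<m}. \<Gamma> X = removal_sum H outs X))"

lemma matchgate_function_flip:
  assumes "matchgate_function m \<Gamma>" "j < m"
  shows "matchgate_function m (\<lambda>X. \<Gamma> ((X - {j}) \<union> ({j} - X)))"
proof -
  obtain H :: "nat wgraph" and outs where gm: "generator_matchgate H outs" and m: "length outs = m"
    and \<Gamma>: "\<And>X. X \<subseteq> {..<m} \<Longrightarrow> \<Gamma> X = removal_sum H outs X"
    using assms(1) unfolding matchgate_function_def by blast
  have fg: "finite_graph H" and outs: "distinct outs" "set outs \<subseteq> gverts H"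
    using gm by (auto simp: generator_matchgate_def)
  have "finite (gverts H)" using fg by (simp add: finite_graph_def)
  then obtain y where y: "y \<notin> gverts H" using ex_new_if_finite infinite_UNIV_nat by blast
  have "\<Gamma> ((X - {j}) \<union> ({j} - X)) = removal_sum (add_pendant H (outs ! j) y) (outs[j := y]) X"
    if "X \<subseteq> {..<m}" for X
  proof -
    have "(X - {j}) \<union> ({j} - X) \<subseteq> {..<m}" using that assms(2) by auto
    then show ?thesis
      using removal_sum_add_pendant[OF fg outs y, of j X] \<Gamma> that m assms(2) by simp
  qed
  then show ?thesis
    unfolding matchgate_function_def
    using generator_matchgate_add_pendant[OF gm _ y, of j] m assms(2)
    by (intro exI[of _ "add_pendant H (outs ! j) y"] exI[of _ "outs[j := y]"]) simp
qed

lemma matchgate_function_flips: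
  assumes "matchgate_function m \<Gamma>" "S \<subseteq> {..<m}"
  shows "matchgate_function m (\<lambda>X. \<Gamma> ((X - S) \<union> (S - X)))"
proof -
  have "finite S" using assms(2) finite_subset by blast
  then show ?thesis using assms(2)
  proof (induction S)
    case (insert j S)
    have "(((X - {j}) \<union> ({j} - X)) - S) \<union> (S - ((X - {j}) \<union> ({j} - X))) =
        (X - insert j S) \<union> (insert j S - X)" for X
      using insert.hyps(2) by auto
    then show ?case
      using matchgate_function_flip[OF insert.IH, of j] insert.prems by simp
  qed (use assms(1) in simp)
qed

text \<open>Graph and drawing stay as they are. Outputs outside the range of \<open>f\<close> become
  ordinary vertices that are never removed, that is, their bits are fixed to 0; monotonicity of
  \<open>f\<close> keeps the cyclic order.\<close>

lemma matchgate_function_restrict: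
  assumes "matchgate_function m \<Gamma>" and f: "strict_mono_on {..<k} f" "f ` {..<k} \<subseteq> {..<m}"
  shows "matchgate_function k (\<lambda>X. \<Gamma> (f ` X))"
proof -
  obtain H :: "nat wgraph" and outs where gm: "generator_matchgate H outs" and m: "length outs = m"
    and \<Gamma>: "\<And>X. X \<subseteq> {..<m} \<Longrightarrow> \<Gamma> X = removal_sum H outs X"
    using assms(1) unfolding matchgate_function_def by blast
  obtain pos cur where fg: "finite_graph H" and dist: "distinct outs"
    and sub: "set outs \<subseteq> gverts H" and pd: "plane_drawing H pos cur"
    and ccw: "ccw_on_outer_face (drawing_set H pos cur) (map pos outs)"
    using gm unfolding generator_matchgate_def by (elim conjE exE)
  let ?D = "drawing_set H pos cur"
  define outs' where "outs' = map (\<lambda>i. outs ! f i) [0..<k]"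
  have len: "length outs' = k" and nth: "\<And>i. i < k \<Longrightarrow> outs' ! i = outs ! f i"
    by (simp_all add: outs'_def)
  have fm: "f i < m" if "i < k" for i using f(2) that by blast
  have fless: "f i < f i'" if "i < i'" "i' < k" for i i'
    using strict_mono_onD[OF f(1), of i i'] that by simp
  have fneq: "f i \<noteq> f i'" if "i < k" "i' < k" "i \<noteq> i'" for i i'
    using fless[of i i'] fless[of i' i] that by (cases "i < i'") auto
  have sub': "set outs' \<subseteq> set outs"
    using fm m by (auto simp: outs'_def)
  have dist': "distinct outs'"
    unfolding distinct_conv_nth len using dist fm fneq m nth by (simp add: nth_eq_iff_index_eq)
  obtain R \<theta> g where oa: "outer_arcs ?D (map pos outs) R \<theta> g"
    using ccw by (auto simp: ccw_on_outer_face_iff)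
  note oa = outer_arcsD[OF oa, unfolded length_map m]
  have "outer_arcs ?D (map pos outs') R (\<theta> \<circ> f) (g \<circ> f)"
    unfolding outer_arcs_def length_map len comp_def
  proof (intro conjI allI impI)
    fix i assume i: "i < k"
    have p: "map pos outs' ! i = map pos outs ! f i"
      using i fm[OF i] nth[OF i] len m by simp
    show "arc (g (f i))" using oa(3)[OF fm[OF i]] .
    show s: "pathstart (g (f i)) = map pos outs' ! i" using oa(4)[OF fm[OF i]] p by simp
    show e: "pathfinish (g (f i)) = of_real R * cis (\<theta> (f i))" using oa(5)[OF fm[OF i]] .
    show "path_image (g (f i)) - {pathstart (g (f i))} \<subseteq> outside ?D"
      unfolding s p using oa(6)[OF fm[OF i]] .
    show "path_image (g (f i)) - {pathfinish (g (f i))} \<subseteq> ball 0 R"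
      unfolding e using oa(7)[OF fm[OF i]] .
    show "path_image (g (f i)) \<inter> path_image (g (f i')) = {}" if "i' < k" "i \<noteq> i'" for i'
      using oa(8)[OF fm[OF i] fm[OF that(1)] fneq[OF i that]] .
  next
    fix i i' assume "i < i' \<and> i' < k"
    then show "\<theta> (f i) < \<theta> (f i')" "\<theta> (f i') < \<theta> (f i) + 2 * pi"
      using oa(9)[of "f i" "f i'"] fless[of i i'] fm[of i'] by auto
  qed (use oa(1,2) in auto)
  moreover have "set (map pos outs') \<subseteq> ?D"
    using sub sub' by (auto simp: drawing_set_def)
  ultimately have "ccw_on_outer_face ?D (map pos outs')" by (rule outer_arcs_imp_ccw)
  then have "generator_matchgate H outs'"
    unfolding generator_matchgate_def using fg dist' sub sub' pd by blast
  moreover have "\<Gamma> (f ` X) = removal_sum H outs' X" if "X \<subseteq> {..<k}" for X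
  proof -
    have "f ` X \<subseteq> {..<m}" using that f(2) by blast
    moreover have "(!) outs' ` X = (!) outs ` f ` X"
      unfolding image_image using nth that by (intro image_cong refl) auto
    ultimately show ?thesis using \<Gamma> by (simp add: removal_sum_def)
  qed
  ultimately show ?thesis
    unfolding matchgate_function_def using len by blast
qed

section \<open>Tensor powers\<close>

definition tuples :: "nat \<Rightarrow> nat \<Rightarrow> nat list set" where
  "tuples k n = {js. length js = n \<and> set js \<subseteq> {..<k}}"

lemma lex_index_Nil [simp]: "lex_index k [] = 0"
  by (simp add: lex_index_def)

lemma lex_index_snoc: "lex_index k (xs @ [x]) = k * lex_index k xs + x"
  by (simp add: lex_index_def)

lemma lex_index_Cons: "lex_index k (x # xs) = x * k ^ length xs + lex_index k xs"
proof (induction xs rule: rev_induct)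
  case (snoc y ys)
  have "lex_index k (x # ys @ [y]) = k * lex_index k (x # ys) + y"
    using lex_index_snoc[of k "x # ys" y] by simp
  then show ?case using snoc by (simp add: lex_index_snoc algebra_simps)
qed (simp add: lex_index_def)

lemma lex_index_less:
  assumes "js \<in> tuples k n"
  shows "lex_index k js < k ^ n"
  using assms
proof (induction js arbitrary: n)
  case (Cons x xs)
  then have IH: "lex_index k xs < k ^ length xs" and x: "Suc x \<le> k" and n: "n = Suc (length xs)"
    by (auto simp: tuples_def)
  have "lex_index k (x # xs) < Suc x * k ^ length xs"
    using IH by (simp add: lex_index_Cons)
  also have "\<dots> \<le> k * k ^ length xs" using x by (rule mult_le_mono1)
  finally show ?case by (simp add: n)
qed (auto simp: tuples_def)

lemma lex_tuple_lex_index: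
  assumes "js \<in> tuples k n"
  shows "lex_tuple k n (lex_index k js) = js"
  using assms
proof (induction js arbitrary: n rule: rev_induct)
  case (snoc y ys)
  then have y: "y < k" and n: "n = Suc (length ys)" and ys: "ys \<in> tuples k (length ys)"
    by (auto simp: tuples_def)
  show ?case
    using y snoc.IH[OF ys] by (simp add: n lex_tuple_Suc lex_index_snoc)
qed (simp add: tuples_def lex_tuple_def)

lemma lex_tuple_in_tuples:
  assumes "c < k ^ n"
  shows "lex_tuple k n c \<in> tuples k n"
proof (cases "n = 0")
  case False
  then have "0 < k" using assms by (cases k) (auto simp: power_0_left)
  then show ?thesis by (auto simp: tuples_def lex_tuple_def)
qed (simp add: tuples_def lex_tuple_def)

lemma lex_index_lex_tuple':
  assumes "c < k ^ n"
  shows "lex_index k (lex_tuple k n c) = c"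
proof (cases "k = 0")
  case True
  then have "n = 0" using assms by (cases n) auto
  then show ?thesis using assms by (simp add: lex_tuple_def)
qed (use assms lex_index_lex_tuple in auto)

lemma bij_betw_lex_index: "bij_betw (lex_index k) (tuples k n) {0..<k ^ n}"
  by (rule bij_betw_byWitness[where f' = "lex_tuple k n"])
    (auto simp: lex_tuple_lex_index lex_index_lex_tuple' lex_index_less lex_tuple_in_tuples)

lemma sum_lex_index: "(\<Sum>c = 0..<k ^ n. f c) = (\<Sum>js\<in>tuples k n. f (lex_index k js))"
  using sum.reindex_bij_betw[OF bij_betw_lex_index, of f k n] by simp

text \<open>Positions count from 0 here, while tensor positions \<open>t\<close> count from 1; hence
  \<open>t - 1\<close> in all uses with \<open>matrix_form\<close>.\<close>

definition insert_at :: "nat \<Rightarrow> nat \<Rightarrow> nat list \<Rightarrow> nat list" where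
  "insert_at t x js = take t js @ x # drop t js"

lemma insert_at_in_tuples: "x < k \<Longrightarrow> js \<in> tuples k n \<Longrightarrow> insert_at t x js \<in> tuples k (Suc n)"
  by (auto simp: tuples_def insert_at_def dest: in_set_takeD in_set_dropD)

lemma bij_betw_insert_at:
  assumes "t \<le> n"
  shows "bij_betw (\<lambda>(x, js). insert_at t x js) ({..<k} \<times> tuples k n) (tuples k (Suc n))"
proof (rule bij_betw_byWitness[where f' = "\<lambda>js. (js ! t, take t js @ drop (Suc t) js)"])
  show "\<forall>a\<in>{..<k} \<times> tuples k n. (\<lambda>js. (js ! t, take t js @ drop (Suc t) js))
      (case a of (x, js) \<Rightarrow> insert_at t x js) = a"
    using assms by (auto simp: tuples_def insert_at_def nth_append min_def)
  show "\<forall>a'\<in>tuples k (Suc n). (case (a' ! t, take t a' @ drop (Suc t) a') of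
      (x, js) \<Rightarrow> insert_at t x js) = a'"
    using assms by (auto simp: tuples_def insert_at_def min_def Cons_nth_drop_Suc)
  show "(\<lambda>(x, js). insert_at t x js) ` ({..<k} \<times> tuples k n) \<subseteq> tuples k (Suc n)"
    by (auto simp: insert_at_in_tuples)
  show "(\<lambda>js. (js ! t, take t js @ drop (Suc t) js)) ` tuples k (Suc n) \<subseteq> {..<k} \<times> tuples k n"
  proof clarsimp
    fix js assume js: "js \<in> tuples k (Suc n)"
    then have "t < length js" using assms by (simp add: tuples_def)
    then have "js ! t \<in> set js" by (rule nth_mem)
    then have "js ! t < k" using js unfolding tuples_def by blast
    then show "js ! t < k \<and> take t js @ drop (Suc t) js \<in> tuples k n"
      using js assms by (auto simp: tuples_def dest: in_set_takeD in_set_dropD)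
  qed
qed

lemma sum_insert_at:
  assumes "t \<le> n"
  shows "(\<Sum>js\<in>tuples k (Suc n). f js) = (\<Sum>x<k. \<Sum>js\<in>tuples k n. f (insert_at t x js))"
proof -
  have "(\<Sum>js\<in>tuples k (Suc n). f js) = (\<Sum>(x, js)\<in>{..<k} \<times> tuples k n. f (insert_at t x js))"
    using sum.reindex_bij_betw[OF bij_betw_insert_at[OF assms], of f k] by (simp add: case_prod_beta)
  then show ?thesis by (simp add: sum.cartesian_product)
qed

section \<open>Entries and matrix forms of tensor powers\<close>

lemma tensor_power_carrier [simp]:
  "A \<in> carrier_mat a b \<Longrightarrow> tensor_power A n \<in> carrier_mat (a ^ n) (b ^ n)"
  by (induction n) (auto simp: kron_mat_def)

lemma kron_mat_index:
  assumes "x < dim_row A" "y < dim_col A" "i < dim_row B" "j < dim_col B"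
  shows "kron_mat A B $$ (x * dim_row B + i, y * dim_col B + j) = A $$ (x, y) * B $$ (i, j)"
proof -
  have "x * r + i < a * r" if "x < a" "i < r" for x a i r :: nat
  proof -
    have "x * r + i < Suc x * r" using that by simp
    also have "\<dots> \<le> a * r" using that by (intro mult_le_mono1) simp
    finally show ?thesis .
  qed
  then show ?thesis using assms by (simp add: kron_mat_def)
qed

text \<open>For multi-indices of length \<open>n\<close> this is the entry of the
  \<open>n\<close>-th tensor power of \<open>A\<close>; see
  \<open>tensor_power_index\<close>.\<close>

definition entry_prod :: "complex Matrix.mat \<Rightarrow> nat list \<Rightarrow> nat list \<Rightarrow> complex" where
  "entry_prod A is js = prod_list (map2 (\<lambda>i j. A $$ (i, j)) is js)"

lemma entry_prod_simps [simp]: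
  "entry_prod A [] js = 1" "entry_prod A (i # is) (j # js) = A $$ (i, j) * entry_prod A is js"
  by (simp_all add: entry_prod_def)

lemma entry_prod_append:
  "length is = length js \<Longrightarrow>
     entry_prod A (is @ is') (js @ js') = entry_prod A is js * entry_prod A is' js'"
  by (simp add: entry_prod_def)

lemma tensor_power_index:
  assumes A: "A \<in> carrier_mat a b" and "is \<in> tuples a n" "js \<in> tuples b n"
  shows "tensor_power A n $$ (lex_index a is, lex_index b js) = entry_prod A is js"
  using assms(2,3)
proof (induction n arbitrary: "is" js)
  case (Suc n)
  obtain i is' where i: "is = i # is'" "i < a" "is' \<in> tuples a n"
    using Suc.prems(1) by (cases "is") (auto simp: tuples_def)
  obtain j js' where j: "js = j # js'" "j < b" "js' \<in> tuples b n"
    using Suc.prems(2) by (cases js) (auto simp: tuples_def)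
  have c: "tensor_power A n \<in> carrier_mat (a ^ n) (b ^ n)" using A by simp
  have "lex_index a is = i * a ^ n + lex_index a is'" "lex_index b js = j * b ^ n + lex_index b js'"
    using i j by (auto simp: lex_index_Cons tuples_def)
  then show ?case
    using kron_mat_index[of i A j "lex_index a is'" "tensor_power A n" "lex_index b js'"] A c i j
      lex_index_less[OF i(3)] lex_index_less[OF j(3)] Suc.IH[OF i(3) j(3)]
    by simp
qed (simp add: tuples_def)

lemma tensor_power_mult_vec_index:
  assumes A: "A \<in> carrier_mat a b" and G: "G \<in> carrier_vec (b ^ n)" and "is": "is \<in> tuples a n"
  shows "vec_index (tensor_power A n *\<^sub>v G) (lex_index a is) =
         (\<Sum>js\<in>tuples b n. entry_prod A is js * vec_index G (lex_index b js))"
proof -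
  have c: "tensor_power A n \<in> carrier_mat (a ^ n) (b ^ n)" using A by simp
  have "vec_index (tensor_power A n *\<^sub>v G) (lex_index a is) =
      (\<Sum>c = 0..<b ^ n. tensor_power A n $$ (lex_index a is, c) * vec_index G c)"
    using lex_index_less[OF "is"] c G by (simp add: scalar_prod_def)
  then show ?thesis
    using tensor_power_index[OF A "is"] by (simp add: sum_lex_index)
qed

text \<open>If \<open>N\<close> consists of the rows of \<open>M\<close> chosen by
  \<open>\<rho>\<close>, its tensor power consists of the rows whose digits are all chosen by
  \<open>\<rho>\<close>. So the signature formed with \<open>M'\<close> is a subfamily of the
  entries of the given one.\<close>

lemma tensor_power_rows:
  assumes M: "M \<in> carrier_mat a b" and N: "N \<in> carrier_mat c b" and G: "G \<in> carrier_vec (b ^ n)"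
    and "is": "is \<in> tuples c n" and \<rho>: "\<And>i. i < c \<Longrightarrow> \<rho> i < a"
    and rows: "\<And>i j. i < c \<Longrightarrow> j < b \<Longrightarrow> N $$ (i, j) = M $$ (\<rho> i, j)"
  shows "vec_index (tensor_power N n *\<^sub>v G) (lex_index c is) =
         vec_index (tensor_power M n *\<^sub>v G) (lex_index a (map \<rho> is))"
proof -
  have "map \<rho> is \<in> tuples a n" using "is" \<rho> by (auto simp: tuples_def)
  moreover have "entry_prod N is js = entry_prod M (map \<rho> is) js" if "js \<in> tuples b n" for js
    using "is" that
  proof (induction "is" arbitrary: js n)
    case (Cons i is')
    then obtain j js' where "js = j # js'" by (cases js) (auto simp: tuples_def)
    then show ?case using Cons.prems Cons.IH[of "n - 1" js'] rows by (auto simp: tuples_def)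
  qed simp
  ultimately show ?thesis
    using tensor_power_mult_vec_index[OF M G] tensor_power_mult_vec_index[OF N G "is"] by simp
qed

lemma mult_mat_index_sum:
  assumes "A \<in> carrier_mat a k" "B \<in> carrier_mat k b" "i < a" "j < b"
  shows "(A * B) $$ (i, j) = (\<Sum>x<k. A $$ (i, x) * B $$ (x, j))"
  using assms by (simp add: scalar_prod_def atLeast0LessThan)

text \<open>The factor at position \<open>t\<close> acts on the row index and the other
  \<open>n - 1\<close> factors on the column index. With \<open>M\<close> this relates rows of the
  signature to rows of \<open>M\<close>; with \<open>M'\<close> it yields the rank.\<close>

lemma matrix_form_tensor_power:
  assumes A: "A \<in> carrier_mat a k" and G: "G \<in> carrier_vec (k ^ n)" and t: "1 \<le> t" "t \<le> n"
  shows "matrix_form a n (tensor_power A n *\<^sub>v G) t =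
         A * (matrix_form k n G t * transpose_mat (tensor_power A (n - 1)))"
proof (rule eq_matI)
  let ?m = "n - 1"
  have n: "n = Suc ?m" using t by simp
  have T: "tensor_power A ?m \<in> carrier_mat (a ^ ?m) (k ^ ?m)" using A by simp
  have mf: "matrix_form k n G t \<in> carrier_mat k (k ^ ?m)" by (simp add: matrix_form_def)
  show "dim_row (matrix_form a n (tensor_power A n *\<^sub>v G) t) =
      dim_row (A * (matrix_form k n G t * transpose_mat (tensor_power A ?m)))"
    "dim_col (matrix_form a n (tensor_power A n *\<^sub>v G) t) =
      dim_col (A * (matrix_form k n G t * transpose_mat (tensor_power A ?m)))"
    using A carrier_matD[OF T] by (simp_all add: matrix_form_def)
  fix r c assume "r < dim_row (A * (matrix_form k n G t * transpose_mat (tensor_power A ?m)))"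
    "c < dim_col (A * (matrix_form k n G t * transpose_mat (tensor_power A ?m)))"
  then have r: "r < a" and c: "c < a ^ ?m" using A carrier_matD[OF T] by auto
  define cs where "cs = lex_tuple a ?m c"
  have cs: "cs \<in> tuples a ?m" and lcs: "lex_index a cs = c"
    using lex_tuple_in_tuples[OF c] lex_index_lex_tuple'[OF c] by (simp_all add: cs_def)
  have ins: "insert_at (t - 1) r cs \<in> tuples a n"
    using insert_at_in_tuples[OF r cs] n by metis
  have split: "entry_prod A (insert_at (t - 1) r cs) (insert_at (t - 1) x ys) =
      A $$ (r, x) * entry_prod A cs ys" if "ys \<in> tuples k ?m" for x ys
  proof -
    have len: "length cs = length ys" using cs that by (simp add: tuples_def)
    have "entry_prod A cs ys = entry_prod A (take (t - 1) cs) (take (t - 1) ys) *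
        entry_prod A (drop (t - 1) cs) (drop (t - 1) ys)"
      using entry_prod_append[of "take (t - 1) cs" "take (t - 1) ys" A
          "drop (t - 1) cs" "drop (t - 1) ys"] len by simp
    then show ?thesis
      using len by (simp add: insert_at_def entry_prod_append)
  qed
  have "matrix_form a n (tensor_power A n *\<^sub>v G) t $$ (r, c) =
      vec_index (tensor_power A n *\<^sub>v G) (lex_index a (insert_at (t - 1) r cs))"
    using r c by (simp add: matrix_form_def Let_def cs_def insert_at_def)
  also have "\<dots> = (\<Sum>js\<in>tuples k (Suc ?m). entry_prod A (insert_at (t - 1) r cs) js *
      vec_index G (lex_index k js))"
    using tensor_power_mult_vec_index[OF A G ins] n by metis
  also have "\<dots> = (\<Sum>x<k. \<Sum>ys\<in>tuples k ?m. entry_prod A (insert_at (t - 1) r cs) (insert_at (t - 1) x ys) *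
      vec_index G (lex_index k (insert_at (t - 1) x ys)))"
    by (rule sum_insert_at) (use t in simp)
  also have "\<dots> = (\<Sum>x<k. A $$ (r, x) *
      (\<Sum>ys\<in>tuples k ?m. vec_index G (lex_index k (insert_at (t - 1) x ys)) * entry_prod A cs ys))"
    by (simp add: split[simplified] sum_distrib_left mult_ac)
  also have "\<dots> = (\<Sum>x<k. A $$ (r, x) *
      (matrix_form k n G t * transpose_mat (tensor_power A ?m)) $$ (x, c))"
  proof (intro sum.cong refl arg_cong2[where f = "(*)"])
    fix x assume "x \<in> {..<k}"
    then have x: "x < k" by simp
    have "(matrix_form k n G t * transpose_mat (tensor_power A ?m)) $$ (x, c) =
        (\<Sum>y = 0..<k ^ ?m. matrix_form k n G t $$ (x, y) * tensor_power A ?m $$ (c, y))"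
      using x c T mf by (simp add: scalar_prod_def)
    also have "\<dots> = (\<Sum>ys\<in>tuples k ?m. matrix_form k n G t $$ (x, lex_index k ys) *
        tensor_power A ?m $$ (c, lex_index k ys))"
      by (rule sum_lex_index)
    also have "\<dots> = (\<Sum>ys\<in>tuples k ?m.
        vec_index G (lex_index k (insert_at (t - 1) x ys)) * entry_prod A cs ys)"
    proof (rule sum.cong[OF refl])
      fix ys assume ys: "ys \<in> tuples k ?m"
      have "tensor_power A ?m $$ (c, lex_index k ys) = entry_prod A cs ys"
        using tensor_power_index[OF A cs ys] lcs by simp
      moreover have "matrix_form k n G t $$ (x, lex_index k ys) =
          vec_index G (lex_index k (insert_at (t - 1) x ys))"
        using x lex_index_less[OF ys]
        by (simp add: matrix_form_def Let_def lex_tuple_lex_index[OF ys, simplified] insert_at_def)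
      ultimately show "matrix_form k n G t $$ (x, lex_index k ys) *
          tensor_power A ?m $$ (c, lex_index k ys) =
          vec_index G (lex_index k (insert_at (t - 1) x ys)) * entry_prod A cs ys" by simp
    qed
    finally show "(\<Sum>ys\<in>tuples k ?m. vec_index G (lex_index k (insert_at (t - 1) x ys)) * entry_prod A cs ys) =
        (matrix_form k n G t * transpose_mat (tensor_power A ?m)) $$ (x, c)" ..
  qed
  also have "\<dots> = (A * (matrix_form k n G t * transpose_mat (tensor_power A ?m))) $$ (r, c)"
    by (rule mult_mat_index_sum[OF A mult_carrier_mat[OF mf] r c, symmetric]) (use T in simp)
  finally show "matrix_form a n (tensor_power A n *\<^sub>v G) t $$ (r, c) =
      (A * (matrix_form k n G t * transpose_mat (tensor_power A ?m))) $$ (r, c)" .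
qed

section \<open>Multiplicativity of tensor powers\<close>

lemma entry_prod_mult:
  assumes A: "A \<in> carrier_mat a b" and B: "B \<in> carrier_mat b c"
    and "is \<in> tuples a n" "js \<in> tuples c n"
  shows "entry_prod (A * B) is js = (\<Sum>ks\<in>tuples b n. entry_prod A is ks * entry_prod B ks js)"
  using assms(3,4)
proof (induction n arbitrary: "is" js)
  case 0
  have "tuples b 0 = {[]}" by (auto simp: tuples_def)
  then show ?case using 0 by (simp add: tuples_def)
next
  case (Suc n)
  obtain i is' where i: "is = i # is'" "i < a" "is' \<in> tuples a n"
    using Suc.prems(1) by (cases "is") (auto simp: tuples_def)
  obtain j js' where j: "js = j # js'" "j < c" "js' \<in> tuples c n"
    using Suc.prems(2) by (cases js) (auto simp: tuples_def)
  have "(A * B) $$ (i, j) = (\<Sum>k<b. A $$ (i, k) * B $$ (k, j))"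
    using A B i j by (simp add: scalar_prod_def atLeast0LessThan)
  then have "entry_prod (A * B) is js =
      (\<Sum>k<b. \<Sum>ks\<in>tuples b n. (A $$ (i, k) * B $$ (k, j)) * (entry_prod A is' ks * entry_prod B ks js'))"
    using Suc.IH[OF i(3) j(3)] by (simp add: i(1) j(1) sum_product)
  also have "\<dots> = (\<Sum>k<b. \<Sum>ks\<in>tuples b n.
      entry_prod A is (insert_at 0 k ks) * entry_prod B (insert_at 0 k ks) js)"
    by (simp add: i(1) j(1) insert_at_def mult_ac)
  also have "\<dots> = (\<Sum>ks\<in>tuples b (Suc n). entry_prod A is ks * entry_prod B ks js)"
    by (rule sum_insert_at[symmetric]) simp
  finally show ?case .
qed

text \<open>Together with \<open>tensor_power_one\<close> this turns an inverse of a matrix into an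
  inverse of its tensor power.\<close>

lemma tensor_power_mult:
  assumes A: "A \<in> carrier_mat a b" and B: "B \<in> carrier_mat b c"
  shows "tensor_power (A * B) n = tensor_power A n * tensor_power B n"
proof (rule eq_matI)
  have TA: "tensor_power A n \<in> carrier_mat (a ^ n) (b ^ n)"
    and TB: "tensor_power B n \<in> carrier_mat (b ^ n) (c ^ n)"
    and TAB: "tensor_power (A * B) n \<in> carrier_mat (a ^ n) (c ^ n)" and AB: "A * B \<in> carrier_mat a c"
    using A B by auto
  show "dim_row (tensor_power (A * B) n) = dim_row (tensor_power A n * tensor_power B n)"
    "dim_col (tensor_power (A * B) n) = dim_col (tensor_power A n * tensor_power B n)"
    using TA TB TAB by auto
  fix i j assume "i < dim_row (tensor_power A n * tensor_power B n)"
    "j < dim_col (tensor_power A n * tensor_power B n)"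
  then have i: "i < a ^ n" and j: "j < c ^ n" using TA TB by auto
  define is' js' where "is' = lex_tuple a n i" and "js' = lex_tuple c n j"
  have is': "is' \<in> tuples a n" "lex_index a is' = i" and js': "js' \<in> tuples c n" "lex_index c js' = j"
    using lex_tuple_in_tuples lex_index_lex_tuple' i j by (auto simp: is'_def js'_def)
  have "(tensor_power A n * tensor_power B n) $$ (i, j) =
      (\<Sum>k = 0..<b ^ n. tensor_power A n $$ (i, k) * tensor_power B n $$ (k, j))"
    using i j TA TB by (simp add: scalar_prod_def)
  also have "\<dots> = (\<Sum>ks\<in>tuples b n. entry_prod A is' ks * entry_prod B ks js')"
    using tensor_power_index[OF A is'(1)] tensor_power_index[OF B _ js'(1)] is'(2) js'(2)
    by (simp add: sum_lex_index)
  also have "\<dots> = tensor_power (A * B) n $$ (i, j)"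
    using entry_prod_mult[OF A B is'(1) js'(1)] tensor_power_index[OF AB is'(1) js'(1)] is'(2) js'(2)
    by simp
  finally show "tensor_power (A * B) n $$ (i, j) = (tensor_power A n * tensor_power B n) $$ (i, j)" ..
qed

lemma kron_mat_one: "kron_mat (1\<^sub>m a) (1\<^sub>m b) = 1\<^sub>m (a * b)"
proof (rule eq_matI)
  fix i j assume "i < dim_row (1\<^sub>m (a * b) :: complex Matrix.mat)" "j < dim_col (1\<^sub>m (a * b) :: complex Matrix.mat)"
  then have ij: "i < a * b" "j < a * b" by auto
  then have "0 < b" by (cases b) auto
  then have "i div b < a" "j div b < a" "i mod b < b" "j mod b < b"
    using ij by (auto simp: less_mult_imp_div_less)
  moreover have "i = j \<longleftrightarrow> i div b = j div b \<and> i mod b = j mod b"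
    by (metis div_mult_mod_eq)
  ultimately show "kron_mat (1\<^sub>m a) (1\<^sub>m b) $$ (i, j) = (1\<^sub>m (a * b) :: complex Matrix.mat) $$ (i, j)"
    using ij by (auto simp: kron_mat_def)
qed (auto simp: kron_mat_def)

lemma tensor_power_one: "tensor_power (1\<^sub>m k) n = 1\<^sub>m (k ^ n)"
  by (induction n) (simp_all add: kron_mat_one)

section \<open>Rank and minors\<close>

text \<open>Rank equal to the number of rows means that the columns span, that is, that the linear
  map is onto. In this form the effect of invertible factors is a matter of solving
  equations.\<close>

lemma rank_eq_dim_row_iff:
  fixes A :: "complex Matrix.mat"
  assumes A: "A \<in> carrier_mat n nc"
  shows "vec_space.rank n A = n \<longleftrightarrow>
    (\<forall>y\<in>carrier_vec n. \<exists>x\<in>carrier_vec nc. A *\<^sub>v x = y)"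
proof -
  interpret vec_space "TYPE(complex)" n .
  have col: "col_space A = {y\<in>carrier_vec n. \<exists>x\<in>carrier_vec nc. A *\<^sub>v x = y}"
    using col_space_eq[OF A] A by simp
  have sub: "set (cols A) \<subseteq> carrier_vec n" using cols_dim A by blast
  have "rank A = n \<longleftrightarrow> span (set (cols A)) = carrier_vec n"
  proof
    assume r: "rank A = n"
    obtain S where S: "finite S" "maximal S (\<lambda>T. T \<subseteq> set (cols A) \<and> lin_indpt T)"
      using maximal_exists_superset[of "set (cols A)" "\<lambda>T. T \<subseteq> set (cols A) \<and> lin_indpt T" "{}"]
      by (auto simp: lin_dep_def)
    then have S': "S \<subseteq> set (cols A)" "lin_indpt S" by (auto simp: maximal_def)
    have "card S = n" using rank_card_indpt[OF A S(2)] r by simp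
    then have "basis S"
      using S(1) S' sub by (intro dim_li_is_basis) (auto simp: dim_is_n)
    then have "carrier_vec n \<subseteq> span (set (cols A))"
      using span_is_monotone[OF S'(1)] by (auto simp: basis_def)
    then show "span (set (cols A)) = carrier_vec n"
      using span_is_subset2[OF sub] by auto
  next
    assume "span (set (cols A)) = carrier_vec n"
    then have "span_vs (set (cols A)) = V" by simp
    then show "rank A = n" unfolding rank_def using dim_is_n by simp
  qed
  then show ?thesis unfolding col[unfolded col_space_def] by blast
qed

text \<open>To reach \<open>y\<close>, solve \<open>A *\<^sub>v x = P' *\<^sub>v y\<close> and apply
  \<open>Q'\<close> to the solution.\<close>

lemma rank_mult_invertible:
  fixes A :: "complex Matrix.mat"
  assumes A: "A \<in> carrier_mat k N" and rank: "vec_space.rank k A = k"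
    and P: "P \<in> carrier_mat k k" "P' \<in> carrier_mat k k" "P * P' = 1\<^sub>m k"
    and Q: "Q \<in> carrier_mat N N" "Q' \<in> carrier_mat N N" "Q * Q' = 1\<^sub>m N"
  shows "vec_space.rank k (P * (A * Q)) = k"
proof -
  have "\<exists>x\<in>carrier_vec N. P * (A * Q) *\<^sub>v x = y" if y: "y \<in> carrier_vec k" for y
  proof -
    obtain x where x: "x \<in> carrier_vec N" "A *\<^sub>v x = P' *\<^sub>v y"
      using rank rank_eq_dim_row_iff[OF A] P(2) y by (meson mult_mat_vec_carrier)
    have "P * (A * Q) *\<^sub>v (Q' *\<^sub>v x) = P *\<^sub>v ((A * Q) *\<^sub>v (Q' *\<^sub>v x))"
      using A P Q x by (intro assoc_mult_mat_vec) auto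
    also have "(A * Q) *\<^sub>v (Q' *\<^sub>v x) = A *\<^sub>v (Q *\<^sub>v (Q' *\<^sub>v x))"
      using A Q x by (intro assoc_mult_mat_vec) auto
    also have "Q *\<^sub>v (Q' *\<^sub>v x) = (Q * Q') *\<^sub>v x"
      using Q x by (intro assoc_mult_mat_vec[symmetric]) auto
    also have "\<dots> = x" using Q x by simp
    also have "P *\<^sub>v (A *\<^sub>v x) = (P * P') *\<^sub>v y"
      unfolding x(2) using P y by (intro assoc_mult_mat_vec[symmetric]) auto
    also have "\<dots> = y" using P y by simp
    finally show ?thesis using Q(2) x(1) by (intro bexI[of _ "Q' *\<^sub>v x"]) auto
  qed
  moreover have "P * (A * Q) \<in> carrier_mat k N" using P A Q by auto
  ultimately show ?thesis using rank_eq_dim_row_iff by blast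
qed

lemma lin_indpt_pair_minor:
  assumes uv: "u \<in> carrier_vec N" "v \<in> carrier_vec N" and indpt: "lin_indpt_pair u v"
  obtains c d where "c < N" "d < N"
    "vec_index u c * vec_index v d \<noteq> vec_index u d * vec_index v c"
proof -
  note minor = that
  show thesis
proof (rule ccontr)
  assume no: "\<not> thesis"
  have eq: "vec_index u c * vec_index v d = vec_index u d * vec_index v c" if cd: "c < N" "d < N" for c d
    using no minor[OF cd] by blast
  interpret vec_space "TYPE(complex)" N .
  \<comment> \<open>A nonzero kernel vector of this matrix makes its columns dependent as soon as
    they are distinct, which is the clause \<open>u \<noteq> v\<close> of
    \<open>lin_indpt_pair\<close>.\<close>
  define A where "A = mat_of_cols N [u, v]"
  have A: "A \<in> carrier_mat N 2"
    using mat_of_cols_carrier(1)[of N "[u, v]"] by (simp add: A_def numeral_2_eq_2)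
  have cols: "cols A = [u, v]" using uv by (simp add: A_def)
  have mult: "A *\<^sub>v Matrix.vec 2 (\<lambda>i. if i = 0 then a else b) = 0\<^sub>v N"
    if "\<And>d. d < N \<Longrightarrow> vec_index u d * a + vec_index v d * b = 0" for a b
    using that by (intro eq_vecI) (simp_all add: A_def scalar_prod_def mat_of_cols_def numeral_2_eq_2)
  have "\<exists>a b. (a \<noteq> 0 \<or> b \<noteq> 0) \<and> (\<forall>d<N. vec_index u d * a + vec_index v d * b = 0)"
  proof (cases "\<exists>c<N. vec_index u c \<noteq> 0")
    case True
    then obtain c where c: "c < N" "vec_index u c \<noteq> 0" by blast
    \<comment> \<open>The vanishing minors with column \<open>c\<close>, read as a linear relation
      between \<open>u\<close> and \<open>v\<close>.\<close>
    have "\<forall>d<N. vec_index u d * vec_index v c + vec_index v d * (- vec_index u c) = 0"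
      using eq[OF c(1)] by (simp add: mult.commute)
    moreover have "- vec_index u c \<noteq> 0" using c(2) by simp
    ultimately show ?thesis by blast
  next
    case False
    then show ?thesis by (intro exI[of _ 1] exI[of _ 0]) simp
  qed
  then obtain a b where ab: "a \<noteq> 0 \<or> b \<noteq> 0" "\<And>d. d < N \<Longrightarrow> vec_index u d * a + vec_index v d * b = 0"
    by blast
  define x where "x = Matrix.vec 2 (\<lambda>i::nat. if i = 0 then a else b)"
  have "vec_index x 0 = a" "vec_index x 1 = b" by (simp_all add: x_def)
  then have "x \<noteq> 0\<^sub>v 2" using ab(1) by auto
  moreover have "x \<in> carrier_vec 2" by (simp add: x_def)
  moreover have "distinct (cols A)" using indpt by (simp add: cols lin_indpt_pair_def)
  moreover have "A *\<^sub>v x = 0\<^sub>v N" unfolding x_def using mult ab(2) by blast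
  ultimately have "lin_dep (set (cols A))" using lin_depI[OF A] by blast
  then show False
    using indpt uv(1) by (simp add: cols lin_indpt_pair_def)
qed
qed

section \<open>Independence of the four rows\<close>

abbreviation toggle :: "nat set \<Rightarrow> nat \<Rightarrow> nat set" where
  "toggle X p \<equiv> (X - {p}) \<union> ({p} - X)"

lemma matchgate_function_noncrossing_outputs:
  assumes "matchgate_function m \<Gamma>"
  obtains H :: "nat wgraph" and outs where "noncrossing_outputs H outs" "length outs = m"
    "\<And>X. X \<subseteq> {..<m} \<Longrightarrow> \<Gamma> X = removal_sum H outs X"
  using assms generator_matchgate_noncrossing_outputs unfolding matchgate_function_def by metis

lemma matchgate_function_identity:
  assumes \<Gamma>: "matchgate_function m \<Gamma>" and A: "A \<subseteq> {..<m}" and B: "B \<subseteq> {..<m}"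
    and P: "P = (A - B) \<union> (B - A)"
  shows "(\<Sum>p\<in>P. (-1) ^ card {q\<in>P. q < p} * (\<Gamma> (toggle A p) * \<Gamma> (toggle B p))) = 0"
proof -
  obtain H :: "nat wgraph" and outs where H: "noncrossing_outputs H outs" "length outs = m"
    and eq: "\<And>X. X \<subseteq> {..<m} \<Longrightarrow> \<Gamma> X = removal_sum H outs X"
    using matchgate_function_noncrossing_outputs[OF \<Gamma>] by blast
  have "(\<Sum>p\<in>P. (-1) ^ card {q\<in>P. q < p} * (\<Gamma> (toggle A p) * \<Gamma> (toggle B p))) =
    (\<Sum>p\<in>P. (-1) ^ card {q\<in>P. q < p} *
       (removal_sum H outs (toggle A p) * removal_sum H outs (toggle B p)))"
  proof (rule sum.cong[OF refl])
    fix p assume "p \<in> P"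
    then have "toggle A p \<subseteq> {..<m}" "toggle B p \<subseteq> {..<m}" using A B unfolding P by auto
    then show "(-1) ^ card {q\<in>P. q < p} * (\<Gamma> (toggle A p) * \<Gamma> (toggle B p)) =
      (-1) ^ card {q\<in>P. q < p} * (removal_sum H outs (toggle A p) * removal_sum H outs (toggle B p))"
      using eq by simp
  qed
  then show ?thesis
    using noncrossing_outputs.matchgate_identity[OF H(1), of A B P] A B P H(2) by simp
qed

lemma matchgate_function_parity:
  assumes "matchgate_function m \<Gamma>" "X \<subseteq> {..<m}" "Y \<subseteq> {..<m}" "\<Gamma> X \<noteq> 0" "\<Gamma> Y \<noteq> 0"
  shows "even (card X) \<longleftrightarrow> even (card Y)"
proof -
  obtain H :: "nat wgraph" and outs where "noncrossing_outputs H outs" "length outs = m"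
    "\<And>X. X \<subseteq> {..<m} \<Longrightarrow> \<Gamma> X = removal_sum H outs X"
    using matchgate_function_noncrossing_outputs[OF assms(1)] by blast
  then show ?thesis
    using noncrossing_outputs.removal_sum_parity[of H outs] assms by metis
qed

text \<open>A minor of the \<open>t\<close>-th matrix form: \<open>R\<close> and \<open>T\<close>
  are rows, given by the removed outputs of block \<open>t\<close>, and \<open>b\<close> and
  \<open>c\<close> are columns, given by the removed outputs elsewhere.\<close>

definition two_minor :: "(nat set \<Rightarrow> complex) \<Rightarrow> nat set \<Rightarrow> nat set \<Rightarrow> nat set \<Rightarrow> nat set \<Rightarrow> complex" where
  "two_minor \<Gamma> R T b c = \<Gamma> (R \<union> b) * \<Gamma> (T \<union> c) - \<Gamma> (R \<union> c) * \<Gamma> (T \<union> b)"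

text \<open>A single identity would only show that some product of an entry of the row
  \<open>toggle S p1\<close> and an entry of the row \<open>toggle S p2\<close> is nonzero.
  Interchanging \<open>b\<close> and \<open>c\<close> negates the given minor, and the difference of
  the two identities has minors on both sides.\<close>

lemma adjacent_two_minor:
  assumes \<Gamma>: "matchgate_function m \<Gamma>" and hi: "hi \<le> m" and S: "S \<subseteq> {lo..<hi}"
    and b: "b \<subseteq> {..<m} - {lo..<hi}" and c: "c \<subseteq> {..<m} - {lo..<hi}"
    and p: "lo \<le> p1" "p1 < p2" "p2 < hi"
    and minor: "two_minor \<Gamma> S (toggle (toggle S p1) p2) b c \<noteq> 0"
  obtains p where "p \<in> (b - c) \<union> (c - b)"
    "two_minor \<Gamma> (toggle S p1) (toggle S p2) (toggle b p) (toggle c p) \<noteq> 0"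
proof -
  define Q where "Q = (b - c) \<union> (c - b)"
  define P where "P = {p1, p2} \<union> Q"
  define s where "s p = ((-1) ^ card {q\<in>P. q < p} :: complex)" for p
  have Qm: "Q \<subseteq> {..<m} - {lo..<hi}" using b c by (auto simp: Q_def)
  have finQ: "finite Q" by (rule finite_subset[OF Qm]) simp
  \<comment> \<open>The block contains no further element of \<open>P\<close>, so \<open>p1\<close>
    and \<open>p2\<close> are neighbours in \<open>P\<close> and carry opposite signs.\<close>
  have "{q\<in>P. q < p2} = insert p1 {q\<in>P. q < p1}"
    using p Qm by (auto simp: P_def)
  then have s2: "s p2 = - s p1"
    using finQ by (simp add: s_def P_def)
  \<comment> \<open>The identity for \<open>toggle S p1 \<union> x\<close> and
    \<open>toggle S p2 \<union> y\<close>. Its terms \<open>p1\<close> and \<open>p2\<close> lead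
    back to the rows \<open>S\<close> and \<open>toggle (toggle S p1) p2\<close>; the terms from
    \<open>Q\<close> toggle a position in both columns.\<close>
  have one: "s p1 * (\<Gamma> (S \<union> x) * \<Gamma> (toggle (toggle S p1) p2 \<union> y) -
        \<Gamma> (toggle (toggle S p1) p2 \<union> x) * \<Gamma> (S \<union> y)) +
      (\<Sum>p\<in>Q. s p * (\<Gamma> (toggle S p1 \<union> toggle x p) * \<Gamma> (toggle S p2 \<union> toggle y p))) = 0"
    if xy: "x \<subseteq> {..<m} - {lo..<hi}" "y \<subseteq> {..<m} - {lo..<hi}" "Q = (x - y) \<union> (y - x)" for x y
  proof -
    let ?A = "toggle S p1 \<union> x" and ?B = "toggle S p2 \<union> y"
    have AB: "?A \<subseteq> {..<m}" "?B \<subseteq> {..<m}" using S xy p hi by auto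
    have nS: "q \<notin> S" "q \<noteq> p1" "q \<noteq> p2" if "q \<in> x \<union> y" for q
      using that S xy(1,2) p by auto
    have np: "p1 \<notin> x \<union> y" "p2 \<notin> x \<union> y" using nS by blast+
    have PAB: "P = (?A - ?B) \<union> (?B - ?A)"
      using nS p(2) unfolding P_def xy(3) by auto
    have t1: "toggle ?A p1 = S \<union> x" "toggle ?B p1 = toggle (toggle S p1) p2 \<union> y"
      "toggle ?A p2 = toggle (toggle S p1) p2 \<union> x" "toggle ?B p2 = S \<union> y"
      using np p(2) by auto
    have t2: "toggle ?A q = toggle S p1 \<union> toggle x q" "toggle ?B q = toggle S p2 \<union> toggle y q"
      if "q \<in> Q" for q
      using nS[of q] that xy(3) by auto
    have "0 = (\<Sum>p\<in>P. s p * (\<Gamma> (toggle ?A p) * \<Gamma> (toggle ?B p)))"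
      using matchgate_function_identity[OF \<Gamma> AB PAB] by (simp add: s_def)
    also have "\<dots> = s p1 * (\<Gamma> (toggle ?A p1) * \<Gamma> (toggle ?B p1)) +
        s p2 * (\<Gamma> (toggle ?A p2) * \<Gamma> (toggle ?B p2)) +
        (\<Sum>p\<in>Q. s p * (\<Gamma> (toggle ?A p) * \<Gamma> (toggle ?B p)))"
    proof -
      have "p1 \<notin> Q" "p2 \<notin> Q" "p1 \<noteq> p2" using np xy(3) p(2) by auto
      then show ?thesis using finQ by (simp add: P_def)
    qed
    also have "(\<Sum>p\<in>Q. s p * (\<Gamma> (toggle ?A p) * \<Gamma> (toggle ?B p))) =
        (\<Sum>p\<in>Q. s p * (\<Gamma> (toggle S p1 \<union> toggle x p) * \<Gamma> (toggle S p2 \<union> toggle y p)))"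
      by (intro sum.cong refl) (simp only: t2)
    finally show ?thesis unfolding t1 s2 by (simp add: algebra_simps)
  qed
  have Qc: "Q = (c - b) \<union> (b - c)" by (auto simp: Q_def)
  let ?T = "toggle (toggle S p1) p2"
  let ?X = "\<lambda>x y. \<Sum>p\<in>Q. s p * (\<Gamma> (toggle S p1 \<union> toggle x p) * \<Gamma> (toggle S p2 \<union> toggle y p))"
  have X: "?X b c = - (s p1 * two_minor \<Gamma> S ?T b c)" "?X c b = s p1 * two_minor \<Gamma> S ?T b c"
  proof -
    have "s p1 * two_minor \<Gamma> S ?T b c + ?X b c = 0"
      using one[OF b c Q_def] by (simp only: two_minor_def mult.commute[of "\<Gamma> (?T \<union> b)"])
    then show "?X b c = - (s p1 * two_minor \<Gamma> S ?T b c)"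
      by (rule minus_unique[symmetric])
    have "s p1 * (- two_minor \<Gamma> S ?T b c) + ?X c b = 0"
      using one[OF c b Qc] by (simp only: two_minor_def mult.commute[of "\<Gamma> (?T \<union> c)"] minus_diff_eq)
    then have "?X c b = - (s p1 * (- two_minor \<Gamma> S ?T b c))"
      by (rule minus_unique[symmetric])
    then show "?X c b = s p1 * two_minor \<Gamma> S ?T b c"
      by (simp only: mult_minus_right minus_minus)
  qed
  have "(\<Sum>p\<in>Q. s p * two_minor \<Gamma> (toggle S p1) (toggle S p2) (toggle b p) (toggle c p)) =
      ?X b c - ?X c b"
    by (simp add: two_minor_def right_diff_distrib sum_subtractf)
  also have "\<dots> = - 2 * s p1 * two_minor \<Gamma> S ?T b c"
    unfolding X by simp
  also have "\<dots> \<noteq> 0" using minor by (simp add: s_def)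
  finally obtain p where "p \<in> Q"
    "s p * two_minor \<Gamma> (toggle S p1) (toggle S p2) (toggle b p) (toggle c p) \<noteq> 0"
    using sum.not_neutral_contains_not_neutral by blast
  then show ?thesis using that[of p] by (auto simp: Q_def)
qed

section \<open>Bits and blocks of an index\<close>

text \<open>The labels of the removed outputs, counted from 0; label 0 belongs to the most
  significant bit.\<close>

definition bit_set :: "nat \<Rightarrow> nat \<Rightarrow> nat set" where
  "bit_set m i = {j. j < m \<and> lex_tuple 2 m i ! j = 1}"

text \<open>The passage between vectors in lexicographic order and set functions, on which the
  matchgate arguments are carried out.\<close>

lemma is_generator_matchgate_signature_iff:
  "is_generator_matchgate_signature m v \<longleftrightarrow>
     (\<exists>\<Gamma>. matchgate_function m \<Gamma> \<and> v = Matrix.vec (2 ^ m) (\<lambda>i. \<Gamma> (bit_set m i)))"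
proof -
  have sig: "standard_signature H outs = Matrix.vec (2 ^ length outs) (\<lambda>i. removal_sum H outs (bit_set (length outs) i))"
    for H :: "nat wgraph" and outs
  proof -
    have "{outs ! j |j. j < length outs \<and> lex_tuple 2 (length outs) i ! j = 1} =
        (!) outs ` bit_set (length outs) i" for i
      by (auto simp: bit_set_def)
    then show ?thesis by (simp add: standard_signature_def Let_def removal_sum_def)
  qed
  have sub: "bit_set m i \<subseteq> {..<m}" for i by (auto simp: bit_set_def)
  show ?thesis
  proof
    assume "is_generator_matchgate_signature m v"
    then obtain H :: "nat wgraph" and outs where H: "generator_matchgate H outs" "length outs = m"
      and v: "v = standard_signature H outs"
      unfolding is_generator_matchgate_signature_def by blast
    have "matchgate_function m (removal_sum H outs)"
      unfolding matchgate_function_def using H by blast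
    then show "\<exists>\<Gamma>. matchgate_function m \<Gamma> \<and> v = Matrix.vec (2 ^ m) (\<lambda>i. \<Gamma> (bit_set m i))"
      using v sig[of H outs] H(2) by blast
  next
    assume "\<exists>\<Gamma>. matchgate_function m \<Gamma> \<and> v = Matrix.vec (2 ^ m) (\<lambda>i. \<Gamma> (bit_set m i))"
    then obtain \<Gamma> where "matchgate_function m \<Gamma>" and v: "v = Matrix.vec (2 ^ m) (\<lambda>i. \<Gamma> (bit_set m i))"
      by blast
    then obtain H :: "nat wgraph" and outs where H: "generator_matchgate H outs" "length outs = m"
      and \<Gamma>: "\<And>X. X \<subseteq> {..<m} \<Longrightarrow> \<Gamma> X = removal_sum H outs X"
      unfolding matchgate_function_def by blast
    have "v = standard_signature H outs"
      unfolding v sig H(2) using \<Gamma>[OF sub] by simp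
    then show "is_generator_matchgate_signature m v"
      unfolding is_generator_matchgate_signature_def using H by blast
  qed
qed

section \<open>Concatenation of blocks\<close>

lemma lex_index_append:
  "lex_index k (xs @ ys) = lex_index k xs * k ^ length ys + lex_index k ys"
  by (induction xs) (simp_all add: lex_index_Cons algebra_simps power_add)

lemma length_concat_lex_tuples: "length (concat (map (lex_tuple k l) ds)) = length ds * l"
  by (induction ds) simp_all

lemma lex_index_concat:
  assumes "ds \<in> tuples (k ^ l) n"
  shows "lex_index k (concat (map (lex_tuple k l) ds)) = lex_index (k ^ l) ds"
  using assms
proof (induction ds arbitrary: n)
  case (Cons d ds)
  then have "d < k ^ l" "ds \<in> tuples (k ^ l) (length ds)" by (auto simp: tuples_def)
  then show ?case
    using Cons.IH by (simp add: lex_index_append lex_index_Cons lex_index_lex_tuple'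
        length_concat_lex_tuples power_mult[symmetric] mult.commute)
qed simp

lemma lex_tuple_concat:
  assumes ds: "ds \<in> tuples (k ^ l) n"
  shows "lex_tuple k (n * l) (lex_index (k ^ l) ds) = concat (map (lex_tuple k l) ds)"
proof -
  have "concat (map (lex_tuple k l) ds) \<in> tuples k (n * l)"
    using ds lex_tuple_in_tuples[of _ k l] length_concat_lex_tuples[of k l ds]
    by (fastforce simp: tuples_def)
  then show ?thesis using lex_tuple_lex_index lex_index_concat[OF ds] by metis
qed

lemma nth_concat_lex_tuples:
  assumes "i < length ds" "q < l"
  shows "concat (map (lex_tuple k l) ds) ! (i * l + q) = lex_tuple k l (ds ! i) ! q"
  using assms
proof (induction ds arbitrary: i)
  case (Cons d ds)
  then show ?case by (cases i) (simp_all add: nth_append)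
qed simp

lemma block_index_less: "i < n \<Longrightarrow> q < l \<Longrightarrow> i * l + q < n * (l::nat)"
proof -
  assume "i < n" "q < l"
  then have "i * l + q < Suc i * l" by simp
  also have "\<dots> \<le> n * l" using \<open>i < n\<close> by (intro mult_le_mono1) simp
  finally show ?thesis .
qed

lemma bit_set_block:
  assumes ds: "ds \<in> tuples (2 ^ l) n" and "i < n" "q < l"
  shows "i * l + q \<in> bit_set (n * l) (lex_index (2 ^ l) ds) \<longleftrightarrow> lex_tuple 2 l (ds ! i) ! q = 1"
  using assms(2,3) lex_tuple_concat[OF ds] nth_concat_lex_tuples[of i ds q l 2] ds block_index_less
  by (simp add: bit_set_def tuples_def)

lemma block_set_eqI:
  fixes n l :: nat
  assumes "X \<subseteq> {..<n * l}" "Y \<subseteq> {..<n * l}"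
    and "\<And>i q. i < n \<Longrightarrow> q < l \<Longrightarrow> i * l + q \<in> X \<longleftrightarrow> i * l + q \<in> Y"
  shows "X = Y"
proof -
  have "j \<in> X \<longleftrightarrow> j \<in> Y" if j: "j < n * l" for j
  proof -
    have "0 < l" using j by (cases l) auto
    then have "j div l < n" "j mod l < l"
      using j by (auto simp: less_mult_imp_div_less)
    then show ?thesis using assms(3)[of "j div l" "j mod l"] by simp
  qed
  then show ?thesis using assms(1,2) by blast
qed

lemma bits_index_less: "length \<alpha> = l \<Longrightarrow> bits_index \<alpha> < 2 ^ l"
  unfolding bits_index_def by (rule lex_index_less) (auto simp: tuples_def)

lemma lex_tuple_bits_index:
  assumes "length \<alpha> = l" "q < l"
  shows "lex_tuple 2 l (bits_index \<alpha>) ! q = 1 \<longleftrightarrow> \<alpha> ! q"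
proof -
  have "map of_bool \<alpha> \<in> tuples 2 l" using assms by (auto simp: tuples_def)
  then show ?thesis
    unfolding bits_index_def using lex_tuple_lex_index[of "map of_bool \<alpha>" 2 l] assms by simp
qed

section \<open>Rows and columns of the block matrix form as sets of outputs\<close>

definition block_bits :: "nat \<Rightarrow> bool list \<Rightarrow> nat set" where
  "block_bits lo \<alpha> = {lo + q | q. q < length \<alpha> \<and> \<alpha> ! q}"

lemma block_bits_subset: "block_bits lo \<alpha> \<subseteq> {lo..<lo + length \<alpha>}"
  by (auto simp: block_bits_def)

lemma block_bits_mem: "lo + q \<in> block_bits lo \<alpha> \<longleftrightarrow> q < length \<alpha> \<and> \<alpha> ! q"
  by (auto simp: block_bits_def)

lemma insert_at_nth:
  assumes "t \<le> length js" "i \<le> length js"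
  shows "insert_at t x js ! i = (if i = t then x else insert_at t y js ! i)"
  using assms by (auto simp: insert_at_def nth_append nth_Cons')

text \<open>The outputs outside of block \<open>t\<close> that are removed in column \<open>c\<close> of the \<open>t\<close>-th matrix form;
  the digit 0 inserted for block \<open>t\<close> contributes no bits.\<close>

definition column_set :: "nat \<Rightarrow> nat \<Rightarrow> nat \<Rightarrow> nat \<Rightarrow> nat set" where
  "column_set l n t c =
     bit_set (n * l) (lex_index (2 ^ l) (insert_at (t - 1) 0 (lex_tuple (2 ^ l) (n - 1) c)))"

context
  fixes l n t :: nat
  assumes t: "1 \<le> t" "t \<le> n"
begin

lemma insert_at_lex_tuple:
  assumes "c < (2 ^ l) ^ (n - 1)" "r < 2 ^ l"
  shows "insert_at (t - 1) r (lex_tuple (2 ^ l) (n - 1) c) \<in> tuples (2 ^ l) n"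
  using insert_at_in_tuples[OF assms(2) lex_tuple_in_tuples[OF assms(1)], of "t - 1"] t by simp

text \<open>Digit \<open>t\<close> of the index contributes the bits of the row and the other digits
  those of the column, in disjoint ranges of outputs; so minors of the matrix form become instances
  of \<open>two_minor\<close>.\<close>

lemma block_matrix_form_index:
  assumes c: "c < (2 ^ l) ^ (n - 1)" and \<alpha>: "length \<alpha> = l"
  shows "block_matrix_form l n (Matrix.vec (2 ^ (n * l)) (\<lambda>i. \<Gamma> (bit_set (n * l) i))) t $$ (bits_index \<alpha>, c) =
     \<Gamma> (block_bits ((t - 1) * l) \<alpha> \<union> column_set l n t c)"
proof -
  let ?js = "lex_tuple (2 ^ l) (n - 1) c" and ?r = "bits_index \<alpha>"
  have r: "?r < 2 ^ l" using bits_index_less[OF \<alpha>] .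
  note ds = insert_at_lex_tuple[OF c r] and ds0 = insert_at_lex_tuple[OF c, of 0]
  let ?I = "lex_index (2 ^ l) (insert_at (t - 1) ?r ?js)"
  have "?I < (2 ^ l) ^ n" using lex_index_less[OF ds] .
  then have "?I < 2 ^ (n * l)" by (simp add: power_mult[symmetric] mult.commute)
  moreover have "bit_set (n * l) ?I = block_bits ((t - 1) * l) \<alpha> \<union> column_set l n t c"
  proof (rule block_set_eqI)
    show "bit_set (n * l) ?I \<subseteq> {..<n * l}" by (auto simp: bit_set_def)
    show "block_bits ((t - 1) * l) \<alpha> \<union> column_set l n t c \<subseteq> {..<n * l}"
      using block_index_less[of "t - 1" n _ l] t \<alpha>
      by (auto simp: block_bits_def column_set_def bit_set_def)
    fix i q assume iq: "i < n" "q < l"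
    have nth: "insert_at (t - 1) ?r ?js ! i = (if i = t - 1 then ?r else insert_at (t - 1) 0 ?js ! i)"
      using insert_at_nth[of "t - 1" ?js i ?r 0] t iq(1) by simp
    have nth0: "insert_at (t - 1) 0 ?js ! (t - 1) = 0"
      using t by (simp add: insert_at_def nth_append)
    have zero: "lex_tuple 2 l 0 ! q \<noteq> 1" using iq(2) by (simp add: lex_tuple_def)
    have R: "i * l + q \<in> block_bits ((t - 1) * l) \<alpha> \<longleftrightarrow> i = t - 1 \<and> \<alpha> ! q"
    proof
      assume "i * l + q \<in> block_bits ((t - 1) * l) \<alpha>"
      then obtain q' where q': "i * l + q = (t - 1) * l + q'" "q' < l" "\<alpha> ! q'"
        using \<alpha> by (auto simp: block_bits_def)
      then have "(i * l + q) div l = ((t - 1) * l + q') div l" by simp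
      then have "i = t - 1" using iq(2) q'(2) by simp
      then show "i = t - 1 \<and> \<alpha> ! q" using q' by simp
    next
      assume "i = t - 1 \<and> \<alpha> ! q"
      then show "i * l + q \<in> block_bits ((t - 1) * l) \<alpha>"
        using iq(2) \<alpha> by (simp add: block_bits_mem)
    qed
    have "i * l + q \<in> bit_set (n * l) ?I \<longleftrightarrow>
        lex_tuple 2 l (insert_at (t - 1) ?r ?js ! i) ! q = 1"
      using bit_set_block[OF ds iq] .
    moreover have "i * l + q \<in> column_set l n t c \<longleftrightarrow>
        lex_tuple 2 l (insert_at (t - 1) 0 ?js ! i) ! q = 1"
      unfolding column_set_def using bit_set_block[OF ds0 iq] by simp
    ultimately show "i * l + q \<in> bit_set (n * l) ?I \<longleftrightarrow>
        i * l + q \<in> block_bits ((t - 1) * l) \<alpha> \<union> column_set l n t c"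
      using lex_tuple_bits_index[OF \<alpha> iq(2)] nth nth0 zero R by (cases "i = t - 1") auto
  qed
  ultimately show ?thesis
    using r c by (simp add: block_matrix_form_def matrix_form_def Let_def insert_at_def)
qed

lemma column_set_subset:
  assumes c: "c < (2 ^ l) ^ (n - 1)"
  shows "column_set l n t c \<subseteq> {..<n * l} - {(t - 1) * l..<(t - 1) * l + l}"
proof
  fix j assume j: "j \<in> column_set l n t c"
  then have jn: "j < n * l" by (simp add: column_set_def bit_set_def)
  have "j \<notin> {(t - 1) * l..<(t - 1) * l + l}"
  proof
    assume "j \<in> {(t - 1) * l..<(t - 1) * l + l}"
    then obtain q where q: "j = (t - 1) * l + q" "q < l"
      by (metis add_less_cancel_left atLeastLessThan_iff le_add_diff_inverse)
    have "insert_at (t - 1) 0 (lex_tuple (2 ^ l) (n - 1) c) ! (t - 1) = 0"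
      using t by (simp add: insert_at_def nth_append)
    then have "lex_tuple 2 l 0 ! q = 1"
      using j bit_set_block[OF insert_at_lex_tuple[OF c, of 0], of "t - 1" q] q t
      unfolding column_set_def by simp
    then show False using q by (simp add: lex_tuple_def)
  qed
  then show "j \<in> {..<n * l} - {(t - 1) * l..<(t - 1) * l + l}" using jn by simp
qed

text \<open>Needed because the columns that \<open>adjacent_two_minor\<close> produces are given as
  sets, whereas a relation between rows is known for column numbers.\<close>

lemma ex_column_set:
  assumes b: "b \<subseteq> {..<n * l} - {(t - 1) * l..<(t - 1) * l + l}"
  obtains c where "c < (2 ^ l) ^ (n - 1)" "column_set l n t c = b"
proof -
  define d where "d i = bits_index (map (\<lambda>q. i * l + q \<in> b) [0..<l])" for i
  define ds where "ds = map d [0..<n]"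
  \<comment> \<open>All block digits except the one at position \<open>t - 1\<close>, which is the
    row index.\<close>
  define js where "js = take (t - 1) ds @ drop t ds"
  have d: "d i < 2 ^ l" for i unfolding d_def by (rule bits_index_less) simp
  have ds: "ds \<in> tuples (2 ^ l) n" using d by (auto simp: tuples_def ds_def)
  have js: "js \<in> tuples (2 ^ l) (n - 1)"
    using ds t by (auto simp: tuples_def js_def dest: in_set_takeD in_set_dropD)
  let ?c = "lex_index (2 ^ l) js"
  have c: "?c < (2 ^ l) ^ (n - 1)" using lex_index_less[OF js] .
  have js_eq: "lex_tuple (2 ^ l) (n - 1) ?c = js" using lex_tuple_lex_index[OF js] .
  have ins: "insert_at (t - 1) 0 js = ds[t - 1 := 0]"
    using t by (simp add: insert_at_def js_def upd_conv_take_nth_drop ds_def min_def)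
  have "column_set l n t ?c = b"
  proof (rule block_set_eqI)
    show "column_set l n t ?c \<subseteq> {..<n * l}" "b \<subseteq> {..<n * l}"
      using column_set_subset[OF c] b by auto
    fix i q assume iq: "i < n" "q < l"
    have "i * l + q \<in> column_set l n t ?c \<longleftrightarrow> lex_tuple 2 l (ds[t - 1 := 0] ! i) ! q = 1"
      using bit_set_block[OF insert_at_lex_tuple[OF c, of 0] iq]
      unfolding column_set_def js_eq ins by simp
    also have "\<dots> \<longleftrightarrow> i * l + q \<in> b"
    proof (cases "i = t - 1")
      case True
      then have "ds[t - 1 := 0] ! i = 0" using iq by (simp add: ds_def)
      moreover have "i * l + q \<notin> b" using b iq True by auto
      ultimately show ?thesis using iq by (simp add: lex_tuple_def)
    next
      case False
      then have "ds[t - 1 := 0] ! i = d i" using iq by (simp add: ds_def)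
      then show ?thesis
        using lex_tuple_bits_index[of "map (\<lambda>q. i * l + q \<in> b) [0..<l]" l q] iq by (simp add: d_def)
    qed
    finally show "i * l + q \<in> column_set l n t ?c \<longleftrightarrow> i * l + q \<in> b" .
  qed
  then show ?thesis using that c by blast
qed

end

section \<open>Parity and the two pairs of rows\<close>

lemma even_card_toggle: "finite S \<Longrightarrow> even (card (toggle S p)) \<longleftrightarrow> odd (card S)"
proof -
  assume fin: "finite S"
  show ?thesis
  proof (cases "p \<in> S")
    case True
    then have "toggle S p = S - {p}" "card S = Suc (card (S - {p}))"
      using card.remove[OF fin] by auto
    then show ?thesis by simp
  next
    case False
    then have "toggle S p = insert p S" by auto
    then show ?thesis using False fin by simp
  qed
qed

lemma homogeneous_2x2:
  fixes x y :: complex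
  assumes "x * a + y * b = 0" "x * c + y * d = 0" "a * d - c * b \<noteq> 0"
  shows "x = 0 \<and> y = 0"
proof -
  have "x * (a * d - c * b) = d * (x * a + y * b) - b * (x * c + y * d)"
    "y * (a * d - c * b) = a * (x * c + y * d) - c * (x * a + y * b)"
    by (simp_all add: algebra_simps)
  then show ?thesis using assms by simp
qed

text \<open>Each pair of rows yields a 2x2 system with nonzero determinant: in the columns
  \<open>b\<close>, \<open>c\<close> for \<open>v0\<close>, \<open>v3\<close>, then in columns from
  \<open>adjacent_two_minor\<close> for \<open>v1\<close>, \<open>v2\<close>.\<close>

lemma four_rows_independent:
  assumes \<Gamma>: "matchgate_function m \<Gamma>" and hi: "hi \<le> m" and S: "S \<subseteq> {lo..<hi}"
    and b: "b \<subseteq> {..<m} - {lo..<hi}" and c: "c \<subseteq> {..<m} - {lo..<hi}"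
    and p: "lo \<le> p1" "p1 < p2" "p2 < hi"
    and minor: "two_minor \<Gamma> S (toggle (toggle S p1) p2) b c \<noteq> 0"
    and comb: "\<And>x. x \<subseteq> {..<m} - {lo..<hi} \<Longrightarrow>
      v0 * \<Gamma> (S \<union> x) + v1 * \<Gamma> (toggle S p2 \<union> x) + v2 * \<Gamma> (toggle S p1 \<union> x) +
      v3 * \<Gamma> (toggle (toggle S p1) p2 \<union> x) = 0"
  shows "v0 = 0 \<and> v1 = 0 \<and> v2 = 0 \<and> v3 = 0"
proof -
  let ?T = "toggle (toggle S p1) p2"
  have finS: "finite S" using S finite_subset by blast
  have T: "?T \<subseteq> {lo..<hi}" and S1: "toggle S p1 \<subseteq> {lo..<hi}" and S2: "toggle S p2 \<subseteq> {lo..<hi}"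
    using S p by auto
  have fin1: "finite (toggle S p1)" using finS by simp
  have par: "even (card (R \<union> x)) \<longleftrightarrow> (even (card R) \<longleftrightarrow> even (card x))" "R \<union> x \<subseteq> {..<m}"
    if "R \<subseteq> {lo..<hi}" "x \<subseteq> {..<m} - {lo..<hi}" for R x
  proof -
    have "finite R" "finite x" "R \<inter> x = {}"
      using that finite_subset[of R "{lo..<hi}"] finite_subset[of x "{..<m}"] by auto
    then show "even (card (R \<union> x)) \<longleftrightarrow> (even (card R) \<longleftrightarrow> even (card x))"
      by (simp add: card_Un_disjoint)
    show "R \<union> x \<subseteq> {..<m}" using that hi by auto
  qed
  have eT: "even (card ?T) \<longleftrightarrow> even (card S)"
    using even_card_toggle[OF fin1] even_card_toggle[OF finS] by simp
  \<comment> \<open>A nonzero product in the minor provides a nonzero entry with which parities can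
    be compared; its two factors also show that \<open>b\<close> and \<open>c\<close> have the same
    parity.\<close>
  obtain R x where R: "R = S \<or> R = ?T" and x: "x = b \<or> x = c" and nz: "\<Gamma> (R \<union> x) \<noteq> 0"
    and bc: "even (card b) \<longleftrightarrow> even (card c)"
  proof -
    consider "\<Gamma> (S \<union> b) \<noteq> 0" "\<Gamma> (?T \<union> c) \<noteq> 0" | "\<Gamma> (S \<union> c) \<noteq> 0" "\<Gamma> (?T \<union> b) \<noteq> 0"
      using minor unfolding two_minor_def by force
    then show ?thesis
    proof cases
      case 1
      then have "even (card b) \<longleftrightarrow> even (card c)"
        using matchgate_function_parity[OF \<Gamma> par(2)[OF S b] par(2)[OF T c]] par(1)[OF S b] par(1)[OF T c] eT
        by blast
      then show ?thesis using that[of S b] 1 by blast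
    next
      case 2
      then have "even (card b) \<longleftrightarrow> even (card c)"
        using matchgate_function_parity[OF \<Gamma> par(2)[OF S c] par(2)[OF T b]] par(1)[OF S c] par(1)[OF T b] eT
        by blast
      then show ?thesis using that[of S c] 2 by blast
    qed
  qed
  \<comment> \<open>The rows \<open>toggle S p1\<close> and \<open>toggle S p2\<close> have the
    other parity, so they vanish in the columns \<open>b\<close> and \<open>c\<close> and the
    relation loses two of its four terms there.\<close>
  have zero: "\<Gamma> (R' \<union> y) = 0" if R': "R' = toggle S p1 \<or> R' = toggle S p2" and y: "y = b \<or> y = c" for R' y
  proof (rule ccontr)
    assume nz': "\<Gamma> (R' \<union> y) \<noteq> 0"
    have R's: "R' \<subseteq> {lo..<hi}" using R' S1 S2 by (elim disjE) (simp_all only:)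
    have ys: "y \<subseteq> {..<m} - {lo..<hi}" using y b c by (elim disjE) (simp_all only:)
    have Rs: "R \<subseteq> {lo..<hi}" using R S T by (elim disjE) (simp_all only:)
    have xs: "x \<subseteq> {..<m} - {lo..<hi}" using x b c by (elim disjE) (simp_all only:)
    have "even (card R') \<longleftrightarrow> odd (card S)" 
      using R' even_card_toggle[OF finS] by (elim disjE) (simp_all only:)
    moreover have "even (card R) \<longleftrightarrow> even (card S)"
      using R eT by (elim disjE) (simp_all only:)
    moreover have "even (card x) \<longleftrightarrow> even (card y)"
      using x y bc by (elim disjE) (simp_all only:)
    moreover have "even (card (R' \<union> y)) \<longleftrightarrow> even (card (R \<union> x))"
      using matchgate_function_parity[OF \<Gamma> par(2)[OF R's ys] par(2)[OF Rs xs] nz' nz] .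
    ultimately show False
      using par(1)[OF R's ys] par(1)[OF Rs xs] by blast
  qed
  have "v0 * \<Gamma> (S \<union> b) + v3 * \<Gamma> (?T \<union> b) = 0" "v0 * \<Gamma> (S \<union> c) + v3 * \<Gamma> (?T \<union> c) = 0"
    using comb[OF b] comb[OF c] zero[of "toggle S p1" b] zero[of "toggle S p2" b]
      zero[of "toggle S p1" c] zero[of "toggle S p2" c] by (simp_all only: mult_zero_right add_0_right simp_thms)
  then have v03: "v0 = 0 \<and> v3 = 0"
    by (rule homogeneous_2x2) (use minor in \<open>simp only: two_minor_def not_False_eq_True\<close>)
  obtain q where q: "q \<in> (b - c) \<union> (c - b)"
    and minor': "two_minor \<Gamma> (toggle S p1) (toggle S p2) (toggle b q) (toggle c q) \<noteq> 0"
    using adjacent_two_minor[OF \<Gamma> hi S b c p minor] .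
  have b': "toggle b q \<subseteq> {..<m} - {lo..<hi}" and c': "toggle c q \<subseteq> {..<m} - {lo..<hi}"
    using q b c by auto
  \<comment> \<open>In these columns the rows of \<open>v0\<close> and \<open>v3\<close> drop out
    because both coefficients are already known to be 0.\<close>
  have "v2 * \<Gamma> (toggle S p1 \<union> toggle b q) + v1 * \<Gamma> (toggle S p2 \<union> toggle b q) = 0"
    "v2 * \<Gamma> (toggle S p1 \<union> toggle c q) + v1 * \<Gamma> (toggle S p2 \<union> toggle c q) = 0"
    using comb[OF b'] comb[OF c'] v03
    by (simp_all only: mult_zero_left add_0_left add_0_right add.commute)
  then have "v2 = 0 \<and> v1 = 0"
    by (rule homogeneous_2x2) (use minor' in \<open>simp only: two_minor_def not_False_eq_True\<close>)
  then show ?thesis using v03 by blast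
qed

section \<open>The submatrix of four rows\<close>

lemma bxor_nth: "length \<alpha> = l \<Longrightarrow> length \<beta> = l \<Longrightarrow> q < l \<Longrightarrow> (\<alpha> \<oplus>\<^sub>b \<beta>) ! q \<longleftrightarrow> \<alpha> ! q \<noteq> \<beta> ! q"
  by (simp add: bxor_def)

lemma length_bxor [simp]: "length (\<alpha> \<oplus>\<^sub>b \<beta>) = min (length \<alpha>) (length \<beta>)"
  by (simp add: bxor_def)

lemma length_unit_bits [simp]: "length (unit_bits l p) = l"
  by (simp add: unit_bits_def)

lemma unit_bits_nth: "q < l \<Longrightarrow> unit_bits l p ! q \<longleftrightarrow> Suc q = p"
  by (simp add: unit_bits_def del: upt_Suc)

lemma length_scale_bits [simp]: "length (scale_bits b \<alpha>) = length \<alpha>"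
  by (simp add: scale_bits_def)

lemma scale_bits_nth: "q < length \<alpha> \<Longrightarrow> scale_bits b \<alpha> ! q \<longleftrightarrow> b \<and> \<alpha> ! q"
  by (simp add: scale_bits_def)

text \<open>The index of the \<open>i\<close>-th row of \<^const>\<open>four_rows\<close>; the binary digits of \<open>i\<close> are \<open>b\<^sub>1 b\<^sub>2\<close>.\<close>

definition flip_bits :: "bool list \<Rightarrow> nat \<Rightarrow> nat \<Rightarrow> nat \<Rightarrow> bool list" where
  "flip_bits \<sigma> p1 p2 i = \<sigma> \<oplus>\<^sub>b scale_bits (2 \<le> i) (unit_bits (length \<sigma>) p1)
                         \<oplus>\<^sub>b scale_bits (odd i) (unit_bits (length \<sigma>) p2)"

lemma length_flip_bits [simp]: "length (flip_bits \<sigma> p1 p2 i) = length \<sigma>"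
  by (simp add: flip_bits_def)

lemma flip_bits_nth:
  "q < length \<sigma> \<Longrightarrow> flip_bits \<sigma> p1 p2 i ! q \<longleftrightarrow>
     ((\<sigma> ! q \<noteq> (2 \<le> i \<and> Suc q = p1)) \<noteq> (odd i \<and> Suc q = p2))"
  by (simp add: flip_bits_def bxor_nth[where l = "length \<sigma>"] scale_bits_nth unit_bits_nth)

lemma four_rows_carrier: "M \<in> carrier_mat a b \<Longrightarrow> four_rows l M \<sigma> p1 p2 \<in> carrier_mat 4 b"
  using mat_of_rows_carrier(1)[of "dim_col M" "map (\<lambda>(b1, b2). Matrix.row M (bits_index
      (\<sigma> \<oplus>\<^sub>b scale_bits b1 (unit_bits l p1) \<oplus>\<^sub>b scale_bits b2 (unit_bits l p2))))
      [(False, False), (False, True), (True, False), (True, True)]"]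
  by (simp add: four_rows_def eval_nat_numeral)

lemma four_rows_index:
  assumes M: "M \<in> carrier_mat (2 ^ length \<sigma>) b" and i: "i < 4" and j: "j < b"
  shows "four_rows (length \<sigma>) M \<sigma> p1 p2 $$ (i, j) = M $$ (bits_index (flip_bits \<sigma> p1 p2 i), j)"
proof -
  have r: "bits_index (flip_bits \<sigma> p1 p2 i) < 2 ^ length \<sigma>"
    by (rule bits_index_less) simp
  consider "i = 0" | "i = 1" | "i = 2" | "i = 3" using i by linarith
  then show ?thesis
    using M j r by cases (simp_all add: four_rows_def flip_bits_def mat_of_rows_def)
qed

lemma block_bits_flip_bits:
  assumes "1 \<le> p1" "p1 < p2" "p2 \<le> length \<sigma>"
  shows "block_bits lo (flip_bits \<sigma> p1 p2 0) = block_bits lo \<sigma>"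
    and "block_bits lo (flip_bits \<sigma> p1 p2 1) = toggle (block_bits lo \<sigma>) (lo + p2 - 1)"
    and "block_bits lo (flip_bits \<sigma> p1 p2 2) = toggle (block_bits lo \<sigma>) (lo + p1 - 1)"
    and "block_bits lo (flip_bits \<sigma> p1 p2 3) = toggle (toggle (block_bits lo \<sigma>) (lo + p1 - 1)) (lo + p2 - 1)"
proof -
  have eqI: "X = Y" if "X \<subseteq> {lo..<lo + length \<sigma>}" "Y \<subseteq> {lo..<lo + length \<sigma>}"
    "\<And>q. q < length \<sigma> \<Longrightarrow> lo + q \<in> X \<longleftrightarrow> lo + q \<in> Y" for X Y :: "nat set"
  proof -
    have "j \<in> X \<longleftrightarrow> j \<in> Y" if "lo \<le> j" "j < lo + length \<sigma>" for j
      using \<open>\<And>q. q < length \<sigma> \<Longrightarrow> lo + q \<in> X \<longleftrightarrow> lo + q \<in> Y\<close>[of "j - lo"] that by simp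
    then show ?thesis using that(1,2) by (auto simp: subset_iff)
  qed
  have sub: "block_bits lo (flip_bits \<sigma> p1 p2 i) \<subseteq> {lo..<lo + length \<sigma>}" for i
    using block_bits_subset[of lo "flip_bits \<sigma> p1 p2 i"] by simp
  have mem: "lo + q \<in> block_bits lo (flip_bits \<sigma> p1 p2 i) \<longleftrightarrow>
      ((\<sigma> ! q \<noteq> (2 \<le> i \<and> Suc q = p1)) \<noteq> (odd i \<and> Suc q = p2))" if "q < length \<sigma>" for q i
    using that by (simp add: block_bits_mem flip_bits_nth)
  have S: "block_bits lo \<sigma> \<subseteq> {lo..<lo + length \<sigma>}" by (rule block_bits_subset)
  have memS: "lo + q \<in> block_bits lo \<sigma> \<longleftrightarrow> \<sigma> ! q" if "q < length \<sigma>" for q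
    using that by (simp add: block_bits_mem)
  have pq: "lo + q = lo + p1 - 1 \<longleftrightarrow> Suc q = p1" "lo + q = lo + p2 - 1 \<longleftrightarrow> Suc q = p2" for q
    using assms by auto
  have t1: "toggle X (lo + p1 - 1) \<subseteq> {lo..<lo + length \<sigma>}" "toggle X (lo + p2 - 1) \<subseteq> {lo..<lo + length \<sigma>}"
    if "X \<subseteq> {lo..<lo + length \<sigma>}" for X using assms that by auto
  have mt: "lo + q \<in> toggle X (lo + p1 - 1) \<longleftrightarrow> (lo + q \<in> X) \<noteq> (Suc q = p1)"
    "lo + q \<in> toggle X (lo + p2 - 1) \<longleftrightarrow> (lo + q \<in> X) \<noteq> (Suc q = p2)" for q X
    using pq by auto
  show "block_bits lo (flip_bits \<sigma> p1 p2 0) = block_bits lo \<sigma>"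
    by (rule eqI[OF sub S]) (simp add: mem memS)
  show "block_bits lo (flip_bits \<sigma> p1 p2 1) = toggle (block_bits lo \<sigma>) (lo + p2 - 1)"
    by (rule eqI[OF sub t1(2)[OF S]]) (simp only: mt, simp add: mem memS)
  show "block_bits lo (flip_bits \<sigma> p1 p2 2) = toggle (block_bits lo \<sigma>) (lo + p1 - 1)"
    by (rule eqI[OF sub t1(1)[OF S]]) (simp only: mt, simp add: mem memS)
  show "block_bits lo (flip_bits \<sigma> p1 p2 3) = toggle (toggle (block_bits lo \<sigma>) (lo + p1 - 1)) (lo + p2 - 1)"
    by (rule eqI[OF sub t1(2)[OF t1(1)[OF S]]]) (simp only: mt, simp add: mem memS)
qed

text \<open>The map \<open>f\<close> sends the two bits of each short block to positions
  \<open>p1\<close> and \<open>p2\<close> of the long block, counted from 0, the more significant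
  bit to \<open>p1\<close>; \<open>\<Sigma>\<close> is \<sigma> repeated in every block. The removed
  set of the long index is the image of the short one with the positions in \<open>\<Sigma>\<close>
  complemented.\<close>

lemma bit_set_flip_bits:
  assumes p: "1 \<le> p1" "p1 < p2" "p2 \<le> length \<sigma>" and "is": "is \<in> tuples 4 n"
  defines "l \<equiv> length \<sigma>"
  defines "f \<equiv> \<lambda>k. k div 2 * l + (if even k then p1 - 1 else p2 - 1)"
    and "\<Sigma> \<equiv> {j. j < n * l \<and> \<sigma> ! (j mod l)}"
    and "X \<equiv> bit_set (n * 2) (lex_index 4 is)"
  shows "bit_set (n * l) (lex_index (2 ^ l) (map (\<lambda>i. bits_index (flip_bits \<sigma> p1 p2 i)) is)) =
         (f ` X - \<Sigma>) \<union> (\<Sigma> - f ` X)"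
proof (rule block_set_eqI)
  let ?\<rho> = "\<lambda>i. bits_index (flip_bits \<sigma> p1 p2 i)"
  have \<rho>: "?\<rho> i < 2 ^ l" for i by (rule bits_index_less) (simp add: l_def)
  have len: "length is = n" using "is" by (simp add: tuples_def)
  have ds: "map ?\<rho> is \<in> tuples (2 ^ l) n" using "is" \<rho> by (auto simp: tuples_def)
  have pl: "p1 - 1 < l" "p2 - 1 < l" using p by (auto simp: l_def)
  have X2: "i * 2 + r \<in> X \<longleftrightarrow> lex_tuple 2 2 (is ! i) ! r = 1" if "i < n" "r < 2" for i r
    unfolding X_def using bit_set_block[of "is" 2 n i r] "is" that by simp
  have Xn: "k < n * 2" if "k \<in> X" for k using that by (simp add: X_def bit_set_def)
  show "bit_set (n * l) (lex_index (2 ^ l) (map ?\<rho> is)) \<subseteq> {..<n * l}"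
    by (auto simp: bit_set_def)
  have "f k < n * l" if "k \<in> X" for k
    unfolding f_def using block_index_less[of "k div 2" n _ l] Xn[OF that] pl by simp
  then show "(f ` X - \<Sigma>) \<union> (\<Sigma> - f ` X) \<subseteq> {..<n * l}" by (auto simp: \<Sigma>_def)
  fix i q assume iq: "i < n" "q < l"
  have "is ! i \<in> set is" using iq len by simp
  then have d: "is ! i < 4" using "is" by (auto simp: tuples_def)
  have b1: "i * 2 \<in> X \<longleftrightarrow> 2 \<le> is ! i"
  proof -
    have "lex_tuple 2 2 (is ! i) ! 0 = is ! i div 2 mod 2" by (simp add: lex_tuple_def)
    moreover have "is ! i div 2 mod 2 = 1 \<longleftrightarrow> 2 \<le> is ! i" using d by auto
    ultimately show ?thesis using X2[OF iq(1), of 0] by simp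
  qed
  have b2: "i * 2 + 1 \<in> X \<longleftrightarrow> odd (is ! i)"
  proof -
    have "lex_tuple 2 2 (is ! i) ! 1 = is ! i mod 2" by (simp add: lex_tuple_def)
    then show ?thesis using X2[OF iq(1), of 1] by (simp add: odd_iff_mod_2_eq_one)
  qed
  have f: "f k = i * l + q \<longleftrightarrow> (k = i * 2 \<and> Suc q = p1) \<or> (k = i * 2 + 1 \<and> Suc q = p2)" for k
  proof -
    have split: "a * l + b = i * l + q \<longleftrightarrow> a = i \<and> b = q" if b: "b < l" for a b
    proof
      assume eq: "a * l + b = i * l + q"
      have "a = (a * l + b) div l" using b by simp
      also have "\<dots> = i" unfolding eq using iq(2) by simp
      finally show "a = i \<and> b = q" using eq by simp
    qed simp
    show ?thesis
    proof (cases "even k")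
      case True
      then have "f k = i * l + q \<longleftrightarrow> k div 2 = i \<and> p1 - 1 = q"
        using split[OF pl(1)] by (simp add: f_def)
      also have "\<dots> \<longleftrightarrow> k = i * 2 \<and> Suc q = p1" using True p(1) by (auto elim!: evenE)
      finally show ?thesis using True by auto
    next
      case False
      then have "f k = i * l + q \<longleftrightarrow> k div 2 = i \<and> p2 - 1 = q"
        using split[OF pl(2)] by (simp add: f_def)
      also have "\<dots> \<longleftrightarrow> k = i * 2 + 1 \<and> Suc q = p2" using False p(1,2) by (auto elim!: oddE)
      finally show ?thesis using False by auto
    qed
  qed
  have "i * l + q \<in> f ` X \<longleftrightarrow> (\<exists>k\<in>X. f k = i * l + q)" unfolding image_iff by metis
  also have "\<dots> \<longleftrightarrow> (Suc q = p1 \<and> 2 \<le> is ! i) \<or> (Suc q = p2 \<and> odd (is ! i))"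
    unfolding f b1[symmetric] b2[symmetric] by blast
  finally have fX: "i * l + q \<in> f ` X \<longleftrightarrow> (Suc q = p1 \<and> 2 \<le> is ! i) \<or> (Suc q = p2 \<and> odd (is ! i))" .
  have \<Sigma>: "i * l + q \<in> \<Sigma> \<longleftrightarrow> \<sigma> ! q"
    using block_index_less[OF iq] iq(2) by (simp add: \<Sigma>_def)
  have "i * l + q \<in> bit_set (n * l) (lex_index (2 ^ l) (map ?\<rho> is)) \<longleftrightarrow> flip_bits \<sigma> p1 p2 (is ! i) ! q"
    using bit_set_block[OF ds iq] lex_tuple_bits_index[of "flip_bits \<sigma> p1 p2 (is ! i)" l q] iq len
    by (simp add: l_def)
  also have "\<dots> \<longleftrightarrow> (\<sigma> ! q \<noteq> (2 \<le> is ! i \<and> Suc q = p1)) \<noteq> (odd (is ! i) \<and> Suc q = p2)"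
    using iq(2) by (simp add: flip_bits_nth l_def)
  also have "\<dots> \<longleftrightarrow> i * l + q \<in> (f ` X - \<Sigma>) \<union> (\<Sigma> - f ` X)"
    using fX \<Sigma> p(2) by auto
  finally show "i * l + q \<in> bit_set (n * l) (lex_index (2 ^ l) (map ?\<rho> is)) \<longleftrightarrow>
      i * l + q \<in> (f ` X - \<Sigma>) \<union> (\<Sigma> - f ` X)" .
qed

lemma four_rows_signature:
  assumes G: "G \<in> carrier_vec (4 ^ n)" and M: "M \<in> carrier_mat (2 ^ length \<sigma>) 4"
    and sig: "is_generator_matchgate_signature (n * length \<sigma>) (tensor_power M n *\<^sub>v G)"
    and p: "1 \<le> p1" "p1 < p2" "p2 \<le> length \<sigma>"
  shows "is_generator_matchgate_signature (2 * n) (tensor_power (four_rows (length \<sigma>) M \<sigma> p1 p2) n *\<^sub>v G)"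
proof -
  let ?l = "length \<sigma>" and ?N = "four_rows (length \<sigma>) M \<sigma> p1 p2"
  let ?f = "\<lambda>k. k div 2 * ?l + (if even k then p1 - 1 else p2 - 1)"
  let ?S = "{j. j < n * ?l \<and> \<sigma> ! (j mod ?l)}"
  let ?\<rho> = "\<lambda>i. bits_index (flip_bits \<sigma> p1 p2 i)"
  obtain \<Gamma> where \<Gamma>: "matchgate_function (n * ?l) \<Gamma>"
    and v: "tensor_power M n *\<^sub>v G = Matrix.vec (2 ^ (n * ?l)) (\<lambda>i. \<Gamma> (bit_set (n * ?l) i))"
    using sig is_generator_matchgate_signature_iff by blast
  have pl: "p1 - 1 < ?l" "p2 - 1 < ?l" using p by linarith+
  \<comment> \<open>Inside a block the order comes from \<open>p1 < p2\<close>; between blocks it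
    holds because both offsets are below the block length.\<close>
  have mono: "strict_mono_on {..<n * 2} ?f"
  proof (rule strict_mono_onI)
    fix k k' :: nat assume kk: "k < k'"
    show "?f k < ?f k'"
    proof (cases "k div 2 = k' div 2")
      case True
      then have "even k" "odd k'" using kk by presburger+
      then show ?thesis using True p by simp
    next
      case False
      then have "Suc (k div 2) \<le> k' div 2" using kk by (simp add: div_le_mono le_neq_implies_less Suc_le_eq)
      then have "Suc (k div 2) * ?l \<le> k' div 2 * ?l" by (rule mult_le_mono1)
      moreover have "?f k < Suc (k div 2) * ?l" using pl by simp
      ultimately show ?thesis by linarith
    qed
  qed
  have range: "?f ` {..<n * 2} \<subseteq> {..<n * ?l}"
    using block_index_less[of _ n _ ?l] pl by auto
  \<comment> \<open>Complementing comes before restricting: the outputs that are then dropped keep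
    bit 0, which stands for their bit in \<sigma>.\<close>
  have \<Gamma>': "matchgate_function (2 * n) (\<lambda>X. \<Gamma> ((?f ` X - ?S) \<union> (?S - ?f ` X)))"
    using matchgate_function_restrict[OF matchgate_function_flips[OF \<Gamma>, of ?S] mono range]
    by (simp add: mult.commute subset_iff)
  have N: "?N \<in> carrier_mat 4 4" using four_rows_carrier[OF M] .
  have TN: "tensor_power ?N n \<in> carrier_mat (4 ^ n) (4 ^ n)" using N by simp
  have pow: "(4::nat) ^ n = 2 ^ (2 * n)" by (simp add: power_mult)
  have "tensor_power ?N n *\<^sub>v G = Matrix.vec (2 ^ (2 * n)) (\<lambda>i. \<Gamma> ((?f ` bit_set (2 * n) i - ?S) \<union> (?S - ?f ` bit_set (2 * n) i)))"
  proof (rule eq_vecI)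
    show "dim_vec (tensor_power ?N n *\<^sub>v G) = dim_vec (Matrix.vec (2 ^ (2 * n)) (\<lambda>i. \<Gamma> ((?f ` bit_set (2 * n) i - ?S) \<union> (?S - ?f ` bit_set (2 * n) i))))"
      using carrier_matD[OF TN] pow by simp
    fix I assume "I < dim_vec (Matrix.vec (2 ^ (2 * n)) (\<lambda>i. \<Gamma> ((?f ` bit_set (2 * n) i - ?S) \<union> (?S - ?f ` bit_set (2 * n) i))))"
    then have I: "I < 2 ^ (2 * n)" "I < 4 ^ n" using pow by simp_all
    define is' where "is' = lex_tuple 4 n I"
    have is': "is' \<in> tuples 4 n" "lex_index 4 is' = I"
      using lex_tuple_in_tuples lex_index_lex_tuple' I(2) by (auto simp: is'_def)
    have \<rho>: "?\<rho> i < 2 ^ ?l" for i by (rule bits_index_less) simp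
    have ds: "map ?\<rho> is' \<in> tuples (2 ^ ?l) n" using is'(1) \<rho> by (auto simp: tuples_def)
    have "lex_index (2 ^ ?l) (map ?\<rho> is') < 2 ^ (n * ?l)"
      using lex_index_less[OF ds] by (simp add: power_mult[symmetric] mult.commute)
    then have "vec_index (tensor_power ?N n *\<^sub>v G) I = \<Gamma> (bit_set (n * ?l) (lex_index (2 ^ ?l) (map ?\<rho> is')))"
      using tensor_power_rows[OF M N G is'(1) \<rho> four_rows_index[OF M]] is'(2) v by simp
    then show "vec_index (tensor_power ?N n *\<^sub>v G) I =
        vec_index (Matrix.vec (2 ^ (2 * n)) (\<lambda>i. \<Gamma> ((?f ` bit_set (2 * n) i - ?S) \<union> (?S - ?f ` bit_set (2 * n) i)))) I"
      using I(1) by (simp only: bit_set_flip_bits[OF p is'(1)] is'(2) index_vec mult.commute[of n 2])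
  qed
  then show ?thesis
    using \<Gamma>' is_generator_matchgate_signature_iff by blast
qed

text \<open>A left kernel vector of the four-row matrix is a relation between rows of
  \<open>M\<close>, hence, after multiplication by \<open>Z\<close>, between the rows of the matrix
  form with the same indices; \<open>four_rows_independent\<close> makes it zero.\<close>

lemma four_rows_invertible:
  assumes G: "G \<in> carrier_vec (4 ^ n)" and M: "M \<in> carrier_mat (2 ^ length \<sigma>) 4"
    and sig: "is_generator_matchgate_signature (n * length \<sigma>) (tensor_power M n *\<^sub>v G)"
    and t: "1 \<le> t" "t \<le> n" and \<tau>: "length \<tau> = length \<sigma>"
    and indpt: "lin_indpt_pair (block_row (length \<sigma>) n (tensor_power M n *\<^sub>v G) t \<sigma>)
                  (block_row (length \<sigma>) n (tensor_power M n *\<^sub>v G) t \<tau>)"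
    and p: "1 \<le> p1" "p1 < p2" "p2 \<le> length \<sigma>"
    and \<sigma>\<tau>: "\<sigma> \<oplus>\<^sub>b \<tau> = unit_bits (length \<sigma>) p1 \<oplus>\<^sub>b unit_bits (length \<sigma>) p2"
  obtains P where "P \<in> carrier_mat 4 4" "four_rows (length \<sigma>) M \<sigma> p1 p2 * P = 1\<^sub>m 4"
    "P * four_rows (length \<sigma>) M \<sigma> p1 p2 = 1\<^sub>m 4"
proof -
  let ?l = "length \<sigma>" and ?N = "four_rows (length \<sigma>) M \<sigma> p1 p2"
  let ?m = "n * ?l" and ?lo = "(t - 1) * ?l" and ?C = "(2 ^ ?l) ^ (n - 1)"
  let ?B = "block_matrix_form ?l n (tensor_power M n *\<^sub>v G) t"
  let ?S = "block_bits ?lo \<sigma>" and ?p1 = "?lo + p1 - 1" and ?p2 = "?lo + p2 - 1"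
  obtain \<Gamma> where \<Gamma>: "matchgate_function ?m \<Gamma>"
    and v: "tensor_power M n *\<^sub>v G = Matrix.vec (2 ^ ?m) (\<lambda>i. \<Gamma> (bit_set ?m i))"
    using sig is_generator_matchgate_signature_iff by blast
  have B: "?B \<in> carrier_mat (2 ^ ?l) ?C" by (simp add: block_matrix_form_def matrix_form_def)
  have entry: "?B $$ (bits_index \<alpha>, c) = \<Gamma> (block_bits ?lo \<alpha> \<union> column_set ?l n t c)"
    if "c < ?C" "length \<alpha> = ?l" for \<alpha> c
    unfolding v using block_matrix_form_index[OF t that] .
  have row: "block_row ?l n (tensor_power M n *\<^sub>v G) t \<alpha> \<in> carrier_vec ?C"
    "c < ?C \<Longrightarrow> vec_index (block_row ?l n (tensor_power M n *\<^sub>v G) t \<alpha>) c = \<Gamma> (block_bits ?lo \<alpha> \<union> column_set ?l n t c)"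
    if "length \<alpha> = ?l" for \<alpha> c
    using B entry that bits_index_less[OF that] unfolding block_row_def by auto
  \<comment> \<open>So \<sigma> and \<tau> index the first and the last of the four rows, which is
    the position of the given minor in \<open>four_rows_independent\<close>.\<close>
  have "\<tau> = flip_bits \<sigma> p1 p2 3"
  proof (rule nth_equalityI)
    fix q assume "q < length \<tau>"
    then have q: "q < ?l" using \<tau> by simp
    have "(\<sigma> \<oplus>\<^sub>b \<tau>) ! q = (unit_bits ?l p1 \<oplus>\<^sub>b unit_bits ?l p2) ! q" using \<sigma>\<tau> by simp
    then show "\<tau> ! q = flip_bits \<sigma> p1 p2 3 ! q"
      using q \<tau> by (simp add: bxor_nth[where l = ?l] unit_bits_nth flip_bits_nth) blast
  qed (simp add: \<tau>)
  then have T: "block_bits ?lo \<tau> = toggle (toggle ?S ?p1) ?p2"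
    using block_bits_flip_bits(4)[OF p] by simp
  obtain c d where cd: "c < ?C" "d < ?C"
    "vec_index (block_row ?l n (tensor_power M n *\<^sub>v G) t \<sigma>) c * vec_index (block_row ?l n (tensor_power M n *\<^sub>v G) t \<tau>) d \<noteq>
     vec_index (block_row ?l n (tensor_power M n *\<^sub>v G) t \<sigma>) d * vec_index (block_row ?l n (tensor_power M n *\<^sub>v G) t \<tau>) c"
    using lin_indpt_pair_minor[OF row(1) row(1) indpt] \<tau> by auto
  have minor: "two_minor \<Gamma> ?S (toggle (toggle ?S ?p1) ?p2) (column_set ?l n t c) (column_set ?l n t d) \<noteq> 0"
    using cd(3) row(2)[OF refl cd(1)] row(2)[OF refl cd(2)] row(2)[OF \<tau> cd(1)] row(2)[OF \<tau> cd(2)]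
    unfolding two_minor_def T by simp
  have hi: "?lo + ?l \<le> ?m"
  proof -
    have "?lo + ?l = Suc (t - 1) * ?l" by simp
    also have "\<dots> \<le> ?m" using t by (intro mult_le_mono1) simp
    finally show ?thesis .
  qed
  have N: "?N \<in> carrier_mat 4 4" using four_rows_carrier[OF M] .
  define Z where "Z = matrix_form 4 n G t * transpose_mat (tensor_power M (n - 1))"
  have Z: "Z \<in> carrier_mat 4 ?C"
    unfolding Z_def using carrier_matD[OF tensor_power_carrier[OF M, of "n - 1"]]
    by (intro mult_carrier_mat[of _ _ "4 ^ (n - 1)"]) (auto simp: matrix_form_def)
  have BZ: "?B = M * Z"
    unfolding block_matrix_form_def Z_def using matrix_form_tensor_power[OF M G t] .
  have "det ?N \<noteq> 0"
  proof
    assume "det ?N = 0"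
    then have "det (transpose_mat ?N) = 0" using det_transpose[OF N] by simp
    moreover have NT: "transpose_mat ?N \<in> carrier_mat 4 4" using N by simp
    ultimately obtain w where w: "w \<in> carrier_vec 4" "w \<noteq> 0\<^sub>v 4" "transpose_mat ?N *\<^sub>v w = 0\<^sub>v 4"
      using det_0_iff_vec_prod_zero_field by blast
    have Nw: "(\<Sum>i<4. vec_index w i * ?N $$ (i, x)) = 0" if x: "x < 4" for x
    proof -
      have "vec_index (transpose_mat ?N *\<^sub>v w) x = 0" using w(3) x by simp
      then show ?thesis
        using x N w(1) by (simp add: scalar_prod_def atLeast0LessThan mult.commute)
    qed
    have comb: "(\<Sum>i<4. vec_index w i * \<Gamma> (block_bits ?lo (flip_bits \<sigma> p1 p2 i) \<union> column_set ?l n t c)) = 0"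
      if c: "c < ?C" for c
    proof -
      have "\<Gamma> (block_bits ?lo (flip_bits \<sigma> p1 p2 i) \<union> column_set ?l n t c) = (\<Sum>x<4. ?N $$ (i, x) * Z $$ (x, c))"
        if i: "i < 4" for i
      proof -
        have r: "bits_index (flip_bits \<sigma> p1 p2 i) < 2 ^ ?l" by (rule bits_index_less) simp
        have "\<Gamma> (block_bits ?lo (flip_bits \<sigma> p1 p2 i) \<union> column_set ?l n t c) =
            (M * Z) $$ (bits_index (flip_bits \<sigma> p1 p2 i), c)"
          using entry[OF c, of "flip_bits \<sigma> p1 p2 i"] BZ by simp
        also have "\<dots> = (\<Sum>x<4. M $$ (bits_index (flip_bits \<sigma> p1 p2 i), x) * Z $$ (x, c))"
          by (rule mult_mat_index_sum[OF M Z r c])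
        also have "\<dots> = (\<Sum>x<4. ?N $$ (i, x) * Z $$ (x, c))"
          using four_rows_index[OF M i] by simp
        finally show ?thesis .
      qed
      then have "(\<Sum>i<4. vec_index w i * \<Gamma> (block_bits ?lo (flip_bits \<sigma> p1 p2 i) \<union> column_set ?l n t c)) =
          (\<Sum>i<4. \<Sum>x<4. (vec_index w i * ?N $$ (i, x)) * Z $$ (x, c))"
        by (simp add: sum_distrib_left mult.assoc)
      also have "\<dots> = (\<Sum>x<4. (\<Sum>i<4. vec_index w i * ?N $$ (i, x)) * Z $$ (x, c))"
        unfolding sum_distrib_right by (rule sum.swap)
      also have "\<dots> = 0" using Nw by simp
      finally show ?thesis .
    qed
    have sum4: "(\<Sum>i<4. g i) = g 0 + g 1 + g 2 + g 3" for g :: "nat \<Rightarrow> complex"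
      by (simp add: eval_nat_numeral)
    have "vec_index w 0 = 0 \<and> vec_index w 1 = 0 \<and> vec_index w 2 = 0 \<and> vec_index w 3 = 0"
    proof (rule four_rows_independent[OF \<Gamma> hi block_bits_subset column_set_subset[OF t cd(1)]
          column_set_subset[OF t cd(2)] _ _ _ minor])
      show "?lo \<le> ?p1" "?p1 < ?p2" "?p2 < ?lo + ?l" using p by auto
      fix x assume "x \<subseteq> {..<?m} - {?lo..<?lo + ?l}"
      then obtain c' where "c' < ?C" "column_set ?l n t c' = x"
        using ex_column_set[OF t] by blast
      then show "vec_index w 0 * \<Gamma> (?S \<union> x) + vec_index w 1 * \<Gamma> (toggle ?S ?p2 \<union> x) +
          vec_index w 2 * \<Gamma> (toggle ?S ?p1 \<union> x) + vec_index w 3 * \<Gamma> (toggle (toggle ?S ?p1) ?p2 \<union> x) = 0"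
        using comb[of c'] unfolding sum4 block_bits_flip_bits[OF p] by blast
    qed
    moreover have "i = 0 \<or> i = 1 \<or> i = 2 \<or> i = 3" if "i < 4" for i :: nat using that by linarith
    ultimately have "w = 0\<^sub>v 4" using w(1) by (intro eq_vecI) auto
    then show False using w(2) by simp
  qed
  \<comment> \<open>A unit of the matrix ring has a two-sided inverse, and both equations are used
    for the rank.\<close>
  then have "?N \<in> Units (ring_mat TYPE(complex) 4 ())"
    by (rule det_non_zero_imp_unit[OF N])
  then show ?thesis
    using that by (auto simp: Units_def ring_mat_def)
qed

theorem theorem5p6:
  fixes G Gu :: "complex Matrix.vec" and M M' :: "complex Matrix.mat"
    and n l t p1 p2 :: nat and \<sigma> \<tau> :: "bool list"
  assumes "generator_signature 4 n G"
    and "full_rank 4 n G"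
    and "1 \<le> t" and "t \<le> n"
    and "vec_space.rank 4 (matrix_form 4 n G t) = 4"
    and "M \<in> carrier_mat (2 ^ l) 4"
    and "vec_space.rank (2 ^ l) M = 4"
    and "Gu = tensor_power M n *\<^sub>v G"
    and "is_generator_matchgate_signature (n * l) Gu"
    and "length \<sigma> = l" and "length \<tau> = l"
    and "even (wt \<sigma>) \<longleftrightarrow> even (wt \<tau>)"
    and "lin_indpt_pair (block_row l n Gu t \<sigma>) (block_row l n Gu t \<tau>)"
    and "\<And>u v. length u = l \<Longrightarrow> length v = l \<Longrightarrow> u \<noteq> v \<Longrightarrow>
           (even (wt u) \<longleftrightarrow> even (wt v)) \<Longrightarrow>
           lin_indpt_pair (block_row l n Gu t u) (block_row l n Gu t v) \<Longrightarrow>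
           wt (\<sigma> \<oplus>\<^sub>b \<tau>) \<le> wt (u \<oplus>\<^sub>b v)"
    and "1 \<le> p1" and "p1 < p2" and "p2 \<le> l"
    and "\<sigma> \<oplus>\<^sub>b \<tau> = unit_bits l p1 \<oplus>\<^sub>b unit_bits l p2"
    and "M' = four_rows l M \<sigma> p1 p2"
  shows "is_generator_matchgate_signature (2 * n) (tensor_power M' n *\<^sub>v G) \<and>
         vec_space.rank 4 (block_matrix_form 2 n (tensor_power M' n *\<^sub>v G) t) = 4"
proof -
  have G: "G \<in> carrier_vec (4 ^ n)" using assms(1) by (simp add: generator_signature_def)
  note l = assms(10)
  have M: "M \<in> carrier_mat (2 ^ length \<sigma>) 4" using assms(6) l by simp
  have sig: "is_generator_matchgate_signature (n * length \<sigma>) (tensor_power M n *\<^sub>v G)"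
    using assms(8,9) l by simp
  have p: "1 \<le> p1" "p1 < p2" "p2 \<le> length \<sigma>" using assms(15-17) l by auto
  have M': "M' = four_rows (length \<sigma>) M \<sigma> p1 p2" using assms(19) l by simp
  have M'c: "M' \<in> carrier_mat 4 4" using four_rows_carrier[OF M] by (simp add: M')
  obtain P where P: "P \<in> carrier_mat 4 4" "M' * P = 1\<^sub>m 4" "P * M' = 1\<^sub>m 4"
    using four_rows_invertible[OF G M sig assms(3,4) _ _ p] assms(8,11,13,18) l
    unfolding M' by auto
  let ?Q = "transpose_mat (tensor_power M' (n - 1))" and ?Q' = "transpose_mat (tensor_power P (n - 1))"
  have TM: "tensor_power M' (n - 1) \<in> carrier_mat (4 ^ (n - 1)) (4 ^ (n - 1))"
    and TP: "tensor_power P (n - 1) \<in> carrier_mat (4 ^ (n - 1)) (4 ^ (n - 1))"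
    using M'c P(1) by simp_all
  \<comment> \<open>Transposition reverses the product, so this right inverse of \<open>?Q\<close>
    comes from \<open>P * M' = 1\<^sub>m 4\<close>, while the factor \<open>M'\<close> on the left
    uses \<open>M' * P = 1\<^sub>m 4\<close>.\<close>
  have "?Q * ?Q' = transpose_mat (tensor_power P (n - 1) * tensor_power M' (n - 1))"
    using transpose_mult[OF TP TM] by simp
  also have "\<dots> = 1\<^sub>m (4 ^ (n - 1))"
    unfolding tensor_power_mult[OF P(1) M'c, symmetric] P(3) tensor_power_one by simp
  finally have QQ: "?Q * ?Q' = 1\<^sub>m (4 ^ (n - 1))" .
  have "matrix_form 4 n G t \<in> carrier_mat 4 (4 ^ (n - 1))" by (simp add: matrix_form_def)
  then have "vec_space.rank 4 (M' * (matrix_form 4 n G t * ?Q)) = 4"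
    by (rule rank_mult_invertible[OF _ assms(5) M'c P(1,2) _ _ QQ]) (use TM TP in simp_all)
  then have "vec_space.rank 4 (block_matrix_form 2 n (tensor_power M' n *\<^sub>v G) t) = 4"
    using matrix_form_tensor_power[OF M'c G assms(3,4)] by (simp add: block_matrix_form_def)
  then show ?thesis
    using four_rows_signature[OF G M sig p] by (simp add: M')
qed

end
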